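(* Given any $W\in\mathbb{S}^n$ having the spectral decomposition $W=P\,\mathrm{diag}(d)P^T$, with $P\in\mathbb{R}^{n\times n}$ orthogonal and $d=(d_1,\dots,d_n)^T\in\mathbb{R}^n$, $d_1\ge\dots\ge d_n$. With $h$, $\Phi$, $\Omega$, $\mathcal{D}$ and the remaining notation as in the context, the following hold. 1. For any $\epsilon\neq0$, $\Phi$ is continuously differentiable at $(\epsilon,W)$, and it holds that $$\Phi'(\epsilon,W)(\tau,H)=P\left[\Omega(\epsilon,d)\circ(P^THP)+\tau\,\mathcal{D}(\epsilon,d)\right]P^T,\qquad\forall(\tau,H)\in\mathbb{R}\times\mathbb{S}^n.$$ 2. $\Phi$ is locally Lipschitz continuous on $\mathbb{R}\times\mathbb{S}^n$. 3. $\Phi$ is directionally differentiable at $(0,W)$, and for any $(\tau,H)\in\mathbb{R}\times\mathbb{S}^n$, it holds that $$\Phi'((0,W);(\tau,H))=\frac12\sum_{1\le k\ne j\le r}\frac{h(0,\lambda_k)-h(0,\lambda_j)}{\lambda_k-\lambda_j}\left(Q_jHQ_k+Q_kHQ_j\right)+\sum_{i\in\alpha}\left(d_i'(W;H)-\frac{|\tau|}{2}\right)p_ip_i^T+\sum_{i\in\beta}h(\tau,d_i'(W;H))\,p_ip_i^T,$$ where for any $1\le i\le n$ with $d_i=\lambda_j$ for some $1\le j\le r$, the elements of $\{d_i'(W;H):i=s_j+1,\dots,s_{j+1}\}$ are the eigenvalues of $P_j^THP_j$, arranged in decreasing order. 4. $\Phi$ is strongly semismooth on $\mathbb{R}\t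imes\mathbb{S}^n$.
   Context: $\mathbb{S}^n$ is the space of real symmetric $n\times n$ matrices; $\circ$ is the Hadamard product. Huber function: for $\epsilon\ne0$, $h(\epsilon,t)=t-|\epsilon|/2$ if $t>|\epsilon|$, $h(\epsilon,t)=t^2/(2|\epsilon|)$ if $0\le t\le|\epsilon|$, $h(\epsilon,t)=0$ if $t<0$; and $h(0,t)=\max\{0,t\}$. $h_1',h_2'$ are the partial derivatives of $h$ with respect to its first and second arguments. The map $\Phi:\mathbb{R}\times\mathbb{S}^n\to\mathbb{S}^n$ is $\Phi(\epsilon,W):=P\,\mathrm{diag}(h(\epsilon,d_1),\dots,h(\epsilon,d_n))P^T$ for $W=P\,\mathrm{diag}(d)P^T$. For $\epsilon\ne0$ and $d\in\mathbb{R}^n$: $[\Omega(\epsilon,d)]_{ij}=\frac{h(\epsilon,d_i)-h(\epsilon,d_j)}{d_i-d_j}$ if $d_i\ne d_j$ and $[\Omega(\epsilon,d)]_{ij}=h_2'(\epsilon,d_i)$ if $d_i=d_j$, $1\le i,j\le n$; $\mathcal{D}(\epsilon,d)=\mathrm{diag}(h_1'(\epsilon,d_1),\dots,h_1'(\epsilon,d_n))$. Index sets: $\alpha=\{i:d_i>0\}$, $\beta=\{i:d_i=0\}$. Let $\lambda_1>\dots>\lambda_r$ be the distinct eigenvalues of $W$ with multiplicities $m_1,\dots,m_r$; $s_1=0$, $s_j=\sum_{i=1}^{j-1}m_i$ for $j=2,\dots,r$, and $s_{r+1}=n$; $p_i$ is the $i$-th column of $P$, $P_j=(p_{s_j+1},\dots,p_{s_{j+1}})\in\mathbb{R}^{n\times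 m_j}$ and $Q_j=P_jP_j^T\in\mathbb{S}^n$ for $j=1,\dots,r$. For $H\in\mathbb{S}^n$, let $d_1(t)\ge\dots\ge d_n(t)$ be the eigenvalues of $W+tH$; $d_i'(W;H):=\lim_{t\downarrow0}(d_i(t)-d_i)/t$ (if the limit exists), $i=1,\dots,n$. Directional derivative: $\Theta'(y;h)=\lim_{t\downarrow0}(\Theta(y+th)-\Theta(y))/t$; $\Theta$ is directionally differentiable at $y$ if this limit exists for all $h$. For a locally Lipschitz continuous $\Theta$, $\partial_B\Theta(y)$ is the set of all limits $\lim_{k\to\infty}\Theta'(y^k)$ with $y^k\to y$ and $\Theta$ Fréchet-differentiable at $y^k$, and $\partial\Theta(y)=\mathrm{conv}\,\partial_B\Theta(y)$ is Clarke's generalized Jacobian. A locally Lipschitz continuous $\Theta$ is semismooth at $y$ if it is directionally differentiable at $y$ and, for any $V\in\partial\Theta(y+h)$, $\|\Theta(y+h)-\Theta(y)-Vh\|=o(\|h\|)$ as $h\to0$; it is strongly semismooth at $y$ if it is semismooth at $y$ and, for any $V\in\partial\Theta(y+h)$, $\|\Theta(y+h)-\Theta(y)-Vh\|=O(\|h\|^2)$ as $h\to0$; it is strongly semismooth on a space if it is so at every point.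
   Formalization: In item 3 the displayed formula, false for arbitrary P (W=0, P=I, τ=0, H=[[0,1],[1,0]]), is asserted for the eigenbases P of W with P_j^T H P_j = diag(d_i'(W;H)) on all blocks with λ_j ≥ 0; such a basis is shown to exist for every H. *)

theory Defs
  imports "HOL-Analysis.Analysis"
begin

section \<open>The Euclidean space of real symmetric matrices\<close>

text \<open>
  A separate type (rather than a subspace of \<^typ>\<open>real^'n^'n\<close>) so that Frechet derivatives,
  generalized Jacobians etc. are those of maps between the spaces themselves. The inner product is
  inherited from \<^typ>\<open>real^'n^'n\<close>, i.e. it is the trace inner product, and the norm is the
  Frobenius norm.
\<close>

typedef ('n::finite) symmat = "{A :: real^'n^'n. transpose A = A}"
  morphisms mat_of symmat_of
proof
  show "0 \<in> {A :: real^'n^'n. transpose A = A}"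
    by (simp add: transpose_def vec_eq_iff)
qed

setup_lifting type_definition_symmat

lemma mat_of_inject': "A = B \<longleftrightarrow> mat_of A = mat_of B"
  by (simp add: mat_of_inject)

lemma transpose_mat_of [simp]: "transpose (mat_of A) = mat_of A"
  using mat_of[of A] by simp

instantiation symmat :: (finite) real_vector
begin

lift_definition zero_symmat :: "'a symmat" is 0
  by (simp add: transpose_def vec_eq_iff)
lift_definition plus_symmat :: "'a symmat \<Rightarrow> 'a symmat \<Rightarrow> 'a symmat" is "(+)"
  by (simp add: transpose_def vec_eq_iff)
lift_definition minus_symmat :: "'a symmat \<Rightarrow> 'a symmat \<Rightarrow> 'a symmat" is "(-)"
  by (simp add: transpose_def vec_eq_iff)
lift_definition uminus_symmat :: "'a symmat \<Rightarrow> 'a symmat" is uminus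
  by (simp add: transpose_def vec_eq_iff)
lift_definition scaleR_symmat :: "real \<Rightarrow> 'a symmat \<Rightarrow> 'a symmat" is scaleR
  by (simp add: transpose_def vec_eq_iff)

instance
  by standard (transfer; simp add: algebra_simps)+

end

instantiation symmat :: (finite) real_inner
begin

lift_definition inner_symmat :: "'a symmat \<Rightarrow> 'a symmat \<Rightarrow> real" is inner .
definition norm_symmat :: "'a symmat \<Rightarrow> real" where
  "norm_symmat A = sqrt (inner A A)"
definition dist_symmat :: "'a symmat \<Rightarrow> 'a symmat \<Rightarrow> real" where
  "dist_symmat A B = norm (A - B)"
definition sgn_symmat :: "'a symmat \<Rightarrow> 'a symmat" where
  "sgn_symmat A = A /\<^sub>R norm A"
definition uniformity_symmat :: "('a symmat \<times> 'a symmat) filter" where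
  "uniformity_symmat = (INF e\<in>{0<..}. principal {(A, B). dist A B < e})"
definition open_symmat :: "'a symmat set \<Rightarrow> bool" where
  "open_symmat U \<longleftrightarrow> (\<forall>A\<in>U. \<forall>\<^sub>F (A', B) in uniformity. A' = A \<longrightarrow> B \<in> U)"

instance
proof
  fix A B C :: "'a symmat" and r :: real
  show "inner A B = inner B A" by transfer (rule inner_commute)
  show "inner (A + B) C = inner A C + inner B C" by transfer (rule inner_add_left)
  show "inner (r *\<^sub>R A) B = r * inner A B" by transfer (rule inner_scaleR_left)
  show "0 \<le> inner A A" by transfer (rule inner_ge_zero)
  show "inner A A = 0 \<longleftrightarrow> A = 0" by transfer (rule inner_eq_zero_iff)
qed (simp_all add: norm_symmat_def dist_symmat_def sgn_symmat_def uniformity_symmat_def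
      open_symmat_def)

end

lemma norm_mat_of [simp]: "norm (mat_of A) = norm A"
  unfolding norm_symmat_def norm_eq_sqrt_inner by transfer simp

lemma linear_mat_of: "linear (mat_of :: 'n::finite symmat \<Rightarrow> _)"
  by (rule linearI; transfer; simp)

lemma ex_orthonormal_basis_symmat:
  "\<exists>B :: 'n::finite symmat set. B \<noteq> {} \<and> finite B \<and>
     (\<forall>u\<in>B. \<forall>v\<in>B. inner u v = (if u = v then 1 else 0)) \<and>
     (\<forall>x. (\<forall>u\<in>B. inner x u = 0) \<longleftrightarrow> x = 0)"
proof -
  let ?S = "{A :: real^'n^'n. transpose A = A}"
  have "subspace ?S"
    by (auto simp: subspace_def transpose_def vec_eq_iff)
  then obtain C where C: "C \<subseteq> ?S" "pairwise orthogonal C" "\<And>x. x \<in> C \<Longrightarrow> norm x = 1"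
      "independent C" "span C = ?S"
    by (rule orthonormal_basis_subspace) blast
  define B where "B = symmat_of ` C"
  have "mat_of (symmat_of c) = c" if "c \<in> C" for c
    using C(1) that by (intro symmat_of_inverse) blast
  then have mB: "mat_of ` B = C"
    by (simp add: B_def image_image)
  have inB: "mat_of u \<in> C" if "u \<in> B" for u using that mB by blast
  have fin: "finite B"
    unfolding B_def using C(4) independent_imp_finite by blast
  have orth: "inner u v = (if u = v then 1 else 0)" if "u \<in> B" "v \<in> B" for u v
  proof (cases "u = v")
    case True
    then show ?thesis
      using C(3)[OF inB[OF that(1)]] by (simp add: inner_symmat.rep_eq norm_eq_1)
  next
    case False
    then show ?thesis
      using C(2) inB[OF that(1)] inB[OF that(2)]
      by (simp add: inner_symmat.rep_eq pairwise_def orthogonal_def mat_of_inject)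
  qed
  have zero: "(\<forall>u\<in>B. inner x u = 0) \<longleftrightarrow> x = 0" for x
  proof
    assume *: "\<forall>u\<in>B. inner x u = 0"
    have "\<And>c. c \<in> C \<Longrightarrow> orthogonal (mat_of x) c"
      using * mB by (auto simp: orthogonal_def inner_symmat.rep_eq)
    moreover have "mat_of x \<in> span C" using C(5) mat_of[of x] by simp
    ultimately have "orthogonal (mat_of x) (mat_of x)"
      by (meson orthogonal_to_span)
    then show "x = 0"
      by (simp add: orthogonal_def mat_of_inject' zero_symmat.rep_eq)
  qed simp
  have "B \<noteq> {}"
  proof
    assume "B = {}"
    then have "symmat_of (mat 1) = (0 :: 'n symmat)" using zero by blast
    then have "mat_of (symmat_of (mat 1)) = (0 :: real^'n^'n)"
      by (simp add: zero_symmat.rep_eq)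
    moreover have "mat_of (symmat_of (mat 1)) = (mat 1 :: real^'n^'n)"
      by (intro symmat_of_inverse) (simp add: transpose_mat)
    ultimately have "(mat 1 :: real^'n^'n) $ i $ i = 0" for i by simp
    then show False by (simp add: mat_def)
  qed
  with fin orth zero show ?thesis by (intro exI[of _ B]) simp
qed

instantiation symmat :: (finite) euclidean_space
begin

definition Basis_symmat :: "'a symmat set" where
  "Basis_symmat = (SOME B. B \<noteq> {} \<and> finite B \<and>
     (\<forall>u\<in>B. \<forall>v\<in>B. inner u v = (if u = v then 1 else 0)) \<and>
     (\<forall>x. (\<forall>u\<in>B. inner x u = 0) \<longleftrightarrow> x = 0))"

instance
proof
  note * = someI_ex[OF ex_orthonormal_basis_symmat[where 'n='a], folded Basis_symmat_def]
  show "(Basis :: 'a symmat set) \<noteq> {}" "finite (Basis :: 'a symmat set)"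
    using * by auto
  show "inner u v = (if u = v then 1 else 0)" if "u \<in> Basis" "v \<in> Basis" for u v :: "'a symmat"
    using * that by blast
  show "(\<forall>u\<in>Basis. inner x u = 0) \<longleftrightarrow> x = 0" for x :: "'a symmat"
    using * by blast
qed

end


section \<open>Spectral decompositions and eigenvalues\<close>

definition diag_mat :: "real^'n \<Rightarrow> real^'n^'n" where
  "diag_mat d = (\<chi> i j. if i = j then d $ i else 0)"

lemma transpose_diag_mat [simp]: "transpose (diag_mat d) = diag_mat d"
  by (simp add: transpose_def diag_mat_def vec_eq_iff)

definition spectral_decomp :: "'n::finite symmat \<Rightarrow> real^'n^'n \<Rightarrow> real^'n \<Rightarrow> bool" where
  "spectral_decomp W P d \<longleftrightarrow>
     orthogonal_matrix P \<and> mat_of W = P ** diag_mat d ** transpose P"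

text \<open>
  The eigenvalues of the principal submatrix of \<open>A\<close> with rows and columns in \<open>B\<close>; vectors on
  \<open>B\<close> are represented by vectors supported in \<open>B\<close>. Multiplicities are dimensions of eigenspaces, which
  for symmetric matrices agree with the algebraic ones.
\<close>

definition eigenspace_on :: "'n::finite set \<Rightarrow> real^'n^'n \<Rightarrow> real \<Rightarrow> (real^'n) set" where
  "eigenspace_on B A x =
     {v. (\<forall>i. i \<notin> B \<longrightarrow> v $ i = 0) \<and> (\<forall>i\<in>B. (A *v v) $ i = x * v $ i)}"

definition are_eigenvalues_on :: "'n::finite set \<Rightarrow> real^'n^'n \<Rightarrow> ('n \<Rightarrow> real) \<Rightarrow> bool" where
  "are_eigenvalues_on B A \<mu> \<longleftrightarrow> (\<forall>x. card {i\<in>B. \<mu> i = x} = dim (eigenspace_on B A x))"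

definition eigvals :: "'n::{finite,linorder} symmat \<Rightarrow> real^'n::{finite,linorder}" where
  "eigvals W = (THE d. antimono (($) d) \<and> are_eigenvalues_on UNIV (mat_of W) (($) d))"

lemma are_eigenvalues_on_spectral_decomp:
  fixes d :: "real^'n"
  assumes "spectral_decomp W P d"
  shows "are_eigenvalues_on UNIV (mat_of W) (($) d)"
  unfolding are_eigenvalues_on_def
proof
  fix x
  let ?Y = "{y :: real^'n. \<forall>i. i \<notin> {i. d $ i = x} \<longrightarrow> y $ i = 0}"
  have W: "mat_of W = P ** diag_mat d ** transpose P"
    and P: "transpose P ** P = mat 1" "P ** transpose P = mat 1"
    using assms by (auto simp: spectral_decomp_def orthogonal_matrix_def)
  have D: "(diag_mat d *v y) $ i = d $ i * y $ i" for y i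
    by (simp add: matrix_vector_mult_def diag_mat_def if_distrib[where f="\<lambda>z. z * _"] cong: if_cong)
  have inv: "transpose P *v (P *v y) = y" "P *v (transpose P *v y) = y" for y
    by (simp_all only: matrix_vector_mul_assoc P matrix_vector_mul_lid)
  have Wv: "mat_of W *v (P *v y) = P *v (diag_mat d *v y)" for y
    by (simp add: W matrix_vector_mul_assoc[symmetric] inv(1) del: transpose_matrix_vector)
  have iff: "P *v y \<in> eigenspace_on UNIV (mat_of W) x \<longleftrightarrow> y \<in> ?Y" for y
  proof -
    have "P *v y \<in> eigenspace_on UNIV (mat_of W) x \<longleftrightarrow> P *v (diag_mat d *v y) = P *v (x *\<^sub>R y)"
      by (simp add: eigenspace_on_def Wv vec_eq_iff[symmetric] matrix_vector_mult_scaleR)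
         (simp add: vec_eq_iff)
    also have "\<dots> \<longleftrightarrow> diag_mat d *v y = x *\<^sub>R y"
      by (metis inv(1))
    also have "\<dots> \<longleftrightarrow> y \<in> ?Y"
      by (auto simp: vec_eq_iff D)
    finally show ?thesis .
  qed
  have "eigenspace_on UNIV (mat_of W) x = (*v) P ` ?Y"
  proof
    show "eigenspace_on UNIV (mat_of W) x \<subseteq> (*v) P ` ?Y"
    proof
      fix v assume v: "v \<in> eigenspace_on UNIV (mat_of W) x"
      have "v = P *v (transpose P *v v)" by (simp only: inv)
      moreover have "transpose P *v v \<in> ?Y" using v iff[of "transpose P *v v"] by (simp only: inv)
      ultimately show "v \<in> (*v) P ` ?Y" by (rule image_eqI)
    qed
    show "(*v) P ` ?Y \<subseteq> eigenspace_on UNIV (mat_of W) x"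
      using iff by blast
  qed
  moreover have "inj ((*v) P)"
    by (rule inj_on_inverseI[where g = "(*v) (transpose P)"]) (rule inv)
  ultimately have "dim (eigenspace_on UNIV (mat_of W) x) = dim ?Y"
    by (simp only: dim_image_eq[OF matrix_vector_mul_linear] inj_on_subset[OF _ subset_UNIV])
  also have "\<dots> = card {i. d $ i = x}"
    using dim_substandard_cart[of "{i. d $ i = x}", where 'a = real]
    by (simp only: dim_vec_eq)
  finally show "card {i \<in> UNIV. d $ i = x} = dim (eigenspace_on UNIV (mat_of W) x)"
    by simp
qed

lemma antimono_le_if_same_card:
  fixes f g :: "'n::{finite,linorder} \<Rightarrow> real"
  assumes "antimono f" "antimono g" "\<And>x. card {i. f i = x} = card {i. g i = x}"
  shows "g i \<le> f i"
proof (rule ccontr)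
  assume "\<not> g i \<le> f i"
  let ?X = "{x \<in> range f \<union> range g. g i \<le> x}"
  have card_ge: "card {j. g i \<le> h j} = (\<Sum>x\<in>?X. card {j. h j = x})"
    if "range h \<subseteq> range f \<union> range g" for h :: "'n \<Rightarrow> real"
  proof -
    have "{j. g i \<le> h j} = (\<Union>x\<in>?X. {j. h j = x})"
      using subsetD[OF that rangeI] by auto
    then show ?thesis by (simp only:) (rule card_UN_disjoint; auto)
  qed
  have "card {j. g i \<le> f j} = card {j. g i \<le> g j}"
    by (simp add: card_ge assms(3))
  moreover have "{j. g i \<le> f j} \<subseteq> {j. j < i}"
  proof
    fix j assume "j \<in> {j. g i \<le> f j}"
    then have "\<not> f j \<le> f i" using \<open>\<not> g i \<le> f i\<close> by simp
    then have "\<not> i \<le> j" using antimonoD[OF \<open>antimono f\<close>] by blast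
    then show "j \<in> {j. j < i}" by simp
  qed
  moreover have "{j. j < i} \<subset> {j. g i \<le> g j}"
  proof
    show "{j. j < i} \<subseteq> {j. g i \<le> g j}"
      using antimonoD[OF \<open>antimono g\<close>] by auto
    have "i \<in> {j. g i \<le> g j}" "i \<notin> {j. j < i}" by simp_all
    then show "{j. j < i} \<noteq> {j. g i \<le> g j}" by blast
  qed
  ultimately show False
    by (metis card_mono finite leD psubset_card_mono)
qed

lemma eigvals_spectral_decomp:
  assumes "spectral_decomp W P d" "antimono (($) d)"
  shows "eigvals W = d"
  unfolding eigvals_def
proof (rule the_equality)
  show *: "antimono (($) d) \<and> are_eigenvalues_on UNIV (mat_of W) (($) d)"
    using assms are_eigenvalues_on_spectral_decomp by blast
  fix e assume e: "antimono (($) e) \<and> are_eigenvalues_on UNIV (mat_of W) (($) e)"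
  have "card {i. d $ i = x} = card {i. e $ i = x}" for x
    using * e by (simp add: are_eigenvalues_on_def)
  then show "e = d"
    using * e by (auto simp: vec_eq_iff intro!: antisym antimono_le_if_same_card)
qed

definition has_eigval_deriv ::
  "'n::{finite,linorder} symmat \<Rightarrow> 'n symmat \<Rightarrow> 'n \<Rightarrow> real \<Rightarrow> bool" where
  "has_eigval_deriv W H i l \<longleftrightarrow>
     ((\<lambda>t. (eigvals (W + t *\<^sub>R H) $ i - eigvals W $ i) / t) \<longlongrightarrow> l) (at_right 0)"

definition eigval_deriv :: "'n::{finite,linorder} symmat \<Rightarrow> 'n symmat \<Rightarrow> 'n \<Rightarrow> real" where
  "eigval_deriv W H i = (THE l. has_eigval_deriv W H i l)"

text \<open>
  The blocks of consecutive indices \<open>s\<^sub>j + 1, \<dots>, s\<^sub>j\<^sub>+\<^sub>1\<close> are addressed by the eigenvalue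
  \<open>\<lambda>\<^sub>j\<close> instead of by \<open>j\<close>. The matrix \<open>P\<^sub>j\<^sup>T H P\<^sub>j\<close> is then the principal submatrix of
  \<open>P\<^sup>T H P\<close> on the block of \<open>\<lambda>\<^sub>j\<close>, and \<open>Q\<^sub>j = P\<^sub>j P\<^sub>j\<^sup>T\<close> is \<open>eigproj P d \<lambda>\<^sub>j\<close>.
\<close>

definition block :: "real^'n \<Rightarrow> real \<Rightarrow> 'n set" where
  "block d x = {i. d $ i = x}"

definition outer :: "real^'n \<Rightarrow> real^'n \<Rightarrow> real^'n^'n" where
  "outer u v = (\<chi> i j. u $ i * v $ j)"

definition eigproj :: "real^'n^'n \<Rightarrow> real^'n \<Rightarrow> real \<Rightarrow> real^'n^'n" where
  "eigproj P d x = (\<Sum>i\<in>block d x. outer (column i P) (column i P))"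

text \<open>
  On the blocks inside \<open>S\<close>, the eigenvectors in the columns of \<open>P\<close> diagonalize \<open>H\<close>:
  \<open>P\<^sub>j\<^sup>T H P\<^sub>j\<close> is the diagonal matrix of the directional derivatives of the eigenvalues.
  Sums of \<open>d\<^sub>i'(W;H) p\<^sub>i p\<^sub>i\<^sup>T\<close> over part of the columns depend on the choice of the eigenvectors inside
  an eigenspace, and have their intended meaning for such a \<open>P\<close> only; e.g. for \<open>W = 0\<close> the \<open>p\<^sub>i\<close> have to
  be eigenvectors of \<open>H\<close>.
\<close>

definition diagonalizes_on ::
  "'n set \<Rightarrow> 'n symmat \<Rightarrow> 'n symmat \<Rightarrow>
     real^'n::{finite,linorder}^'n::{finite,linorder} \<Rightarrow> real^'n::{finite,linorder} \<Rightarrow> bool" where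
  "diagonalizes_on S W H P d \<longleftrightarrow>
     (\<forall>i\<in>S. \<forall>k\<in>S. d $ i = d $ k \<longrightarrow>
        (transpose P ** mat_of H ** P) $ i $ k = (if i = k then eigval_deriv W H i else 0))"


section \<open>Huber function and the associated matrix function\<close>

definition huber :: "real \<Rightarrow> real \<Rightarrow> real" where
  "huber \<epsilon> t =
     (if \<epsilon> = 0 then max 0 t
      else if t > \<bar>\<epsilon>\<bar> then t - \<bar>\<epsilon>\<bar> / 2
      else if 0 \<le> t then t\<^sup>2 / (2 * \<bar>\<epsilon>\<bar>)
      else 0)"

definition huber_d1 :: "real \<Rightarrow> real \<Rightarrow> real" where
  "huber_d1 \<epsilon> t = deriv (\<lambda>e. huber e t) \<epsilon>"

definition huber_d2 :: "real \<Rightarrow> real \<Rightarrow> real" where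
  "huber_d2 \<epsilon> t = deriv (huber \<epsilon>) t"

definition huber_mat :: "real \<Rightarrow> real^'n::finite^'n \<Rightarrow> real^'n \<Rightarrow> real^'n^'n" where
  "huber_mat \<epsilon> P d = P ** diag_mat (\<chi> i. huber \<epsilon> (d $ i)) ** transpose P"

text \<open>The common value for all spectral decompositions of the matrix, cf. \<open>mat_of_Phi\<close> below.\<close>

definition Phi :: "real \<times> 'n::finite symmat \<Rightarrow> 'n symmat" where
  "Phi = (\<lambda>(\<epsilon>, W). THE S. \<exists>P d. spectral_decomp W P d \<and> mat_of S = huber_mat \<epsilon> P d)"

text \<open>The Hadamard product of \<open>Omega\<close> with another matrix is the componentwise \<open>*\<close> on vectors.\<close>

definition Omega :: "real \<Rightarrow> real^'n \<Rightarrow> real^'n^'n" where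
  "Omega \<epsilon> d = (\<chi> i j. if d $ i \<noteq> d $ j
      then (huber \<epsilon> (d $ i) - huber \<epsilon> (d $ j)) / (d $ i - d $ j)
      else huber_d2 \<epsilon> (d $ i))"

definition Dcal :: "real \<Rightarrow> real^'n \<Rightarrow> real^'n^'n" where
  "Dcal \<epsilon> d = diag_mat (\<chi> i. huber_d1 \<epsilon> (d $ i))"

text \<open>
  The sum over \<open>k \<noteq> j\<close> runs over the ordered pairs \<open>(x, y)\<close> of distinct values
  \<open>\<lambda>\<^sub>k, \<lambda>\<^sub>j\<close> among the entries of \<open>d\<close>.
\<close>

definition Phi_dir_formula ::
  "'n symmat \<Rightarrow> real^'n::{finite,linorder}^'n::{finite,linorder} \<Rightarrow> real^'n::{finite,linorder} \<Rightarrow>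
     real \<Rightarrow> 'n symmat \<Rightarrow> real^'n::{finite,linorder}^'n::{finite,linorder}" where
  "Phi_dir_formula W P d \<tau> H =
     (1/2) *\<^sub>R (\<Sum>(x, y)\<in>{(x, y). x \<in> range (($) d) \<and> y \<in> range (($) d) \<and> x \<noteq> y}.
        ((huber 0 x - huber 0 y) / (x - y)) *\<^sub>R
        (eigproj P d y ** mat_of H ** eigproj P d x + eigproj P d x ** mat_of H ** eigproj P d y))
   + (\<Sum>i | d $ i > 0. (eigval_deriv W H i - \<bar>\<tau>\<bar> / 2) *\<^sub>R outer (column i P) (column i P))
   + (\<Sum>i | d $ i = 0. huber \<tau> (eigval_deriv W H i) *\<^sub>R outer (column i P) (column i P))"

lemma huber_mat_unique:
  assumes "spectral_decomp W P d" "spectral_decomp W R e"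
  shows "huber_mat \<epsilon> P d = huber_mat \<epsilon> R e"
proof -
  define M where "M = transpose R ** P"
  have oP: "transpose P ** P = mat 1" "P ** transpose P = mat 1"
    and oR: "transpose R ** R = mat 1" "R ** transpose R = mat 1"
    using assms by (auto simp: spectral_decomp_def orthogonal_matrix_def)
  have eq: "P ** diag_mat d ** transpose P = R ** diag_mat e ** transpose R"
    using assms by (simp add: spectral_decomp_def)
  have RM: "R ** M = P" unfolding M_def by (simp add: matrix_mul_assoc oR)
  have MP: "M ** transpose P = transpose R"
    unfolding M_def using oP(2) by (simp add: matrix_mul_assoc[symmetric])
  have dl: "(M ** diag_mat x) $ i $ j = M $ i $ j * x $ j" for x i j
    by (simp add: matrix_matrix_mult_def diag_mat_def if_distrib cong: if_cong)
  have dr: "(diag_mat x ** M) $ i $ j = x $ i * M $ i $ j" for x i j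
    by (simp add: matrix_matrix_mult_def diag_mat_def if_distrib[where f="\<lambda>z. z * _"] cong: if_cong)
  have "transpose R ** (P ** diag_mat d ** transpose P) ** P
      = transpose R ** (R ** diag_mat e ** transpose R) ** P"
    using eq by simp
  moreover have "transpose R ** (P ** diag_mat d ** transpose P) ** P = M ** diag_mat d"
    unfolding M_def using oP(1) by (simp add: matrix_mul_assoc[symmetric])
  moreover have "transpose R ** (R ** diag_mat e ** transpose R) ** P = diag_mat e ** M"
    unfolding M_def using oR(1) by (simp add: matrix_mul_assoc)
  ultimately have "M ** diag_mat d = diag_mat e ** M"
    by simp
  then have "M $ i $ j * d $ j = e $ i * M $ i $ j" for i j
    by (metis dl dr)
  then have "M $ i $ j = 0 \<or> d $ j = e $ i" for i j
    by (metis mult.commute mult_cancel_left)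
  then have "M $ i $ j * huber \<epsilon> (d $ j) = huber \<epsilon> (e $ i) * M $ i $ j" for i j
    by (metis mult.commute mult_zero_left)
  then have *: "M ** diag_mat (\<chi> i. huber \<epsilon> (d $ i)) = diag_mat (\<chi> i. huber \<epsilon> (e $ i)) ** M"
    by (simp add: vec_eq_iff dl dr)
  have "huber_mat \<epsilon> P d = R ** (M ** diag_mat (\<chi> i. huber \<epsilon> (d $ i))) ** transpose P"
    by (simp add: huber_mat_def matrix_mul_assoc RM)
  also have "\<dots> = R ** diag_mat (\<chi> i. huber \<epsilon> (e $ i)) ** (M ** transpose P)"
    by (simp add: * matrix_mul_assoc)
  finally show ?thesis
    by (simp add: MP huber_mat_def)
qed

lemma mat_of_Phi:
  assumes "spectral_decomp W P d"
  shows "mat_of (Phi (\<epsilon>, W)) = huber_mat \<epsilon> P d"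
proof -
  have "transpose (huber_mat \<epsilon> P d) = huber_mat \<epsilon> P d"
    by (simp add: huber_mat_def matrix_transpose_mul matrix_mul_assoc)
  then have S: "mat_of (symmat_of (huber_mat \<epsilon> P d)) = huber_mat \<epsilon> P d"
    by (simp add: symmat_of_inverse)
  have "Phi (\<epsilon>, W) = symmat_of (huber_mat \<epsilon> P d)"
    unfolding Phi_def prod.case
  proof (rule the_equality)
    show "\<exists>P' d'. spectral_decomp W P' d' \<and>
        mat_of (symmat_of (huber_mat \<epsilon> P d)) = huber_mat \<epsilon> P' d'"
      using assms S by blast
  next
    fix T assume "\<exists>P' d'. spectral_decomp W P' d' \<and> mat_of T = huber_mat \<epsilon> P' d'"
    then have "mat_of T = huber_mat \<epsilon> P d" using huber_mat_unique[OF assms] by metis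
    then show "T = symmat_of (huber_mat \<epsilon> P d)" by (metis mat_of_inverse)
  qed
  with S show ?thesis by simp
qed


section \<open>Differentiability and semismoothness\<close>

definition continuously_differentiable_at ::
  "('a::real_normed_vector \<Rightarrow> 'b::real_normed_vector) \<Rightarrow> 'a \<Rightarrow> bool" where
  "continuously_differentiable_at F y \<longleftrightarrow>
     (\<exists>U F'. open U \<and> y \<in> U \<and>
        (\<forall>x\<in>U. (F has_derivative blinfun_apply (F' x)) (at x)) \<and> continuous_on U F')"

definition locally_lipschitz ::
  "('a::real_normed_vector \<Rightarrow> 'b::real_normed_vector) \<Rightarrow> bool" where
  "locally_lipschitz F \<longleftrightarrow> (\<forall>y. \<exists>U L. open U \<and> y \<in> U \<and> L-lipschitz_on U F)"

definition has_dir_deriv ::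
  "('a::real_normed_vector \<Rightarrow> 'b::real_normed_vector) \<Rightarrow> 'a \<Rightarrow> 'a \<Rightarrow> 'b \<Rightarrow> bool" where
  "has_dir_deriv F y h D \<longleftrightarrow> ((\<lambda>t. (F (y + t *\<^sub>R h) - F y) /\<^sub>R t) \<longlongrightarrow> D) (at_right 0)"

definition dir_deriv ::
  "('a::real_normed_vector \<Rightarrow> 'b::real_normed_vector) \<Rightarrow> 'a \<Rightarrow> 'a \<Rightarrow> 'b" where
  "dir_deriv F y h = (THE D. has_dir_deriv F y h D)"

definition directionally_differentiable_at ::
  "('a::real_normed_vector \<Rightarrow> 'b::real_normed_vector) \<Rightarrow> 'a \<Rightarrow> bool" where
  "directionally_differentiable_at F y \<longleftrightarrow> (\<forall>h. \<exists>D. has_dir_deriv F y h D)"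

definition B_subdiff ::
  "('a::real_normed_vector \<Rightarrow> 'b::real_normed_vector) \<Rightarrow> 'a \<Rightarrow> ('a \<Rightarrow>\<^sub>L 'b) set" where
  "B_subdiff F y =
     {V. \<exists>(u :: nat \<Rightarrow> 'a) F'. u \<longlonglongrightarrow> y \<and>
           (\<forall>k. (F has_derivative blinfun_apply (F' k)) (at (u k))) \<and> F' \<longlonglongrightarrow> V}"

definition clarke_jacobian ::
  "('a::real_normed_vector \<Rightarrow> 'b::real_normed_vector) \<Rightarrow> 'a \<Rightarrow> ('a \<Rightarrow>\<^sub>L 'b) set" where
  "clarke_jacobian F y = convex hull B_subdiff F y"

definition semismooth_at ::
  "('a::real_normed_vector \<Rightarrow> 'b::real_normed_vector) \<Rightarrow> 'a \<Rightarrow> bool" where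
  "semismooth_at F y \<longleftrightarrow>
     locally_lipschitz F \<and> directionally_differentiable_at F y \<and>
     (\<forall>c>0. \<forall>\<^sub>F h in nhds 0. \<forall>V\<in>clarke_jacobian F (y + h).
        norm (F (y + h) - F y - blinfun_apply V h) \<le> c * norm h)"

definition strongly_semismooth_at ::
  "('a::real_normed_vector \<Rightarrow> 'b::real_normed_vector) \<Rightarrow> 'a \<Rightarrow> bool" where
  "strongly_semismooth_at F y \<longleftrightarrow>
     semismooth_at F y \<and>
     (\<exists>C. \<forall>\<^sub>F h in nhds 0. \<forall>V\<in>clarke_jacobian F (y + h).
        norm (F (y + h) - F y - blinfun_apply V h) \<le> C * (norm h)\<^sup>2)"

definition strongly_semismooth ::
  "('a::real_normed_vector \<Rightarrow> 'b::real_normed_vector) \<Rightarrow> bool" where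
  "strongly_semismooth F \<longleftrightarrow> (\<forall>y. strongly_semismooth_at F y)"

end

theory Submission
  imports Defs
begin

text \<open>
  Everything is reduced to scalar properties of \<open>h\<close> by comparing two symmetric matrices
  \<open>W = P diag d P\<^sup>T\<close> and \<open>X = R diag e R\<^sup>T\<close> in their mixed frame. With \<open>M = P\<^sup>T R\<close>, the matrix
  \<open>P\<^sup>T (X - W) R\<close> has the entries \<open>M\<^sub>i\<^sub>k (e\<^sub>k - d\<^sub>i)\<close>, and \<open>P\<^sup>T (\<Phi>(\<epsilon>',X) - \<Phi>(\<epsilon>,W)) R\<close> has the entries
  \<open>M\<^sub>i\<^sub>k (h(\<epsilon>',e\<^sub>k) - h(\<epsilon>,d\<^sub>i))\<close>. Hence \<open>|M\<^sub>i\<^sub>k| |e\<^sub>k - d\<^sub>i| \<le> \<parallel>X - W\<parallel>\<close> (\<open>mixed_frame_bound\<close>), and a Lipschitz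
  estimate for \<open>h\<close> gives one for \<open>\<Phi>\<close> (\<open>Phi_lipschitz\<close>). No continuity of eigenvectors is needed, and
  multiple eigenvalues are no special case.

  For fixed \<open>\<epsilon> \<noteq> 0\<close> the increment of \<open>\<Phi>(\<epsilon>,\<cdot>)\<close> and its linearization differ, entry by entry in the mixed frame,
  only in the arguments of divided differences of \<open>h(\<epsilon>,\<cdot>)\<close>. Since \<open>h(\<epsilon>,\<cdot>)\<close> has a Lipschitz derivative, this
  yields, together with a scalar Taylor estimate for the change of \<open>\<epsilon>\<close>, a quadratic error bound that is locally
  uniform in the base point (\<open>Phi_quadratic_error\<close>). Such a bound makes
  the derivative continuous (\<open>continuous_on_derivative_if_quadratic_error\<close>).

  Strong semismoothness at \<open>y\<close> follows from \<open>\<Phi>(z) - \<Phi>(y) - \<Phi>'(z)(z - y) = O(\<parallel>z - y\<parallel>\<^sup>2)\<close> at the points \<open>z\<close> of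
  differentiability, because this estimate passes to limits and convex combinations of derivatives
  (\<open>strongly_semismooth_at_if_quadratic_error\<close>). For \<open>y = (\<epsilon>,W)\<close> with \<open>\<epsilon> \<noteq> 0\<close> it is the quadratic bound again, with
  base point \<open>z\<close>. For \<open>y = (0,W)\<close> and \<open>z = (\<epsilon>,X)\<close> with \<open>\<epsilon> \<noteq> 0\<close>, Euler's relation \<open>\<Phi>(z) = \<Phi>'(z) z\<close> reduces it to
  \<open>\<Phi>(0,W) - \<Phi>'(z)(0,W)\<close>, which is of second order by the gaps between the eigenvalues of \<open>W\<close> and zero
  (\<open>Phi_quadratic_error_at_zero\<close>). It extends to points \<open>(0,X)\<close> where \<open>\<Phi>\<close> happens to be differentiable by
  a mean value argument along rays from \<open>y\<close> (\<open>quadratic_error_on_hyperplane\<close>).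

  For the directional derivative at \<open>(0,W)\<close> choose the eigenframe \<open>R\<close> of \<open>W\<close> so that \<open>R\<^sup>T H R\<close> is diagonal and
  sorted inside the eigenspaces of \<open>W\<close>; it maximises a weighted trace, and the same argument proves the spectral theorem
  (\<open>ex_block_diagonalizing_frame\<close>). In the mixed frame of \<open>W\<close> and \<open>W + t H\<close> the eigenvalues are
  \<open>d\<^sub>i + t (R\<^sup>T H R)\<^sub>i\<^sub>i + O(t\<^sup>2)\<close> (\<open>eigenvalue_ray_expansion\<close>), and \<open>\<Phi>\<close> has a corresponding expansion
  (\<open>Phi_ray_expansion\<close>), whose scalar part is exactly linear in small \<open>t > 0\<close> (\<open>huber_ray\<close>).
\<close>


section \<open>Matrices in orthonormal frames\<close>

lemma matrix_mult_entry: "(A ** B) $ i $ j = (\<Sum>k\<in>UNIV. A $ i $ k * B $ k $ j)"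
  by (simp add: matrix_matrix_mult_def)

lemma diag_mat_nth: "diag_mat x $ i $ j = (if i = j then x $ i else 0)"
  by (simp add: diag_mat_def)

lemma mult_diag_mat_entry: "(M ** diag_mat x) $ i $ j = M $ i $ j * (x $ j :: real)"
  by (simp add: matrix_mult_entry diag_mat_nth if_distrib cong: if_cong)

lemma diag_mat_mult_entry: "(diag_mat x ** M) $ i $ j = (x $ i :: real) * M $ i $ j"
  by (simp add: matrix_mult_entry diag_mat_nth if_distrib[where f="\<lambda>z. z * _"] cong: if_cong)

lemma orthogonal_matrixD:
  "orthogonal_matrix P \<Longrightarrow> transpose P ** P = mat 1" "orthogonal_matrix P \<Longrightarrow> P ** transpose P = mat 1"
  by (simp_all add: orthogonal_matrix_def)

lemma orthogonal_cancel:
  assumes "orthogonal_matrix P"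
  shows "transpose P ** (P ** A) = A" "P ** (transpose P ** A) = A"
    "A ** P ** transpose P = A" "A ** transpose P ** P = A"
  using assms by (simp_all add: matrix_mul_assoc orthogonal_matrixD)
     (simp_all add: matrix_mul_assoc[symmetric] orthogonal_matrixD)

lemma matrix_diff_distribs:
  fixes A B :: "real^'n^'m"
  shows "C ** (A - B) = C ** A - C ** B" "(A - B) ** D = A ** D - B ** D"
  by (simp_all add: vec_eq_iff matrix_mult_entry algebra_simps sum_subtractf)

lemma norm_mult_orthogonal_right:
  fixes A :: "real^'n^'m"
  assumes "orthogonal_matrix R"
  shows "norm (A ** R) = norm A"
proof -
  have "orthogonal_transformation ((*v) (transpose R))"
    using assms by (simp add: orthogonal_transformation_matrix del: transpose_matrix_vector)
  then have "norm (transpose R *v A $ i) = norm (A $ i)" for i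
    by (rule orthogonal_transformation_norm)
  moreover have "(A ** R) $ i = transpose R *v A $ i" for i
    by (simp add: vec_eq_iff matrix_mult_entry matrix_vector_mult_def transpose_def mult.commute
        del: transpose_matrix_vector)
  ultimately show ?thesis by (simp add: norm_vec_def)
qed

lemma norm_transpose:
  fixes A :: "real^'n^'m"
  shows "norm (transpose A) = norm A"
proof -
  have "inner (transpose A) (transpose A) = inner A A"
    unfolding inner_vec_def transpose_def by (simp add: sum.swap[of _ "UNIV :: 'm set"])
  then show ?thesis by (simp add: norm_eq_sqrt_inner)
qed

lemma norm_mult_orthogonal_left:
  fixes A :: "real^'n^'m"
  assumes "orthogonal_matrix P"
  shows "norm (P ** A) = norm A"
  by (metis assms norm_mult_orthogonal_right norm_transpose matrix_transpose_mul orthogonal_matrix_transpose)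

lemma norm_change_frames:
  fixes A :: "real^'n^'n"
  assumes "orthogonal_matrix P" "orthogonal_matrix R"
  shows "norm (transpose P ** A ** R) = norm A"
  by (simp add: assms norm_mult_orthogonal_left norm_mult_orthogonal_right)

lemma norm_matrix_square: "(norm A)\<^sup>2 = (\<Sum>i\<in>UNIV. \<Sum>j\<in>UNIV. (A $ i $ j :: real)\<^sup>2)"
  unfolding power2_norm_eq_inner by (simp add: inner_vec_def power2_eq_square)

lemma abs_entry_le_norm: "\<bar>A $ i $ j :: real\<bar> \<le> norm A"
  by (metis Finite_Cartesian_Product.norm_nth_le component_le_norm_cart order_trans)

lemma norm_le_entry_bound:
  fixes A :: "real^'n^'n"
  assumes "\<And>i j. \<bar>A $ i $ j\<bar> \<le> B"
  shows "norm A \<le> real CARD('n) * B"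
proof -
  have "0 \<le> B" using assms[of undefined undefined] by linarith
  have "(norm A)\<^sup>2 \<le> (\<Sum>i\<in>(UNIV :: 'n set). \<Sum>j\<in>(UNIV :: 'n set). B\<^sup>2)"
    unfolding norm_matrix_square
    by (intro sum_mono) (metis assms abs_ge_zero power2_abs power_mono)
  also have "\<dots> = (real CARD('n) * B)\<^sup>2" by (simp add: power2_eq_square)
  finally show ?thesis using \<open>0 \<le> B\<close> power2_le_imp_le by fastforce
qed

lemma orthogonal_entry_le_1:
  assumes "orthogonal_matrix M"
  shows "\<bar>M $ i $ j :: real\<bar> \<le> 1"
proof -
  have "(\<Sum>k\<in>UNIV. M $ i $ k * M $ i $ k) = 1"
    using arg_cong[OF orthogonal_matrixD(2)[OF assms], of "\<lambda>A. A $ i $ i"]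
    by (simp add: matrix_mult_entry transpose_def mat_def)
  moreover have "M $ i $ j * M $ i $ j \<le> (\<Sum>k\<in>UNIV. M $ i $ k * M $ i $ k)"
    by (rule member_le_sum) auto
  ultimately show ?thesis by (metis abs_square_le_1 power2_eq_square)
qed

lemma orthogonal_row_sum:
  assumes "orthogonal_matrix M"
  shows "(\<Sum>k\<in>UNIV. M $ i $ k * M $ j $ k) = (if i = j then 1 else 0 :: real)"
  using arg_cong[OF orthogonal_matrixD(2)[OF assms], of "\<lambda>A. A $ i $ j"]
  by (simp add: matrix_mult_entry transpose_def mat_def)

lemma orthogonal_column_sum:
  assumes "orthogonal_matrix M"
  shows "(\<Sum>k\<in>UNIV. M $ k $ i * M $ k $ j) = (if i = j then 1 else 0 :: real)"
  using arg_cong[OF orthogonal_matrixD(1)[OF assms], of "\<lambda>A. A $ i $ j"]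
  by (simp add: matrix_mult_entry transpose_def mat_def)

lemma spectral_decompD:
  assumes "spectral_decomp W P d"
  shows "orthogonal_matrix P" "mat_of W = P ** diag_mat d ** transpose P"
    "transpose P ** mat_of W = diag_mat d ** transpose P" "mat_of W ** P = P ** diag_mat d"
proof -
  show 1: "orthogonal_matrix P" and 2: "mat_of W = P ** diag_mat d ** transpose P"
    using assms by (auto simp: spectral_decomp_def)
  show "transpose P ** mat_of W = diag_mat d ** transpose P"
    unfolding 2 using orthogonal_matrixD(1)[OF 1] by (simp add: matrix_mul_assoc)
  show "mat_of W ** P = P ** diag_mat d"
    unfolding 2 using orthogonal_matrixD(1)[OF 1] by (simp flip: matrix_mul_assoc)
qed

lemma orthogonal_frames:
  assumes "spectral_decomp W P d" "spectral_decomp X R e"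
  shows "orthogonal_matrix (transpose P ** R)"
  using assms by (simp add: orthogonal_matrix_mul spectral_decompD)

lemma mixed_frame_diff:
  assumes "spectral_decomp W P d" "spectral_decomp X R e"
  shows "(transpose P ** (mat_of X - mat_of W) ** R) $ i $ k = (transpose P ** R) $ i $ k * (e $ k - d $ i)"
proof -
  have eq: "transpose P ** (mat_of X - mat_of W) ** R
      = (transpose P ** R) ** diag_mat e - diag_mat d ** (transpose P ** R)"
    using spectral_decompD(3)[OF assms(1)] spectral_decompD(4)[OF assms(2)]
    by (simp add: matrix_diff_distribs matrix_mul_assoc[symmetric])
  show ?thesis unfolding eq by (simp add: mult_diag_mat_entry diag_mat_mult_entry algebra_simps)
qed

lemma mat_of_minus: "mat_of (A - B) = mat_of A - mat_of B"
  by (rule minus_symmat.rep_eq)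

text \<open>
  The entries of the transition matrix between eigenframes of nearby matrices are small wherever the
  eigenvalues are far apart; this replaces the continuity of eigenvectors.
\<close>

lemma mixed_frame_bound:
  assumes "spectral_decomp W P d" "spectral_decomp X R e"
  shows "\<bar>(transpose P ** R) $ i $ k\<bar> * \<bar>e $ k - d $ i\<bar> \<le> norm (X - W)"
proof -
  have "norm (X - W) = norm (transpose P ** (mat_of X - mat_of W) ** R)"
    by (simp add: norm_change_frames[OF assms[THEN spectral_decompD(1)]] flip: mat_of_minus)
  then show ?thesis
    by (metis abs_entry_le_norm mixed_frame_diff[OF assms] abs_mult)
qed

lemma huber_mat_frame:
  assumes "spectral_decomp W P d"
  shows "spectral_decomp (Phi (\<epsilon>, W)) P (\<chi> i. huber \<epsilon> (d $ i))"
  using assms by (simp add: spectral_decomp_def mat_of_Phi[OF assms] huber_mat_def)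

section \<open>Spectral theorem and perturbation of eigenvalues\<close>

lemma continuous_on_matrix_mult [continuous_intros]:
  fixes f :: "'a::topological_space \<Rightarrow> real^'n^'m" and g :: "'a \<Rightarrow> real^'k^'n"
  shows "continuous_on S f \<Longrightarrow> continuous_on S g \<Longrightarrow> continuous_on S (\<lambda>x. f x ** g x)"
  unfolding matrix_matrix_mult_def by (intro continuous_intros)

lemma continuous_on_transpose [continuous_intros]:
  fixes f :: "'a::topological_space \<Rightarrow> real^'n^'m"
  shows "continuous_on S f \<Longrightarrow> continuous_on S (\<lambda>x. transpose (f x))"
  unfolding transpose_def by (intro continuous_intros)

lemma compact_spectral_frames: "compact {R. spectral_decomp W R d}"
proof -
  have "closed {R. spectral_decomp W R d}"
    unfolding spectral_decomp_def orthogonal_matrix_def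
    by (intro closed_Collect_conj closed_Collect_eq continuous_intros)
  moreover have "bounded {R. spectral_decomp W R d}"
    unfolding bounded_iff
    by (rule exI[where x = "real CARD('a) * 1"])
       (auto intro!: norm_le_entry_bound orthogonal_entry_le_1 dest: spectral_decompD(1) simp del: mult_1_right)
  ultimately show ?thesis by (simp add: compact_eq_bounded_closed)
qed

lemma conjugated_entry: "(transpose R ** A ** R) $ i $ j = inner (column i R) (A *v column j R)"
  by (simp add: matrix_mult_entry inner_vec_def column_def transpose_def matrix_vector_mult_def
      sum_distrib_left sum_distrib_right mult.assoc) (rule sum.swap)

lemma conjugated_symmetric:
  "(transpose R ** mat_of H ** R) $ i $ j = (transpose R ** mat_of H ** R) $ j $ i"
proof -
  have "transpose (transpose R ** mat_of H ** R) = transpose R ** mat_of H ** R"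
    by (simp add: matrix_transpose_mul matrix_mul_assoc)
  from arg_cong[OF this, of "\<lambda>A. A $ j $ i"] show ?thesis by (simp add: transpose_def)
qed

text \<open>The right multiplication by a Givens rotation in the plane of the coordinates \<open>i\<close> and \<open>j\<close>.\<close>

definition rotate_columns :: "real \<Rightarrow> real \<Rightarrow> 'n \<Rightarrow> 'n \<Rightarrow> real^'n^'m \<Rightarrow> real^'n^'m" where
  "rotate_columns c s i j R = (\<chi> a b. if b = i then c * R $ a $ i + s * R $ a $ j
     else if b = j then c * R $ a $ j - s * R $ a $ i else R $ a $ b)"

lemma column_rotate_columns:
  assumes "i \<noteq> j"
  shows "column i (rotate_columns c s i j R) = c *\<^sub>R column i R + s *\<^sub>R column j R"
    "column j (rotate_columns c s i j R) = c *\<^sub>R column j R - s *\<^sub>R column i R"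
    "k \<noteq> i \<Longrightarrow> k \<noteq> j \<Longrightarrow> column k (rotate_columns c s i j R) = column k R"
  using assms by (simp_all add: rotate_columns_def column_def vec_eq_iff)

lemma sum_split2:
  fixes i j :: "'n::finite"
  assumes "i \<noteq> j"
  shows "(\<Sum>k\<in>UNIV. f k) = f i + f j + (\<Sum>k\<in>UNIV - {i, j}. f k :: real)"
proof -
  have "(\<Sum>k\<in>UNIV. f k) = f i + (\<Sum>k\<in>UNIV - {i}. f k)"
    by (rule sum.remove) auto
  also have "(\<Sum>k\<in>UNIV - {i}. f k) = f j + (\<Sum>k\<in>UNIV - {i} - {j}. f k)"
    using assms by (intro sum.remove) auto
  also have "UNIV - {i} - {j} = UNIV - {i, j}" by auto
  finally show ?thesis by simp
qed

lemma conjugated_diag_entry: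
  "(A ** diag_mat \<delta> ** transpose B) $ a $ b = (\<Sum>k\<in>UNIV. A $ a $ k * \<delta> $ k * (B $ b $ k :: real))"
  by (simp add: matrix_mult_entry[of "A ** diag_mat \<delta>"] mult_diag_mat_entry transpose_def)

lemma rotate_columns_diag:
  assumes "i \<noteq> j" "\<delta> $ i = \<delta> $ j" "c\<^sup>2 + s\<^sup>2 = 1"
  shows "rotate_columns c s i j R ** diag_mat \<delta> ** transpose (rotate_columns c s i j R)
       = R ** diag_mat \<delta> ** transpose R"
proof -
  have "(\<Sum>k\<in>UNIV. rotate_columns c s i j R $ a $ k * \<delta> $ k * rotate_columns c s i j R $ b $ k)
      = (\<Sum>k\<in>UNIV. R $ a $ k * \<delta> $ k * R $ b $ k)" for a b
  proof -
    have *: "(c * u + s * v) * z * (c * u' + s * v') + (c * v - s * u) * z * (c * v' - s * u')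
        = u * z * u' + v * z * v'" for u v u' v' z
    proof -
      have "(c * u + s * v) * z * (c * u' + s * v') + (c * v - s * u) * z * (c * v' - s * u')
        = (c\<^sup>2 + s\<^sup>2) * (u * z * u' + v * z * v')"
        by (simp add: power2_eq_square algebra_simps)
      then show ?thesis using assms(3) by simp
    qed
    have rest: "(\<Sum>k\<in>UNIV - {i, j}. rotate_columns c s i j R $ a $ k * \<delta> $ k * rotate_columns c s i j R $ b $ k)
      = (\<Sum>k\<in>UNIV - {i, j}. R $ a $ k * \<delta> $ k * R $ b $ k)"
      by (rule sum.cong) (auto simp: rotate_columns_def)
    show ?thesis
      unfolding sum_split2[OF assms(1)] rest
      using assms(1,2) *[of "R $ a $ i" "R $ a $ j" "\<delta> $ j" "R $ b $ i" "R $ b $ j"]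
      by (simp add: rotate_columns_def)
  qed
  then show ?thesis
    by (simp add: vec_eq_iff conjugated_diag_entry)
qed

lemma diag_mat_1: "diag_mat (\<chi> i. 1) = mat 1"
  by (simp add: diag_mat_def mat_def vec_eq_iff)

lemma spectral_decomp_rotate_columns:
  assumes "spectral_decomp W R d" "i \<noteq> j" "d $ i = d $ j" "c\<^sup>2 + s\<^sup>2 = 1"
  shows "spectral_decomp W (rotate_columns c s i j R) d"
proof -
  let ?R = "rotate_columns c s i j R"
  have "?R ** transpose ?R = R ** transpose R"
    using rotate_columns_diag[OF assms(2) _ assms(4), of "\<chi> i. 1" R] by (simp add: diag_mat_1)
  also have "\<dots> = mat 1" using assms(1) by (simp add: spectral_decomp_def orthogonal_matrix_def)
  finally have "orthogonal_matrix ?R"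
    by (metis orthogonal_matrix orthogonal_matrix_transpose transpose_transpose)
  then show ?thesis
    using assms(1) rotate_columns_diag[OF assms(2-4), of R] by (simp add: spectral_decomp_def)
qed

text \<open>
  For a rotation with cosine \<open>c\<close> and sine \<open>s\<close>: the quarter turn gives the sign of \<open>D\<close>, and small angles
  exclude \<open>g \<noteq> 0\<close>, whose term is linear in the angle.
\<close>

lemma quadratic_nonpos_imp:
  fixes D g :: real
  assumes "\<And>c s. c\<^sup>2 + s\<^sup>2 = 1 \<Longrightarrow> 2 * c * s * g \<le> s\<^sup>2 * D"
  shows "0 \<le> D" "g = 0"
proof -
  show D: "0 \<le> D" using assms[of 0 1] by simp
  have *: "2 * x * g \<le> x\<^sup>2 * D" for x
  proof -
    define r where "r = sqrt (1 + x\<^sup>2)"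
    have r: "r\<^sup>2 = 1 + x\<^sup>2" "r > 0" unfolding r_def by (simp_all add: add_pos_nonneg)
    have "(1 / r)\<^sup>2 + (x / r)\<^sup>2 = (1 + x\<^sup>2) / r\<^sup>2"
      by (simp add: power_divide add_divide_distrib)
    then have "(1 / r)\<^sup>2 + (x / r)\<^sup>2 = 1" unfolding r(1)[symmetric] using r(2) by simp
    from assms[OF this] have "r\<^sup>2 * (2 * (1 / r) * (x / r) * g) \<le> r\<^sup>2 * ((x / r)\<^sup>2 * D)"
      by (rule mult_left_mono) simp
    then show ?thesis using r(2) by (simp add: power2_eq_square)
  qed
  show "g = 0"
  proof (rule ccontr)
    assume "g \<noteq> 0"
    define x where "x = g / (D + 1)"
    have g: "g = x * (D + 1)" using D by (simp add: x_def)
    have "x \<noteq> 0" using \<open>g \<noteq> 0\<close> g by auto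
    have "x\<^sup>2 * (2 * (D + 1)) \<le> x\<^sup>2 * D" using *[of x] unfolding g by (simp add: power2_eq_square mult_ac)
    then have "2 * (D + 1) \<le> D" using mult_le_cancel_left_pos[of "x\<^sup>2"] \<open>x \<noteq> 0\<close> by (metis zero_less_power2)
    then show False using D by simp
  qed
qed

text \<open>
  Maximise the weighted trace \<open>\<Sum>\<^sub>i w\<^sub>i (R\<^sup>T H R)\<^sub>i\<^sub>i\<close>, with strictly decreasing weights, over the compact
  set of the orthonormal eigenframes of \<open>W\<close>. Rotations inside an eigenspace stay in that set, so at a
  maximiser every two-dimensional diagonal submatrix of \<open>R\<^sup>T H R\<close> inside a block is diagonal and
  sorted. For \<open>W = 0\<close> this is the spectral theorem.
\<close>

lemma ex_block_diagonalizing_frame: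
  fixes W H :: "'n::{finite,linorder} symmat"
  assumes "spectral_decomp W P d"
  obtains R where "spectral_decomp W R d"
    "\<And>i j. i \<noteq> j \<Longrightarrow> d $ i = d $ j \<Longrightarrow> (transpose R ** mat_of H ** R) $ i $ j = 0"
    "\<And>i j. i \<le> j \<Longrightarrow> d $ i = d $ j \<Longrightarrow>
       (transpose R ** mat_of H ** R) $ j $ j \<le> (transpose R ** mat_of H ** R) $ i $ i"
proof -
  define w :: "'n \<Rightarrow> real" where "w i = card {i..}" for i
  define f where "f R = (\<Sum>i\<in>UNIV. w i * (transpose R ** mat_of H ** R) $ i $ i)" for R
  have w: "w j < w i" if "i < j" for i j
  proof -
    have "{j..} \<subset> {i..}" using that by auto
    then show ?thesis unfolding w_def by (simp add: psubset_card_mono)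
  qed
  have "continuous_on {R. spectral_decomp W R d} f"
    unfolding f_def by (intro continuous_intros)
  then obtain R where R: "spectral_decomp W R d" and max: "\<And>R'. spectral_decomp W R' d \<Longrightarrow> f R' \<le> f R"
    using continuous_attains_sup[OF compact_spectral_frames[of W d], of f] assms by auto
  define G where "G = transpose R ** mat_of H ** R"
  have sym: "G $ i $ j = G $ j $ i" for i j unfolding G_def by (rule conjugated_symmetric)
  have main: "0 \<le> G $ i $ i - G $ j $ j \<and> G $ i $ j = 0" if "i < j" "d $ i = d $ j" for i j
  proof -
    have ij: "i \<noteq> j" using that by simp
    have "2 * c * s * G $ i $ j \<le> s\<^sup>2 * (G $ i $ i - G $ j $ j)" if cs: "c\<^sup>2 + s\<^sup>2 = 1" for c s
    proof -
      define G' where "G' = transpose (rotate_columns c s i j R) ** mat_of H ** rotate_columns c s i j R"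
      let ?\<Delta> = "2 * c * s * G $ i $ j - s\<^sup>2 * (G $ i $ i - G $ j $ j)"
      have c2: "c * c = 1 - s * s" using cs by (simp add: power2_eq_square)
      have cc: "c * (c * x) = x - s * (s * x)" for x
      proof -
        have "c * (c * x) = (c * c) * x" by simp
        then show ?thesis unfolding c2 by (simp add: algebra_simps)
      qed
      have Gij: "G $ a $ b = inner (column a R) (mat_of H *v column b R)" for a b
        unfolding G_def by (rule conjugated_entry)
      have ii: "G' $ i $ i = G $ i $ i + ?\<Delta>"
        unfolding G'_def conjugated_entry column_rotate_columns[OF ij]
        by (simp add: matrix_vector_right_distrib matrix_vector_mult_scaleR inner_add_left
            inner_add_right Gij[symmetric] sym[of j i] power2_eq_square algebra_simps cc)
      have jj: "G' $ j $ j = G $ j $ j - ?\<Delta>"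
        unfolding G'_def conjugated_entry column_rotate_columns[OF ij]
        by (simp add: matrix_vector_mult_diff_distrib matrix_vector_mult_scaleR inner_diff_left
            inner_diff_right Gij[symmetric] sym[of j i] power2_eq_square algebra_simps cc)
      have rest: "(\<Sum>k\<in>UNIV - {i, j}. w k * G' $ k $ k) = (\<Sum>k\<in>UNIV - {i, j}. w k * G $ k $ k)"
        by (rule sum.cong) (auto simp: G'_def conjugated_entry Gij column_rotate_columns[OF ij])
      have "f (rotate_columns c s i j R) \<le> f R"
        by (intro max spectral_decomp_rotate_columns R ij \<open>d $ i = d $ j\<close> cs)
      then have "w i * (G $ i $ i + ?\<Delta>) + w j * (G $ j $ j - ?\<Delta>) \<le> w i * G $ i $ i + w j * G $ j $ j"
        unfolding f_def G'_def[symmetric] G_def[symmetric] sum_split2[OF ij] rest ii jj by simp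
      then have "(w i - w j) * ?\<Delta> \<le> 0" by (simp add: algebra_simps)
      then show ?thesis using w[OF \<open>i < j\<close>] by (simp add: mult_le_0_iff)
    qed
    from quadratic_nonpos_imp[OF this] show ?thesis by simp
  qed
  show ?thesis
  proof (rule that[OF R])
    show "(transpose R ** mat_of H ** R) $ i $ j = 0" if "i \<noteq> j" "d $ i = d $ j" for i j
      using main[of i j] main[of j i] that sym[of i j] by (fold G_def) (metis neqE)
    show "(transpose R ** mat_of H ** R) $ j $ j \<le> (transpose R ** mat_of H ** R) $ i $ i"
      if "i \<le> j" "d $ i = d $ j" for i j
      using main[of i j] that by (fold G_def) (cases "i = j", auto)
  qed
qed

theorem ex_spectral_decomp:
  fixes W :: "'n::{finite,linorder} symmat"
  obtains P d where "spectral_decomp W P d" "antimono (($) d)"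
proof -
  have "spectral_decomp (0 :: 'n symmat) (mat 1) 0"
    by (simp add: spectral_decomp_def orthogonal_matrix_id zero_symmat.rep_eq vec_eq_iff matrix_mult_entry
        diag_mat_def)
  then obtain R where R: "spectral_decomp (0 :: 'n symmat) R 0"
    and offdiag: "\<And>i j. i \<noteq> j \<Longrightarrow> (transpose R ** mat_of W ** R) $ i $ j = 0"
    and sorted: "\<And>i j. i \<le> j \<Longrightarrow>
       (transpose R ** mat_of W ** R) $ j $ j \<le> (transpose R ** mat_of W ** R) $ i $ i"
    by (rule ex_block_diagonalizing_frame[where H = W]) auto
  define d where "d = (\<chi> i. (transpose R ** mat_of W ** R) $ i $ i)"
  have R: "orthogonal_matrix R" using R by (rule spectral_decompD)
  have "transpose R ** mat_of W ** R = diag_mat d"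
    using offdiag by (simp add: vec_eq_iff diag_mat_nth d_def)
  then have "R ** (transpose R ** mat_of W ** R) ** transpose R = R ** diag_mat d ** transpose R"
    by simp
  then have "mat_of W = R ** diag_mat d ** transpose R"
    by (simp add: orthogonal_cancel[OF R] matrix_mul_assoc orthogonal_matrixD[OF R])
  moreover have "antimono (($) d)" by (auto intro!: antimonoI sorted simp: d_def)
  ultimately show ?thesis using R by (intro that) (simp add: spectral_decomp_def)
qed

text \<open>
  The entries in rows up to \<open>i\<close> have total square sum one more than the number of columns before \<open>i\<close>,
  and those columns cannot absorb all of it.
\<close>

lemma orthogonal_matrix_pivot:
  fixes N :: "real^'n::{finite,linorder}^'n::{finite,linorder}"
  assumes N: "orthogonal_matrix N"
  obtains j k where "j \<le> i" "i \<le> k" "1 / real CARD('n) \<le> \<bar>N $ j $ k\<bar>"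
proof -
  let ?n = "real CARD('n)"
  have "\<exists>j\<in>{..i}. \<exists>k\<in>{i..}. 1 / ?n \<le> \<bar>N $ j $ k\<bar>"
  proof (rule ccontr)
    assume "\<not> ?thesis"
    then have "\<bar>N $ j $ k\<bar> < 1 / ?n" if "j \<le> i" "i \<le> k" for j k
      using that by (simp add: not_le)
    then have less: "(N $ j $ k)\<^sup>2 < (1 / ?n)\<^sup>2" if "j \<le> i" "i \<le> k" for j k
      using that by (metis abs_ge_zero power2_abs power_strict_mono pos2)
    have "(\<Sum>j\<in>{..i}. \<Sum>k\<in>{i..}. (N $ j $ k)\<^sup>2) < (\<Sum>j\<in>{..i}. \<Sum>k\<in>{i..}. (1 / ?n)\<^sup>2)"
      by (intro sum_strict_mono less) auto
    also have "\<dots> = (real (card {..i}) / ?n) * (real (card {i..}) / ?n)"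
      by (simp add: power2_eq_square)
    also have "\<dots> \<le> 1 * 1"
      by (intro mult_mono) (auto simp: divide_le_eq_1 intro!: card_mono)
    finally have 1: "(\<Sum>j\<in>{..i}. \<Sum>k\<in>{i..}. (N $ j $ k)\<^sup>2) < 1" by simp
    have "(\<Sum>j\<in>{..i}. \<Sum>k\<in>{..<i}. (N $ j $ k)\<^sup>2) = (\<Sum>k\<in>{..<i}. \<Sum>j\<in>{..i}. (N $ j $ k)\<^sup>2)"
      by (rule sum.swap)
    also have "\<dots> \<le> (\<Sum>k\<in>{..<i}. \<Sum>j\<in>UNIV. (N $ j $ k)\<^sup>2)"
      by (intro sum_mono sum_mono2) auto
    also have "\<dots> = card {..<i}"
      using orthogonal_column_sum[OF N] by (simp add: power2_eq_square)
    finally have 2: "(\<Sum>j\<in>{..i}. \<Sum>k\<in>{..<i}. (N $ j $ k)\<^sup>2) \<le> card {..<i}" .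
    have "{..i} = insert i {..<i}" by auto
    then have "1 + real (card {..<i}) = card {..i}" by simp
    also have "\<dots> = (\<Sum>j\<in>{..i}. \<Sum>k\<in>UNIV. (N $ j $ k)\<^sup>2)"
      using orthogonal_row_sum[OF N] by (simp add: power2_eq_square)
    also have "\<dots> = (\<Sum>j\<in>{..i}. (\<Sum>k\<in>{..<i}. (N $ j $ k)\<^sup>2) + (\<Sum>k\<in>{i..}. (N $ j $ k)\<^sup>2))"
    proof (rule sum.cong)
      fix j assume "j \<in> {..i}"
      have "(UNIV :: 'n set) = {..<i} \<union> {i..}" by auto
      moreover have "sum f ({..<i} \<union> {i..}) = sum f {..<i} + sum f {i..}" for f :: "'n \<Rightarrow> real"
        by (rule sum.union_disjoint) auto
      ultimately show "(\<Sum>k\<in>UNIV. (N $ j $ k)\<^sup>2) = (\<Sum>k\<in>{..<i}. (N $ j $ k)\<^sup>2) + (\<Sum>k\<in>{i..}. (N $ j $ k)\<^sup>2)"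
        by metis
    qed simp
    also have "\<dots> < card {..<i} + 1"
      using 1 2 by (simp add: sum.distrib)
    finally show False by simp
  qed
  then show ?thesis using that by auto
qed

lemma abs_le_of_product:
  assumes "\<bar>m\<bar> * a \<le> B" "1 / c \<le> \<bar>m\<bar>" "0 < c" "0 \<le> a"
  shows "(a :: real) \<le> c * B"
proof -
  have "1 / c * a \<le> \<bar>m\<bar> * a" using assms by (intro mult_right_mono) auto
  then have "1 / c * a \<le> B" using assms by linarith
  then show ?thesis using assms(3) by (simp add: field_simps)
qed

text \<open>Weyl's inequality up to a factor, with which a pivot entry of the transition matrix suffices.\<close>

lemma eigenvalue_perturbation:
  fixes W X :: "'n::{finite,linorder} symmat"
  assumes W: "spectral_decomp W P d" "antimono (($) d)" and X: "spectral_decomp X R e" "antimono (($) e)"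
  shows "\<bar>e $ i - d $ i\<bar> \<le> real CARD('n) * norm (X - W)"
proof -
  have *: "e $ i - d $ i \<le> real CARD('n) * norm (X - W)"
    if W: "spectral_decomp W P d" "antimono (($) d)" and X: "spectral_decomp X R e" "antimono (($) e)"
    for W X :: "'n symmat" and P R d e
  proof -
    obtain j k where jk: "j \<le> i" "i \<le> k" "1 / real CARD('n) \<le> \<bar>(transpose R ** P) $ j $ k\<bar>"
      using orthogonal_matrix_pivot[OF orthogonal_frames[OF X(1) W(1)]] .
    have "\<bar>d $ k - e $ j\<bar> \<le> real CARD('n) * norm (W - X)"
      using abs_le_of_product[OF mixed_frame_bound[OF X(1) W(1)] jk(3)] by simp
    moreover have "e $ i \<le> e $ j" "d $ k \<le> d $ i"
      using jk W(2) X(2) by (auto dest: antimonoD)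
    ultimately show ?thesis by (simp add: norm_minus_commute)
  qed
  from *[OF W X] *[OF X W] show ?thesis by (simp add: norm_minus_commute)
qed

section \<open>The Huber function\<close>

lemma has_derivative_if_quadratic_error:
  fixes F :: "'a::real_normed_vector \<Rightarrow> 'b::real_normed_vector"
  assumes L: "bounded_linear L" and "0 < \<delta>"
    and *: "\<And>y. norm (y - x) < \<delta> \<Longrightarrow> norm (F y - F x - L (y - x)) \<le> C * (norm (y - x))\<^sup>2"
  shows "(F has_derivative L) (at x)"
proof -
  have "((\<lambda>y. \<bar>C\<bar> * norm (y - x)) \<longlongrightarrow> \<bar>C\<bar> * norm (x - x)) (at x)"
    by (intro tendsto_intros)
  then have lim: "((\<lambda>y. \<bar>C\<bar> * norm (y - x)) \<longlongrightarrow> 0) (at x)" by simp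
  have "((\<lambda>y. norm (F y - F x - L (y - x)) / norm (y - x)) \<longlongrightarrow> 0) (at x)"
  proof (rule Lim_null_comparison[OF _ lim])
    have "norm (F y - F x - L (y - x)) / norm (y - x) \<le> \<bar>C\<bar> * norm (y - x)"
      if "y \<noteq> x" "norm (y - x) < \<delta>" for y
    proof -
      have "norm (F y - F x - L (y - x)) \<le> \<bar>C\<bar> * (norm (y - x))\<^sup>2"
        using *[OF that(2)] by (smt (verit) mult_right_mono zero_le_power2)
      then show ?thesis using that(1) by (simp add: field_simps power2_eq_square)
    qed
    then show "\<forall>\<^sub>F y in at x. norm (norm (F y - F x - L (y - x)) / norm (y - x)) \<le> \<bar>C\<bar> * norm (y - x)"
      using \<open>0 < \<delta>\<close> by (auto simp: eventually_at dist_norm intro!: exI[of _ \<delta>])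
  qed
  then show ?thesis using L by (simp add: has_derivative_iff_norm)
qed

definition huber_slope :: "real \<Rightarrow> real \<Rightarrow> real" where
  "huber_slope \<epsilon> t = min 1 (max 0 (t / \<bar>\<epsilon>\<bar>))"

lemma huber_slope_bounds: "0 \<le> huber_slope \<epsilon> t" "huber_slope \<epsilon> t \<le> 1"
  by (auto simp: huber_slope_def)

lemma huber_eq_slope:
  assumes "\<epsilon> \<noteq> 0"
  shows "huber \<epsilon> t = t * huber_slope \<epsilon> t - \<bar>\<epsilon>\<bar> * (huber_slope \<epsilon> t)\<^sup>2 / 2"
proof -
  consider "t > \<bar>\<epsilon>\<bar>" | "0 \<le> t" "t \<le> \<bar>\<epsilon>\<bar>" | "t < 0" by linarith
  then show ?thesis
  proof cases
    case 1
    then have "huber_slope \<epsilon> t = 1" using assms by (simp add: huber_slope_def min_def max_def)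
    then show ?thesis using 1 assms by (simp add: huber_def)
  next
    case 2
    then have "huber_slope \<epsilon> t = t / \<bar>\<epsilon>\<bar>" using assms by (simp add: huber_slope_def min_def max_def)
    define a where "a = \<bar>\<epsilon>\<bar>"
    have "a > 0" using assms by (simp add: a_def)
    then have "t\<^sup>2 / (2 * a) = t * (t / a) - a * (t / a)\<^sup>2 / 2"
      by (simp add: power2_eq_square field_simps)
    then show ?thesis unfolding \<open>huber_slope \<epsilon> t = t / \<bar>\<epsilon>\<bar>\<close>
      using 2 assms by (simp add: huber_def a_def)
  next
    case 3
    then have "huber_slope \<epsilon> t = 0" using assms by (simp add: huber_slope_def divide_neg_pos)
    moreover have "\<not> \<bar>\<epsilon>\<bar> < t" using 3 by linarith
    ultimately show ?thesis using 3 assms by (simp add: huber_def)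
  qed
qed

text \<open>
  The dual description \<open>h(\<epsilon>,t) = max { t q - |\<epsilon>| q\<^sup>2 / 2 | 0 \<le> q \<le> 1 }\<close>. For \<open>\<epsilon> \<noteq> 0\<close> the maximiser is
  the slope, and comparing maximisers at different points gives all estimates on \<open>h\<close>.
\<close>

lemma huber_ge:
  assumes "0 \<le> p" "p \<le> 1"
  shows "t * p - \<bar>\<epsilon>\<bar> * p\<^sup>2 / 2 \<le> huber \<epsilon> t"
proof (cases "\<epsilon> = 0")
  case True
  have "t * p \<le> max 0 t"
    using assms by (cases "t \<le> 0") (auto simp: mult_nonpos_nonneg mult_le_cancel_left1 max_def)
  then show ?thesis using True by (simp add: huber_def)
next
  case False
  define a where "a = \<bar>\<epsilon>\<bar>"
  have a: "a > 0" using False by (simp add: a_def)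
  consider "t > a" | "0 \<le> t" "t \<le> a" | "t < 0" by linarith
  then show ?thesis
  proof cases
    case 1
    have "0 \<le> (1 - p) * (2 * (t - a) + a * (1 - p))"
      using 1 a assms by (intro mult_nonneg_nonneg add_nonneg_nonneg) auto
    then show ?thesis using 1 False
      by (simp add: huber_def power2_eq_square algebra_simps flip: a_def)
  next
    case 2
    have "0 \<le> (t - a * p)\<^sup>2 / (2 * a)" using a by simp
    also have "\<dots> = t\<^sup>2 / (2 * a) - (t * p - a * p\<^sup>2 / 2)"
      using a by (simp add: power2_eq_square field_simps)
    finally show ?thesis using 2 False
      by (simp add: huber_def flip: a_def)
  next
    case 3
    have "t * p \<le> 0" "0 \<le> a * p\<^sup>2" using 3 assms a by (auto simp: mult_nonpos_nonneg)
    then have "t * p - a * p\<^sup>2 / 2 \<le> 0" by linarith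
    moreover have "\<not> \<bar>\<epsilon>\<bar> < t" using 3 by linarith
    then have "huber \<epsilon> t = 0" using 3 False by (simp add: huber_def)
    ultimately show ?thesis by (simp add: a_def)
  qed
qed

lemma huber_eq_max:
  obtains q where "0 \<le> q" "q \<le> 1" "huber \<epsilon> t = t * q - \<bar>\<epsilon>\<bar> * q\<^sup>2 / 2"
proof (cases "\<epsilon> = 0")
  case True
  show ?thesis
    by (rule that[of "if t > 0 then 1 else 0"]) (auto simp: True huber_def)
next
  case False
  show ?thesis by (rule that[of "huber_slope \<epsilon> t"]) (auto simp: False huber_eq_slope huber_slope_bounds)
qed

lemma huber_lipschitz: "\<bar>huber \<epsilon> t - huber \<epsilon>' t'\<bar> \<le> \<bar>t - t'\<bar> + \<bar>\<epsilon> - \<epsilon>'\<bar> / 2"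
proof -
  have *: "huber \<epsilon> t - huber \<epsilon>' t' \<le> \<bar>t - t'\<bar> + \<bar>\<epsilon> - \<epsilon>'\<bar> / 2" for \<epsilon> t \<epsilon>' t'
  proof -
    obtain q where q: "0 \<le> q" "q \<le> 1" "huber \<epsilon> t = t * q - \<bar>\<epsilon>\<bar> * q\<^sup>2 / 2" by (rule huber_eq_max)
    have "(t - t') * q \<le> \<bar>t - t'\<bar> * 1" using q by (intro mult_mono) auto
    moreover have "(\<bar>\<epsilon>'\<bar> - \<bar>\<epsilon>\<bar>) * q\<^sup>2 \<le> \<bar>\<epsilon> - \<epsilon>'\<bar> * 1"
      using q by (intro mult_mono) (auto simp: abs_square_le_1 power_le_one)
    moreover have "t' * q - \<bar>\<epsilon>'\<bar> * q\<^sup>2 / 2 \<le> huber \<epsilon>' t'" using q by (intro huber_ge)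
    ultimately show ?thesis unfolding q(3) by (simp add: algebra_simps)
  qed
  show ?thesis
    using *[of \<epsilon> t \<epsilon>' t'] *[of \<epsilon>' t' \<epsilon> t] by (intro abs_leI) (simp_all add: abs_minus_commute)
qed

lemma huber_mono: "t \<le> t' \<Longrightarrow> huber \<epsilon> t \<le> huber \<epsilon> t'"
  by (metis huber_eq_max huber_ge mult_right_mono diff_right_mono order_trans)

lemma huber_slope_lipschitz:
  assumes "\<epsilon> \<noteq> 0"
  shows "\<bar>huber_slope \<epsilon> t - huber_slope \<epsilon> t'\<bar> \<le> \<bar>t - t'\<bar> / \<bar>\<epsilon>\<bar>"
proof -
  have "\<bar>min 1 (max 0 u) - min 1 (max 0 v)\<bar> \<le> \<bar>u - v\<bar>" for u v :: real
    by (auto simp: min_def max_def abs_if)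
  then have "\<bar>huber_slope \<epsilon> t - huber_slope \<epsilon> t'\<bar> \<le> \<bar>t / \<bar>\<epsilon>\<bar> - t' / \<bar>\<epsilon>\<bar>\<bar>"
    unfolding huber_slope_def .
  also have "\<dots> = \<bar>t - t'\<bar> / \<bar>\<epsilon>\<bar>" by (simp add: abs_divide flip: diff_divide_distrib)
  finally show ?thesis .
qed

lemma huber_slope_lipschitz_parameter:
  assumes "\<epsilon> \<noteq> 0" "\<epsilon>' \<noteq> 0"
  shows "\<bar>huber_slope \<epsilon> t - huber_slope \<epsilon>' t\<bar> \<le> \<bar>\<epsilon> - \<epsilon>'\<bar> / \<bar>\<epsilon>\<bar>"
proof -
  define a b where "a = \<bar>\<epsilon>\<bar>" and "b = \<bar>\<epsilon>'\<bar>"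
  have ab: "a > 0" "b > 0" using assms by (auto simp: a_def b_def)
  have "\<bar>min 1 (max 0 (t / a)) - min 1 (max 0 (t / b))\<bar> \<le> \<bar>a - b\<bar> / a"
  proof (cases "0 \<le> t")
    case False
    then have "t / a < 0" "t / b < 0" using ab by (auto simp: divide_neg_pos)
    then show ?thesis using ab by (simp add: max_def)
  next
    case True
    then have q: "min 1 (max 0 (t / a)) = min 1 (t / a)" "min 1 (max 0 (t / b)) = min 1 (t / b)"
      using ab by auto
    show ?thesis
    proof (cases "t \<le> b")
      case True
      have "\<bar>min 1 (t / a) - min 1 (t / b)\<bar> \<le> \<bar>t / a - t / b\<bar>" by (simp add: min_def)
      also have "t / a - t / b = (t / b) * ((b - a) / a)" using ab by (simp add: field_simps)
      also have "\<bar>\<dots>\<bar> = \<bar>t / b\<bar> * (\<bar>b - a\<bar> / a)" using ab by (simp add: abs_mult)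
      also have "\<dots> \<le> 1 * (\<bar>b - a\<bar> / a)"
        using ab True \<open>0 \<le> t\<close> by (intro mult_right_mono) auto
      finally show ?thesis unfolding q by (simp add: abs_minus_commute)
    next
      case False
      then have "min 1 (t / b) = 1" using ab by (simp add: min_def)
      moreover have "(a - t) / a \<le> \<bar>a - b\<bar> / a" using False ab by (intro divide_right_mono) auto
      then have "1 - t / a \<le> \<bar>a - b\<bar> / a" using ab by (simp add: diff_divide_distrib)
      moreover have "0 \<le> \<bar>a - b\<bar> / a" using ab by simp
      ultimately show ?thesis unfolding q by (simp add: min_def)
    qed
  qed
  moreover have "\<bar>a - b\<bar> / a \<le> \<bar>\<epsilon> - \<epsilon>'\<bar> / a" using ab by (intro divide_right_mono) (auto simp: a_def b_def)
  ultimately show ?thesis by (simp add: huber_slope_def flip: a_def b_def)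
qed

lemma huber_taylor:
  assumes "\<epsilon> \<noteq> 0"
  shows "\<bar>huber \<epsilon> t' - huber \<epsilon> t - huber_slope \<epsilon> t * (t' - t)\<bar> \<le> (t' - t)\<^sup>2 / \<bar>\<epsilon>\<bar>"
proof -
  let ?q = "huber_slope \<epsilon> t" and ?q' = "huber_slope \<epsilon> t'"
  let ?D = "huber \<epsilon> t' - huber \<epsilon> t - ?q * (t' - t)"
  have "t' * ?q - \<bar>\<epsilon>\<bar> * ?q\<^sup>2 / 2 \<le> huber \<epsilon> t'" "t * ?q' - \<bar>\<epsilon>\<bar> * ?q'\<^sup>2 / 2 \<le> huber \<epsilon> t"
    by (simp_all add: huber_ge huber_slope_bounds)
  then have "0 \<le> ?D" "?D \<le> (?q' - ?q) * (t' - t)"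
    using huber_eq_slope[OF assms, of t] huber_eq_slope[OF assms, of t'] by (simp_all add: algebra_simps)
  then have "\<bar>?D\<bar> \<le> \<bar>?q' - ?q\<bar> * \<bar>t' - t\<bar>" by (simp add: abs_mult[symmetric])
  also have "\<dots> \<le> \<bar>t' - t\<bar> / \<bar>\<epsilon>\<bar> * \<bar>t' - t\<bar>"
    by (intro mult_right_mono huber_slope_lipschitz assms) simp
  finally show ?thesis by (simp add: power2_eq_square)
qed

lemma huber_taylor_parameter:
  assumes "\<bar>\<epsilon>' - \<epsilon>\<bar> < \<bar>\<epsilon>\<bar>"
  shows "\<bar>huber \<epsilon>' t - huber \<epsilon> t - (- sgn \<epsilon> * (huber_slope \<epsilon> t)\<^sup>2 / 2) * (\<epsilon>' - \<epsilon>)\<bar> \<le> (\<epsilon>' - \<epsilon>)\<^sup>2 / \<bar>\<epsilon>\<bar>"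
proof -
  have nz: "\<epsilon> \<noteq> 0" "\<epsilon>' \<noteq> 0" using assms by auto
  have sgn: "sgn \<epsilon> * (\<epsilon>' - \<epsilon>) = \<bar>\<epsilon>'\<bar> - \<bar>\<epsilon>\<bar>" using assms by (auto simp: sgn_real_def)
  let ?q = "huber_slope \<epsilon> t" and ?q' = "huber_slope \<epsilon>' t"
  let ?D = "huber \<epsilon>' t - huber \<epsilon> t + (\<bar>\<epsilon>'\<bar> - \<bar>\<epsilon>\<bar>) * ?q\<^sup>2 / 2"
  have "t * ?q - \<bar>\<epsilon>'\<bar> * ?q\<^sup>2 / 2 \<le> huber \<epsilon>' t" "t * ?q' - \<bar>\<epsilon>\<bar> * ?q'\<^sup>2 / 2 \<le> huber \<epsilon> t"
    by (simp_all add: huber_ge huber_slope_bounds)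
  then have "0 \<le> ?D" "?D \<le> (\<bar>\<epsilon>'\<bar> - \<bar>\<epsilon>\<bar>) * (?q\<^sup>2 - ?q'\<^sup>2) / 2"
    using huber_eq_slope[OF nz(1), of t] huber_eq_slope[OF nz(2), of t]
    unfolding left_diff_distrib right_diff_distrib diff_divide_distrib by linarith+
  then have "\<bar>?D\<bar> \<le> \<bar>(\<bar>\<epsilon>'\<bar> - \<bar>\<epsilon>\<bar>) * (?q\<^sup>2 - ?q'\<^sup>2) / 2\<bar>" by linarith
  also have "\<dots> = \<bar>\<bar>\<epsilon>'\<bar> - \<bar>\<epsilon>\<bar>\<bar> * (\<bar>?q - ?q'\<bar> * ((?q + ?q') / 2))"
    using huber_slope_bounds(1)[of \<epsilon> t] huber_slope_bounds(1)[of \<epsilon>' t]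
    by (simp add: power2_eq_square abs_mult square_diff_square_factored)
  also have "\<dots> \<le> \<bar>\<epsilon>' - \<epsilon>\<bar> * (\<bar>\<epsilon> - \<epsilon>'\<bar> / \<bar>\<epsilon>\<bar> * 1)"
    using huber_slope_bounds[of \<epsilon> t] huber_slope_bounds[of \<epsilon>' t]
    by (intro mult_mono huber_slope_lipschitz_parameter nz) auto
  also have "\<dots> = \<bar>\<epsilon>' - \<epsilon>\<bar>\<^sup>2 / \<bar>\<epsilon>\<bar>" by (simp add: power2_eq_square abs_minus_commute del: abs_mult_self_eq)
  also have "\<dots> = (\<epsilon>' - \<epsilon>)\<^sup>2 / \<bar>\<epsilon>\<bar>" by simp
  finally have "\<bar>?D\<bar> \<le> (\<epsilon>' - \<epsilon>)\<^sup>2 / \<bar>\<epsilon>\<bar>" .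
  moreover have "?D = huber \<epsilon>' t - huber \<epsilon> t - (- sgn \<epsilon> * ?q\<^sup>2 / 2) * (\<epsilon>' - \<epsilon>)"
    unfolding sgn[symmetric] by (simp add: algebra_simps)
  ultimately show ?thesis by simp
qed

lemma has_derivative_huber:
  assumes "\<epsilon> \<noteq> 0"
  shows "(huber \<epsilon> has_real_derivative huber_slope \<epsilon> t) (at t)"
  unfolding has_field_derivative_def
  by (rule has_derivative_if_quadratic_error[where \<delta> = 1 and C = "1 / \<bar>\<epsilon>\<bar>"])
     (use huber_taylor[OF assms, of _ t] in \<open>auto intro: bounded_linear_mult_right\<close>)

lemma has_derivative_huber_parameter:
  assumes "\<epsilon> \<noteq> 0"
  shows "((\<lambda>e. huber e t) has_real_derivative - sgn \<epsilon> * (huber_slope \<epsilon> t)\<^sup>2 / 2) (at \<epsilon>)"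
  unfolding has_field_derivative_def
  by (rule has_derivative_if_quadratic_error[where \<delta> = "\<bar>\<epsilon>\<bar>" and C = "1 / \<bar>\<epsilon>\<bar>"])
     (use huber_taylor_parameter[of _ \<epsilon> t] assms in \<open>auto intro: bounded_linear_mult_right\<close>)

lemma huber_d2_eq: "\<epsilon> \<noteq> 0 \<Longrightarrow> huber_d2 \<epsilon> t = huber_slope \<epsilon> t"
  unfolding huber_d2_def by (intro DERIV_imp_deriv has_derivative_huber)

lemma huber_d1_eq: "\<epsilon> \<noteq> 0 \<Longrightarrow> huber_d1 \<epsilon> t = - sgn \<epsilon> * (huber_slope \<epsilon> t)\<^sup>2 / 2"
  unfolding huber_d1_def by (intro DERIV_imp_deriv has_derivative_huber_parameter)

lemma huber_d1_lipschitz: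
  assumes "\<epsilon> \<noteq> 0"
  shows "\<bar>huber_d1 \<epsilon> t - huber_d1 \<epsilon> t'\<bar> \<le> \<bar>t - t'\<bar> / \<bar>\<epsilon>\<bar>"
proof -
  let ?q = "huber_slope \<epsilon> t" and ?q' = "huber_slope \<epsilon> t'"
  have "huber_d1 \<epsilon> t - huber_d1 \<epsilon> t' = - sgn \<epsilon> * ((?q - ?q') * ((?q + ?q') / 2))"
    using assms by (simp add: huber_d1_eq power2_eq_square field_simps)
  also have "\<bar>\<dots>\<bar> = \<bar>?q - ?q'\<bar> * ((?q + ?q') / 2)"
    using assms huber_slope_bounds(1)[of \<epsilon> t] huber_slope_bounds(1)[of \<epsilon> t']
    by (simp add: abs_mult abs_sgn_eq)
  also have "\<dots> \<le> \<bar>t - t'\<bar> / \<bar>\<epsilon>\<bar> * 1"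
    using huber_slope_bounds[of \<epsilon> t] huber_slope_bounds[of \<epsilon> t']
    by (intro mult_mono huber_slope_lipschitz assms) auto
  finally show ?thesis by simp
qed

text \<open>
  For \<open>\<epsilon> = 0\<close> the value at \<open>x = y\<close> is \<open>0\<close>, due to the division by zero in the slope; the secant identity and
  the bounds below hold for this value as well.
\<close>

definition divdiff :: "real \<Rightarrow> real \<Rightarrow> real \<Rightarrow> real" where
  "divdiff \<epsilon> x y = (if x \<noteq> y then (huber \<epsilon> x - huber \<epsilon> y) / (x - y) else huber_slope \<epsilon> x)"

lemma Omega_eq_divdiff: "\<epsilon> \<noteq> 0 \<Longrightarrow> Omega \<epsilon> d $ i $ j = divdiff \<epsilon> (d $ i) (d $ j)"
  by (simp add: Omega_def divdiff_def huber_d2_eq)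

lemma divdiff_mult: "divdiff \<epsilon> x y * (x - y) = huber \<epsilon> x - huber \<epsilon> y"
  by (simp add: divdiff_def)

lemma divdiff_commute: "divdiff \<epsilon> x y = divdiff \<epsilon> y x"
  unfolding divdiff_def by (metis minus_diff_eq minus_divide_divide)

lemma divdiff_bounds: "0 \<le> divdiff \<epsilon> x y" "divdiff \<epsilon> x y \<le> 1"
proof -
  have *: "0 \<le> divdiff \<epsilon> x y \<and> divdiff \<epsilon> x y \<le> 1" if "x > y" for x y
    using huber_mono[of y x \<epsilon>] huber_lipschitz[of \<epsilon> x \<epsilon> y] that by (simp add: divdiff_def divide_le_eq)
  show "0 \<le> divdiff \<epsilon> x y" "divdiff \<epsilon> x y \<le> 1"
    using *[of x y] *[of y x] divdiff_commute[of \<epsilon> x y]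
    by (cases x y rule: linorder_cases; simp add: divdiff_def huber_slope_bounds)+
qed

text \<open>
  The divided difference \<open>\<integral>\<^sub>0\<^sup>1 h\<^sub>2'(\<epsilon>, x + s (y - x)) ds\<close> inherits the Lipschitz constant of \<open>h\<^sub>2'\<close>.
\<close>

lemma divdiff_has_integral:
  assumes "\<epsilon> \<noteq> 0"
  shows "((\<lambda>s. huber_slope \<epsilon> (x + s * (y - x))) has_integral divdiff \<epsilon> x y) {0..1}"
proof (cases "x = y")
  case True
  then show ?thesis using has_integral_const_real[of "huber_slope \<epsilon> x" 0 1] by (simp add: divdiff_def)
next
  case False
  have "((\<lambda>s. (y - x) * huber_slope \<epsilon> (x + s * (y - x))) has_integral
      huber \<epsilon> (x + 1 * (y - x)) - huber \<epsilon> (x + 0 * (y - x))) {0..1}"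
  proof (rule fundamental_theorem_of_calculus)
    fix s :: real
    have "((\<lambda>s. huber \<epsilon> (x + s * (y - x))) has_real_derivative
        huber_slope \<epsilon> (x + s * (y - x)) * (y - x)) (at s)"
      by (rule DERIV_chain2[OF has_derivative_huber[OF assms]]) (auto intro!: derivative_eq_intros)
    then show "((\<lambda>s. huber \<epsilon> (x + s * (y - x))) has_vector_derivative
        (y - x) * huber_slope \<epsilon> (x + s * (y - x))) (at s within {0..1})"
      by (simp add: has_field_derivative_at_within has_real_derivative_iff_has_vector_derivative mult.commute
          flip: has_real_derivative_iff_has_vector_derivative)
  qed simp
  from has_integral_mult_right[OF this, of "1 / (y - x)"] show ?thesis
    using False divdiff_commute[of \<epsilon> x y] by (simp add: divdiff_def)
qed

lemma divdiff_lipschitz: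
  assumes "\<epsilon> \<noteq> 0"
  shows "\<bar>divdiff \<epsilon> x y - divdiff \<epsilon> x z\<bar> \<le> \<bar>y - z\<bar> / \<bar>\<epsilon>\<bar>"
proof -
  have "((\<lambda>s. huber_slope \<epsilon> (x + s * (y - x)) - huber_slope \<epsilon> (x + s * (z - x))) has_integral
      divdiff \<epsilon> x y - divdiff \<epsilon> x z) (cbox 0 1)"
    using has_integral_diff[OF divdiff_has_integral[OF assms, of x y] divdiff_has_integral[OF assms, of x z]]
    by simp
  moreover have "norm (huber_slope \<epsilon> (x + s * (y - x)) - huber_slope \<epsilon> (x + s * (z - x))) \<le> \<bar>y - z\<bar> / \<bar>\<epsilon>\<bar>"
    if "s \<in> cbox 0 1" for s
  proof -
    have "\<bar>(x + s * (y - x)) - (x + s * (z - x))\<bar> = s * \<bar>y - z\<bar>"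
      using that by (simp add: abs_mult flip: right_diff_distrib)
    also have "\<dots> \<le> 1 * \<bar>y - z\<bar>" using that by (intro mult_right_mono) auto
    finally have "\<bar>(x + s * (y - x)) - (x + s * (z - x))\<bar> / \<bar>\<epsilon>\<bar> \<le> \<bar>y - z\<bar> / \<bar>\<epsilon>\<bar>"
      by (intro divide_right_mono) auto
    then show ?thesis
      using huber_slope_lipschitz[OF assms, of "x + s * (y - x)" "x + s * (z - x)"] by simp
  qed
  ultimately have "norm (divdiff \<epsilon> x y - divdiff \<epsilon> x z) \<le> \<bar>y - z\<bar> / \<bar>\<epsilon>\<bar> * measure lborel (cbox 0 (1 :: real))"
    by (intro has_integral_bound) auto
  then show ?thesis by simp
qed

section \<open>The derivative of the matrix function off \<open>\<epsilon> = 0\<close>\<close>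

lemma matrix_linear_distribs:
  fixes A B :: "real^'n^'m"
  shows "C ** (A + B) = C ** A + C ** B" "(A + B) ** D = A ** D + B ** D"
    "C ** (c *\<^sub>R A) = c *\<^sub>R (C ** A)" "(c *\<^sub>R A) ** D = c *\<^sub>R (A ** D)"
  by (simp_all add: vec_eq_iff matrix_mult_entry algebra_simps sum.distrib sum_distrib_left)

lemma mat_of_linear:
  "mat_of (A + B) = mat_of A + mat_of B" "mat_of (c *\<^sub>R A) = c *\<^sub>R mat_of A"
  by (rule plus_symmat.rep_eq scaleR_symmat.rep_eq)+

text \<open>
  The candidate for the derivative, applied to the direction \<open>v = (\<tau>, H)\<close>. That it depends only on the point
  and not on the frame \<open>P\<close> follows from the uniqueness of derivatives.
\<close>

definition PhiD :: "real \<Rightarrow> real^'n^'n \<Rightarrow> real^'n \<Rightarrow> real \<times> 'n::finite symmat \<Rightarrow> 'n symmat" where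
  "PhiD \<epsilon> P d v = symmat_of
     (P ** (Omega \<epsilon> d * (transpose P ** mat_of (snd v) ** P) + fst v *\<^sub>R Dcal \<epsilon> d) ** transpose P)"

lemma mat_of_PhiD:
  "mat_of (PhiD \<epsilon> P d v) =
     P ** (Omega \<epsilon> d * (transpose P ** mat_of (snd v) ** P) + fst v *\<^sub>R Dcal \<epsilon> d) ** transpose P"
proof -
  let ?A = "Omega \<epsilon> d * (transpose P ** mat_of (snd v) ** P) + fst v *\<^sub>R Dcal \<epsilon> d"
  have Om: "Omega \<epsilon> d $ i $ j = Omega \<epsilon> d $ j $ i" for i j
    unfolding Omega_def by simp (metis minus_diff_eq minus_divide_divide)
  have "?A $ j $ i = ?A $ i $ j" for i j
    using conjugated_symmetric[of P "snd v" i j]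
    by (simp add: Om[of j i] Dcal_def diag_mat_nth)
  then have "transpose ?A = ?A" by (simp add: vec_eq_iff transpose_def)
  then have "transpose (P ** ?A ** transpose P) = P ** ?A ** transpose P"
    by (simp add: matrix_transpose_mul matrix_mul_assoc)
  then show ?thesis unfolding PhiD_def by (simp add: symmat_of_inverse)
qed

lemma linear_PhiD: "linear (PhiD \<epsilon> P d)"
proof (rule linearI)
  fix v w and c :: real
  show "PhiD \<epsilon> P d (v + w) = PhiD \<epsilon> P d v + PhiD \<epsilon> P d w"
    by (simp add: mat_of_inject' mat_of_linear mat_of_PhiD matrix_linear_distribs algebra_simps)
  have "Omega \<epsilon> d * (c *\<^sub>R B) = c *\<^sub>R (Omega \<epsilon> d * B)" for B
    by (simp add: vec_eq_iff)
  then show "PhiD \<epsilon> P d (c *\<^sub>R v) = c *\<^sub>R PhiD \<epsilon> P d v"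
    by (simp add: mat_of_inject' mat_of_linear mat_of_PhiD matrix_linear_distribs scaleR_add_right)
qed

lemma Phi_diff_mixed_frame:
  assumes "spectral_decomp W P d" "spectral_decomp X R e"
  shows "(transpose P ** (mat_of (Phi (\<epsilon>', X)) - mat_of (Phi (\<epsilon>, W))) ** R) $ i $ k
    = (transpose P ** R) $ i $ k * (huber \<epsilon>' (e $ k) - huber \<epsilon> (d $ i))"
  using mixed_frame_diff[OF assms[THEN huber_mat_frame], of \<epsilon>' \<epsilon> i k] by simp

lemma norm_symmat_le_entry_bound:
  fixes A :: "'n::finite symmat"
  assumes "orthogonal_matrix P" "orthogonal_matrix R"
    "\<And>i k. \<bar>(transpose P ** mat_of A ** R) $ i $ k\<bar> \<le> B"
  shows "norm A \<le> real CARD('n) * B"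
  using norm_le_entry_bound[OF assms(3)] by (simp add: norm_change_frames[OF assms(1,2)])

lemma Phi_lipschitz:
  fixes y y' :: "real \<times> 'n::{finite,linorder} symmat"
  shows "norm (Phi y' - Phi y) \<le> 2 * real CARD('n) * norm (y' - y)"
proof -
  obtain \<epsilon> W \<epsilon>' X where y: "y = (\<epsilon>, W)" "y' = (\<epsilon>', X)" by (metis surj_pair)
  obtain P d R e where W: "spectral_decomp W P d" and X: "spectral_decomp X R e"
    by (metis ex_spectral_decomp)
  have "norm (Phi y' - Phi y) \<le> real CARD('n) * (2 * norm (y' - y))"
  proof (rule norm_symmat_le_entry_bound)
    fix i k
    let ?m = "(transpose P ** R) $ i $ k"
    have "\<bar>(transpose P ** mat_of (Phi y' - Phi y) ** R) $ i $ k\<bar> = \<bar>?m\<bar> * \<bar>huber \<epsilon>' (e $ k) - huber \<epsilon> (d $ i)\<bar>"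
      by (simp add: mat_of_minus y Phi_diff_mixed_frame[OF W X] abs_mult)
    also have "\<dots> \<le> \<bar>?m\<bar> * (\<bar>e $ k - d $ i\<bar> + \<bar>\<epsilon>' - \<epsilon>\<bar> / 2)"
      by (intro mult_left_mono huber_lipschitz) simp
    also have "\<dots> = \<bar>?m\<bar> * \<bar>e $ k - d $ i\<bar> + \<bar>?m\<bar> * (\<bar>\<epsilon>' - \<epsilon>\<bar> / 2)"
      by (simp add: distrib_left)
    also have "\<dots> \<le> norm (X - W) + 1 * \<bar>\<epsilon>' - \<epsilon>\<bar>"
      by (intro add_mono mixed_frame_bound[OF W X] mult_mono orthogonal_entry_le_1[OF orthogonal_frames[OF W X]]) auto
    also have "\<dots> \<le> 2 * norm (y' - y)"
      using norm_fst_le[of "\<epsilon>' - \<epsilon>" "X - W"] norm_snd_le[of "X - W" "\<epsilon>' - \<epsilon>"] by (simp add: y)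
    finally show "\<bar>(transpose P ** mat_of (Phi y' - Phi y) ** R) $ i $ k\<bar> \<le> 2 * norm (y' - y)" .
  qed (use W X in \<open>auto dest: spectral_decompD\<close>)
  then show ?thesis by (simp add: mult_ac)
qed

text \<open>
  In the mixed frame of the two eigenbases, \<open>\<Phi>(\<epsilon>,X) - \<Phi>(\<epsilon>,W)\<close> has the entries
  \<open>\<Sum>\<^sub>l (P\<^sup>T H P)\<^sub>i\<^sub>l M\<^sub>l\<^sub>k h[d\<^sub>i, e\<^sub>k]\<close> with \<open>H = X - W\<close> and \<open>M = P\<^sup>T R\<close>, and the derivative has the same
  entries with the divided differences \<open>h[d\<^sub>i, d\<^sub>l]\<close>. Replacing \<open>e\<^sub>k\<close> by \<open>d\<^sub>l\<close> costs a factor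
  \<open>|e\<^sub>k - d\<^sub>l|\<close>, which \<open>M\<^sub>l\<^sub>k\<close> turns into a second factor \<open>\<parallel>H\<parallel>\<close>, whatever the multiplicities are.
\<close>

lemma Phi_quadratic_error:
  fixes W X :: "'n::finite symmat"
  assumes W: "spectral_decomp W P d" and X: "spectral_decomp X R e" and \<epsilon>: "\<bar>\<epsilon>' - \<epsilon>\<bar> < \<bar>\<epsilon>\<bar>"
  shows "norm (Phi (\<epsilon>', X) - Phi (\<epsilon>, W) - PhiD \<epsilon> P d (\<epsilon>' - \<epsilon>, X - W))
    \<le> real CARD('n) * (real CARD('n) + 2) / \<bar>\<epsilon>\<bar> * (norm ((\<epsilon>', X) - (\<epsilon>, W)))\<^sup>2"
proof -
  define \<eta> where "\<eta> = norm ((\<epsilon>', X) - (\<epsilon>, W))"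
  define M where "M = transpose P ** R"
  define G where "G = transpose P ** (mat_of X - mat_of W) ** P"
  define \<tau> where "\<tau> = \<epsilon>' - \<epsilon>"
  have nz: "\<epsilon> \<noteq> 0" using \<epsilon> by auto
  have P: "orthogonal_matrix P" and R: "orthogonal_matrix R" using W X spectral_decompD by auto
  have \<tau>: "\<bar>\<tau>\<bar> \<le> \<eta>" and H: "norm (X - W) \<le> \<eta>"
    using norm_fst_le[of "\<epsilon>' - \<epsilon>" "X - W"] norm_snd_le[of "X - W" "\<epsilon>' - \<epsilon>"] by (simp_all add: \<eta>_def \<tau>_def)
  have \<eta>: "0 \<le> \<eta>" by (simp add: \<eta>_def)
  have Mb: "\<bar>M $ i $ k\<bar> \<le> 1" for i k
    unfolding M_def by (rule orthogonal_entry_le_1[OF orthogonal_frames[OF W X]])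
  have Me: "\<bar>M $ i $ k\<bar> * \<bar>e $ k - d $ i\<bar> \<le> \<eta>" for i k
    using mixed_frame_bound[OF W X, of i k] H by (simp add: M_def)
  have "norm G = norm (X - W)"
    by (simp add: G_def norm_change_frames[OF P P] flip: mat_of_minus)
  then have Gb: "\<bar>G $ i $ l\<bar> \<le> \<eta>" for i l using abs_entry_le_norm[of G i l] H by linarith
  have GM: "(\<Sum>l\<in>UNIV. G $ i $ l * M $ l $ k) = M $ i $ k * (e $ k - d $ i)" for i k
  proof -
    have "G ** M = transpose P ** (mat_of X - mat_of W) ** R"
      by (simp add: G_def M_def matrix_mul_assoc orthogonal_cancel[OF P])
    from arg_cong[OF this, of "\<lambda>A. A $ i $ k"] show ?thesis
      unfolding mixed_frame_diff[OF W X] matrix_mult_entry[of G] by (simp add: M_def)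
  qed
  have "norm (Phi (\<epsilon>', X) - Phi (\<epsilon>, W) - PhiD \<epsilon> P d (\<epsilon>' - \<epsilon>, X - W))
      \<le> real CARD('n) * ((real CARD('n) + 2) / \<bar>\<epsilon>\<bar> * \<eta>\<^sup>2)"
  proof (rule norm_symmat_le_entry_bound[OF P R])
    fix i k
    let ?\<omega> = "divdiff \<epsilon> (d $ i)"
    have D: "transpose P ** mat_of (PhiD \<epsilon> P d (\<tau>, X - W)) ** R = (Omega \<epsilon> d * G + \<tau> *\<^sub>R Dcal \<epsilon> d) ** M"
      by (simp add: mat_of_PhiD mat_of_minus matrix_mul_assoc G_def M_def orthogonal_matrixD[OF P])
    have "(transpose P ** mat_of (PhiD \<epsilon> P d (\<tau>, X - W)) ** R) $ i $ k
        = (\<Sum>l\<in>UNIV. Omega \<epsilon> d $ i $ l * G $ i $ l * M $ l $ k) + \<tau> * huber_d1 \<epsilon> (d $ i) * M $ i $ k"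
      unfolding D matrix_linear_distribs Dcal_def
      by (simp add: diag_mat_mult_entry matrix_mult_entry[of "Omega \<epsilon> d * G"])
    then have D: "(transpose P ** mat_of (PhiD \<epsilon> P d (\<tau>, X - W)) ** R) $ i $ k
        = (\<Sum>l\<in>UNIV. G $ i $ l * M $ l $ k * ?\<omega> (d $ l)) + \<tau> * huber_d1 \<epsilon> (d $ i) * M $ i $ k"
      by (simp add: Omega_eq_divdiff[OF nz] mult_ac)
    have "?\<omega> (e $ k) * (e $ k - d $ i) = huber \<epsilon> (e $ k) - huber \<epsilon> (d $ i)"
      using divdiff_mult[of \<epsilon> "d $ i" "e $ k"] by (simp add: algebra_simps)
    then have "M $ i $ k * (huber \<epsilon> (e $ k) - huber \<epsilon> (d $ i)) = ?\<omega> (e $ k) * (M $ i $ k * (e $ k - d $ i))"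
      by (metis mult.left_commute)
    also have "\<dots> = (\<Sum>l\<in>UNIV. G $ i $ l * M $ l $ k * ?\<omega> (e $ k))"
      unfolding GM[symmetric] by (simp add: sum_distrib_left mult_ac)
    finally have F: "M $ i $ k * (huber \<epsilon> (e $ k) - huber \<epsilon> (d $ i)) = \<dots>" .
    have E: "(transpose P ** mat_of (Phi (\<epsilon>', X) - Phi (\<epsilon>, W) - PhiD \<epsilon> P d (\<tau>, X - W)) ** R) $ i $ k
       = (\<Sum>l\<in>UNIV. G $ i $ l * M $ l $ k * ?\<omega> (e $ k)) - (\<Sum>l\<in>UNIV. G $ i $ l * M $ l $ k * ?\<omega> (d $ l))
         + M $ i $ k * (huber \<epsilon>' (e $ k) - huber \<epsilon> (e $ k) - huber_d1 \<epsilon> (d $ i) * \<tau>)"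
      using Phi_diff_mixed_frame[OF W X, of \<epsilon>' \<epsilon> i k] F
      unfolding mat_of_minus[of "Phi _ - Phi _"] matrix_diff_distribs(1)[of _ "mat_of (Phi _ - Phi _)"]
        matrix_diff_distribs(2)[of "transpose P ** mat_of (Phi _ - Phi _)"] vector_minus_component D
      by (simp add: mat_of_minus M_def algebra_simps)
    have "\<bar>G $ i $ l * M $ l $ k * ?\<omega> (e $ k) - G $ i $ l * M $ l $ k * ?\<omega> (d $ l)\<bar> \<le> \<eta> * (\<eta> / \<bar>\<epsilon>\<bar>)" for l
    proof -
      have "\<bar>G $ i $ l * M $ l $ k * ?\<omega> (e $ k) - G $ i $ l * M $ l $ k * ?\<omega> (d $ l)\<bar>
          = \<bar>G $ i $ l\<bar> * (\<bar>M $ l $ k\<bar> * \<bar>?\<omega> (e $ k) - ?\<omega> (d $ l)\<bar>)"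
        by (simp add: mult.assoc abs_mult flip: right_diff_distrib)
      also have "\<dots> \<le> \<eta> * (\<bar>M $ l $ k\<bar> * (\<bar>e $ k - d $ l\<bar> / \<bar>\<epsilon>\<bar>))"
        by (intro mult_mono mult_left_mono Gb divdiff_lipschitz nz) (auto simp: \<eta>)
      also have "\<dots> = \<eta> * ((\<bar>M $ l $ k\<bar> * \<bar>e $ k - d $ l\<bar>) / \<bar>\<epsilon>\<bar>)" by simp
      also have "\<dots> \<le> \<eta> * (\<eta> / \<bar>\<epsilon>\<bar>)" by (intro mult_left_mono divide_right_mono Me \<eta>) auto
      finally show ?thesis .
    qed
    then have "\<bar>(\<Sum>l\<in>UNIV. G $ i $ l * M $ l $ k * ?\<omega> (e $ k)) - (\<Sum>l\<in>UNIV. G $ i $ l * M $ l $ k * ?\<omega> (d $ l))\<bar>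
       \<le> (\<Sum>l\<in>(UNIV :: 'n set). \<eta> * (\<eta> / \<bar>\<epsilon>\<bar>))"
      unfolding sum_subtractf[symmetric] by (intro order_trans[OF sum_abs] sum_mono)
    then have 1: "\<bar>(\<Sum>l\<in>UNIV. G $ i $ l * M $ l $ k * ?\<omega> (e $ k)) - (\<Sum>l\<in>UNIV. G $ i $ l * M $ l $ k * ?\<omega> (d $ l))\<bar>
       \<le> real CARD('n) * (\<eta>\<^sup>2 / \<bar>\<epsilon>\<bar>)" by (simp add: power2_eq_square)
    have "\<bar>M $ i $ k * (huber \<epsilon>' (e $ k) - huber \<epsilon> (e $ k) - huber_d1 \<epsilon> (d $ i) * \<tau>)\<bar>
        \<le> \<bar>M $ i $ k\<bar> * (\<tau>\<^sup>2 / \<bar>\<epsilon>\<bar> + \<bar>\<tau>\<bar> * (\<bar>e $ k - d $ i\<bar> / \<bar>\<epsilon>\<bar>))"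
    proof -
      have "\<bar>huber \<epsilon>' (e $ k) - huber \<epsilon> (e $ k) - huber_d1 \<epsilon> (e $ k) * \<tau>\<bar> \<le> \<tau>\<^sup>2 / \<bar>\<epsilon>\<bar>"
        using huber_taylor_parameter[OF \<epsilon>] by (simp add: huber_d1_eq[OF nz] \<tau>_def)
      moreover have "\<bar>\<tau> * (huber_d1 \<epsilon> (e $ k) - huber_d1 \<epsilon> (d $ i))\<bar> \<le> \<bar>\<tau>\<bar> * (\<bar>e $ k - d $ i\<bar> / \<bar>\<epsilon>\<bar>)"
        unfolding abs_mult by (intro mult_left_mono huber_d1_lipschitz nz) auto
      ultimately have "\<bar>huber \<epsilon>' (e $ k) - huber \<epsilon> (e $ k) - huber_d1 \<epsilon> (d $ i) * \<tau>\<bar>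
          \<le> \<tau>\<^sup>2 / \<bar>\<epsilon>\<bar> + \<bar>\<tau>\<bar> * (\<bar>e $ k - d $ i\<bar> / \<bar>\<epsilon>\<bar>)"
        unfolding right_diff_distrib mult.commute[of \<tau>] by (rule order_trans[OF _ add_mono, rotated]) simp
      then show ?thesis unfolding abs_mult by (intro mult_left_mono) auto
    qed
    also have "\<dots> = \<bar>M $ i $ k\<bar> * (\<tau>\<^sup>2 / \<bar>\<epsilon>\<bar>) + \<bar>\<tau>\<bar> * ((\<bar>M $ i $ k\<bar> * \<bar>e $ k - d $ i\<bar>) / \<bar>\<epsilon>\<bar>)"
      by (simp add: algebra_simps)
    also have "\<dots> \<le> 1 * (\<eta>\<^sup>2 / \<bar>\<epsilon>\<bar>) + \<eta> * (\<eta> / \<bar>\<epsilon>\<bar>)"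
      using \<tau> by (intro add_mono mult_mono divide_right_mono Mb Me \<eta>) (auto simp: \<eta> abs_le_square_iff[symmetric])
    also have "\<dots> = 2 * (\<eta>\<^sup>2 / \<bar>\<epsilon>\<bar>)" by (simp add: power2_eq_square)
    finally have 2: "\<bar>M $ i $ k * (huber \<epsilon>' (e $ k) - huber \<epsilon> (e $ k) - huber_d1 \<epsilon> (d $ i) * \<tau>)\<bar> \<le> 2 * (\<eta>\<^sup>2 / \<bar>\<epsilon>\<bar>)" .
    have "(real CARD('n) + 2) / \<bar>\<epsilon>\<bar> * \<eta>\<^sup>2 = real CARD('n) * (\<eta>\<^sup>2 / \<bar>\<epsilon>\<bar>) + 2 * (\<eta>\<^sup>2 / \<bar>\<epsilon>\<bar>)"
      by (simp add: add_divide_distrib distrib_right)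
    with 1 2 show "\<bar>(transpose P ** mat_of (Phi (\<epsilon>', X) - Phi (\<epsilon>, W) - PhiD \<epsilon> P d (\<epsilon>' - \<epsilon>, X - W)) ** R) $ i $ k\<bar>
        \<le> (real CARD('n) + 2) / \<bar>\<epsilon>\<bar> * \<eta>\<^sup>2"
      unfolding \<tau>_def[symmetric] E by linarith
  qed
  then show ?thesis by (simp add: \<eta>_def mult.assoc)
qed

lemma bounded_linear_PhiD: "bounded_linear (PhiD \<epsilon> P d)"
  using linear_PhiD linear_conv_bounded_linear by blast

lemma has_derivative_Phi:
  fixes W :: "'n::{finite,linorder} symmat"
  assumes W: "spectral_decomp W P d" and "\<epsilon> \<noteq> 0"
  shows "(Phi has_derivative PhiD \<epsilon> P d) (at (\<epsilon>, W))"
proof (rule has_derivative_if_quadratic_error[OF bounded_linear_PhiD, where \<delta> = "\<bar>\<epsilon>\<bar>"])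
  fix y :: "real \<times> 'n symmat"
  assume less: "norm (y - (\<epsilon>, W)) < \<bar>\<epsilon>\<bar>"
  obtain \<epsilon>' X where y: "y = (\<epsilon>', X)" by (metis surj_pair)
  obtain R e where X: "spectral_decomp X R e" by (metis ex_spectral_decomp)
  have "\<bar>\<epsilon>' - \<epsilon>\<bar> < \<bar>\<epsilon>\<bar>"
    using norm_fst_le[of "\<epsilon>' - \<epsilon>" "X - W"] less by (simp add: y)
  from Phi_quadratic_error[OF W X this]
  show "norm (Phi y - Phi (\<epsilon>, W) - PhiD \<epsilon> P d (y - (\<epsilon>, W)))
      \<le> real CARD('n) * (real CARD('n) + 2) / \<bar>\<epsilon>\<bar> * (norm (y - (\<epsilon>, W)))\<^sup>2"
    by (simp add: y)
qed (use \<open>\<epsilon> \<noteq> 0\<close> in simp)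

section \<open>Second-order expansion at \<open>\<epsilon> = 0\<close>\<close>

lemma mat_of_Phi_frame:
  assumes "spectral_decomp W P d"
  shows "mat_of (Phi (\<epsilon>, W)) = P ** diag_mat (\<chi> i. huber \<epsilon> (d $ i)) ** transpose P"
  using spectral_decompD(2)[OF huber_mat_frame[OF assms]] .

text \<open>Euler's relation for the function \<open>h\<close>, which is positively homogeneous of degree one.\<close>

lemma PhiD_euler:
  assumes W: "spectral_decomp W P d" and "\<epsilon> \<noteq> 0"
  shows "PhiD \<epsilon> P d (\<epsilon>, W) = Phi (\<epsilon>, W)"
proof -
  have P: "orthogonal_matrix P" using W by (rule spectral_decompD)
  have D: "transpose P ** mat_of W ** P = diag_mat d"
    by (simp add: spectral_decompD(3)[OF W] orthogonal_cancel[OF P])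
  have "\<bar>\<epsilon>\<bar> = \<epsilon> * sgn \<epsilon>" by (simp add: abs_sgn mult.commute)
  then have h: "huber \<epsilon> t = huber_slope \<epsilon> t * t + \<epsilon> * huber_d1 \<epsilon> t" for t
    using \<open>\<epsilon> \<noteq> 0\<close> by (simp add: huber_eq_slope huber_d1_eq)
  have "Omega \<epsilon> d * diag_mat d + \<epsilon> *\<^sub>R Dcal \<epsilon> d = diag_mat (\<chi> i. huber \<epsilon> (d $ i))"
    by (simp add: vec_eq_iff diag_mat_nth Dcal_def Omega_eq_divdiff[OF \<open>\<epsilon> \<noteq> 0\<close>] divdiff_def h)
  then show ?thesis
    by (simp add: mat_of_inject' mat_of_PhiD mat_of_Phi_frame[OF W] D)
qed

lemma ex_min_gap:
  fixes e :: "real^'n"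
  obtains \<rho> where "\<rho> > 0" "\<And>k l. e $ k \<noteq> e $ l \<Longrightarrow> \<rho> \<le> \<bar>e $ k - e $ l\<bar>" "\<And>k. e $ k \<noteq> 0 \<Longrightarrow> \<rho> \<le> \<bar>e $ k\<bar>"
proof -
  let ?S = "range (\<lambda>(k, l). e $ k - e $ l) \<union> range (\<lambda>k. e $ k)"
  have "finite ?S" by simp
  from finite_set_avoid[OF this, of 0] obtain \<rho>
    where "\<rho> > 0" and \<rho>: "\<And>x. x \<in> ?S \<Longrightarrow> x \<noteq> 0 \<Longrightarrow> \<rho> \<le> dist 0 x" by blast
  show ?thesis
  proof (rule that[OF \<open>\<rho> > 0\<close>])
    show "\<rho> \<le> \<bar>e $ k - e $ l\<bar>" if "e $ k \<noteq> e $ l" for k l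
      using \<rho>[of "e $ k - e $ l"] rangeI[of "\<lambda>(k, l). e $ k - e $ l" "(k, l)"] that by simp
    show "\<rho> \<le> \<bar>e $ k\<bar>" if "e $ k \<noteq> 0" for k
      using \<rho>[of "e $ k"] that by simp
  qed
qed

lemma orthogonal_row_pivot:
  fixes N :: "real^'n^'n"
  assumes N: "orthogonal_matrix N"
  obtains k where "1 / real CARD('n) \<le> \<bar>N $ i $ k\<bar>"
proof -
  let ?n = "real CARD('n)"
  have "\<exists>k. 1 / ?n \<le> \<bar>N $ i $ k\<bar>"
  proof (rule ccontr)
    assume "\<not> ?thesis"
    then have "(N $ i $ k)\<^sup>2 < (1 / ?n)\<^sup>2" for k
      by (metis abs_ge_zero not_le power2_abs power_strict_mono pos2)
    then have "(\<Sum>k\<in>UNIV. (N $ i $ k)\<^sup>2) < (\<Sum>k\<in>(UNIV :: 'n set). (1 / ?n)\<^sup>2)"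
      by (intro sum_strict_mono) auto
    also have "\<dots> \<le> 1" by (simp add: power2_eq_square)
    finally show False using orthogonal_row_sum[OF N, of i i] by (simp add: power2_eq_square)
  qed
  then show ?thesis using that by blast
qed

text \<open>
  The entries of the difference in the eigenframe of \<open>X\<close> are \<open>\<Sum>\<^sub>k M\<^sub>i\<^sub>k M\<^sub>j\<^sub>k g(e\<^sub>k)\<close> with
  \<open>g(t) = h(0,t) - \<Omega>\<^sub>i\<^sub>j t\<close>. Let \<open>x\<close> and \<open>y\<close> be eigenvalues of \<open>W\<close> next to \<open>d\<^sub>i\<close> and \<open>d\<^sub>j\<close>. The value
  \<open>g(x)\<close> may be subtracted from all \<open>g(e\<^sub>k)\<close>: for \<open>i \<noteq> j\<close> because the rows of \<open>M\<close> are orthogonal, and for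
  \<open>i = j\<close> because \<open>g(x) = 0\<close>, as \<open>h(0,\<cdot>)\<close> and \<open>h(\<epsilon>,\<cdot>)\<close> have the same constant slope near \<open>x \<noteq> 0\<close>.
  Now every term has two factors of first order: \<open>M\<^sub>j\<^sub>k\<close> and \<open>M\<^sub>i\<^sub>k (e\<^sub>k - x)\<close> if \<open>e\<^sub>k\<close> is neither \<open>x\<close> nor
  \<open>y\<close>, and \<open>M\<^sub>i\<^sub>k\<close> and \<open>g(y) - g(x)\<close> if \<open>e\<^sub>k = y \<noteq> x\<close>, since \<open>\<Omega>\<^sub>i\<^sub>j\<close> is close to the divided difference of
  \<open>h(0,\<cdot>)\<close> at \<open>x\<close> and \<open>y\<close>.
\<close>

lemma Phi_quadratic_error_at_zero_aux:
  fixes W X :: "'n::finite symmat"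
  assumes W: "spectral_decomp W R e" and X: "spectral_decomp X P d" and nz: "\<epsilon> \<noteq> 0"
    and \<rho>: "\<rho> > 0" "\<And>k l. e $ k \<noteq> e $ l \<Longrightarrow> \<rho> \<le> \<bar>e $ k - e $ l\<bar>" "\<And>k. e $ k \<noteq> 0 \<Longrightarrow> \<rho> \<le> \<bar>e $ k\<bar>"
    and \<eta>: "\<bar>\<epsilon>\<bar> \<le> \<eta>" "norm (X - W) \<le> \<eta>" "(real CARD('n) + 1) * \<eta> < \<rho>"
  shows "norm (Phi (0, W) - PhiD \<epsilon> P d (0, W))
    \<le> real CARD('n) * (real CARD('n) * (4 * ((real CARD('n) + 1) * \<eta>)\<^sup>2 / \<rho>))"
proof -
  let ?n = "real CARD('n)"
  define K where "K = (?n + 1) * \<eta>"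
  define M where "M = transpose P ** R"
  have P: "orthogonal_matrix P" using X by (rule spectral_decompD)
  have M: "orthogonal_matrix M" unfolding M_def by (rule orthogonal_frames[OF X W])
  have n: "?n \<ge> 1" by (simp add: Suc_leI)
  have \<eta>0: "0 \<le> \<eta>" using \<eta>(1) by linarith
  have \<eta>K: "\<eta> \<le> ?n * \<eta>" "K = ?n * \<eta> + \<eta>" "0 \<le> K"
    using \<eta>0 n mult_right_mono[OF n \<eta>0] by (simp_all add: K_def distrib_right)
  have Mb: "\<bar>M $ i $ k\<bar> \<le> 1" for i k
    by (rule orthogonal_entry_le_1[OF M])
  have Me: "\<bar>M $ i $ k\<bar> * \<bar>e $ k - d $ i\<bar> \<le> \<eta>" for i k
    using mixed_frame_bound[OF X W, of i k] \<eta>(2) by (simp add: M_def norm_minus_commute)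
  have "\<exists>x \<in> range (($) e). \<bar>x - d $ i\<bar> \<le> ?n * \<eta>" for i
  proof -
    obtain k where "1 / ?n \<le> \<bar>M $ i $ k\<bar>" by (rule orthogonal_row_pivot[OF M])
    from abs_le_of_product[OF Me this] show ?thesis by auto
  qed
  then obtain near where near: "\<And>i. near i \<in> range (($) e)" "\<And>i. \<bar>near i - d $ i\<bar> \<le> ?n * \<eta>" by metis
  have MK: "\<bar>M $ i $ k\<bar> * \<bar>e $ k - near i\<bar> \<le> K" for i k
  proof -
    have "\<bar>M $ i $ k\<bar> * \<bar>e $ k - near i\<bar> \<le> \<bar>M $ i $ k\<bar> * (\<bar>e $ k - d $ i\<bar> + \<bar>near i - d $ i\<bar>)"
      by (intro mult_left_mono) auto
    also have "\<dots> \<le> \<eta> + 1 * (?n * \<eta>)"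
      unfolding distrib_left by (intro add_mono Me mult_mono Mb near) auto
    finally show ?thesis using \<eta>K by simp
  qed
  have small: "\<bar>M $ i $ k\<bar> \<le> K / \<rho>" if "e $ k \<noteq> near i" for i k
  proof -
    have "\<rho> \<le> \<bar>e $ k - near i\<bar>" using near(1)[of i] \<rho>(2) that by auto
    then have "\<bar>M $ i $ k\<bar> * \<rho> \<le> \<bar>M $ i $ k\<bar> * \<bar>e $ k - near i\<bar>" by (intro mult_left_mono) auto
    also have "\<dots> \<le> K" by (rule MK)
    finally show ?thesis using \<rho>(1) by (simp add: pos_le_divide_eq)
  qed
  have "norm (Phi (0, W) - PhiD \<epsilon> P d (0, W)) \<le> ?n * (?n * (4 * K\<^sup>2 / \<rho>))"
  proof (rule norm_symmat_le_entry_bound[OF P P])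
    fix i j
    define \<omega> where "\<omega> = divdiff \<epsilon> (d $ i) (d $ j)"
    define g where "g a = huber 0 a - \<omega> * a" for a
    have \<omega>: "0 \<le> \<omega>" "\<omega> \<le> 1" unfolding \<omega>_def by (rule divdiff_bounds)+
    have g: "\<bar>g a - g b\<bar> \<le> \<bar>a - b\<bar>" for a b
    proof -
      have "g a - g b = (divdiff 0 a b - \<omega>) * (a - b)"
        using divdiff_mult[of 0 a b] by (simp add: g_def algebra_simps)
      moreover have "\<bar>divdiff 0 a b - \<omega>\<bar> \<le> 1"
        using divdiff_bounds[of 0 a b] \<omega> by linarith
      ultimately show ?thesis using mult_right_mono[of _ 1 "\<bar>a - b\<bar>"] by (simp add: abs_mult)
    qed
    have MRe: "transpose P ** (R ** diag_mat f ** transpose R) ** P = M ** diag_mat f ** transpose M" for f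
      by (simp add: M_def matrix_transpose_mul matrix_mul_assoc)
    have "transpose P ** mat_of (PhiD \<epsilon> P d (0, W)) ** P = Omega \<epsilon> d * (transpose P ** mat_of W ** P)"
      by (simp add: mat_of_PhiD matrix_mul_assoc orthogonal_cancel[OF P] orthogonal_matrixD[OF P])
    then have "(transpose P ** mat_of (Phi (0, W) - PhiD \<epsilon> P d (0, W)) ** P) $ i $ j
        = (\<Sum>k\<in>UNIV. M $ i $ k * huber 0 (e $ k) * M $ j $ k) - \<omega> * (\<Sum>k\<in>UNIV. M $ i $ k * e $ k * M $ j $ k)"
      unfolding mat_of_minus matrix_diff_distribs mat_of_Phi_frame[OF W] spectral_decompD(2)[OF W] MRe
      by (simp add: conjugated_diag_entry Omega_eq_divdiff[OF nz] \<omega>_def)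
    also have "\<dots> = (\<Sum>k\<in>UNIV. M $ i $ k * M $ j $ k * g (e $ k))"
      by (simp add: g_def right_diff_distrib sum_subtractf sum_distrib_left mult_ac)
    also have "\<dots> = (\<Sum>k\<in>UNIV. M $ i $ k * M $ j $ k * (g (e $ k) - g (near i)))"
    proof -
      have "(\<Sum>k\<in>UNIV. M $ i $ k * M $ j $ k) * g (near i) = 0"
      proof (cases "i = j")
        case False
        then show ?thesis by (simp add: orthogonal_row_sum[OF M])
      next
        case True
        have \<omega>: "\<omega> = huber_slope \<epsilon> (d $ i)" using True by (simp add: \<omega>_def divdiff_def)
        consider "near i = 0" | "\<rho> \<le> near i" | "near i \<le> - \<rho>"
          using near(1)[of i] \<rho>(3) by force
        then have "g (near i) = 0"
        proof cases
          case 1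
          then show ?thesis by (simp add: g_def huber_def)
        next
          case 2
          then have "\<bar>\<epsilon>\<bar> < d $ i" using near(2)[of i] \<eta> \<eta>K by (simp add: K_def)
          then have "\<omega> = 1" using nz by (simp add: \<omega> huber_slope_def min_def max_def)
          then show ?thesis using 2 \<rho>(1) by (simp add: g_def huber_def)
        next
          case 3
          then have "d $ i < 0" using near(2)[of i] \<eta> \<eta>K \<eta>0 by (simp add: K_def)
          then have "\<omega> = 0" using nz by (simp add: \<omega> huber_slope_def divide_neg_pos)
          then show ?thesis using 3 \<rho>(1) by (simp add: g_def huber_def)
        qed
        then show ?thesis by simp
      qed
      then show ?thesis by (simp add: right_diff_distrib sum_subtractf sum_distrib_right)
    qed
    also have "\<bar>\<dots>\<bar> \<le> (\<Sum>k\<in>(UNIV :: 'n set). 4 * K\<^sup>2 / \<rho>)"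
    proof (intro order_trans[OF sum_abs] sum_mono)
      fix k
      let ?t = "\<bar>M $ i $ k * M $ j $ k * (g (e $ k) - g (near i))\<bar>"
      consider "e $ k = near i" | "e $ k \<noteq> near i" "e $ k \<noteq> near j" | "e $ k \<noteq> near i" "e $ k = near j"
        by blast
      then show "?t \<le> 4 * K\<^sup>2 / \<rho>"
      proof cases
        case 1
        then show ?thesis using \<rho>(1) by simp
      next
        case 2
        have "?t = \<bar>M $ j $ k\<bar> * (\<bar>M $ i $ k\<bar> * \<bar>g (e $ k) - g (near i)\<bar>)"
          by (simp add: abs_mult)
        also have "\<dots> \<le> K / \<rho> * (\<bar>M $ i $ k\<bar> * \<bar>e $ k - near i\<bar>)"
          using small[OF 2(2)] \<rho>(1) \<eta>K(3) by (intro mult_mono mult_left_mono g) auto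
        also have "\<dots> \<le> K / \<rho> * K" using \<rho>(1) \<eta>K(3) by (intro mult_left_mono MK) auto
        also have "\<dots> \<le> 4 * K\<^sup>2 / \<rho>" using \<rho>(1) by (simp add: power2_eq_square divide_right_mono)
        finally show ?thesis .
      next
        case 3
        let ?x = "near i" and ?y = "near j"
        have "\<bar>huber 0 ?y - huber \<epsilon> (d $ j)\<bar> \<le> K" "\<bar>huber 0 ?x - huber \<epsilon> (d $ i)\<bar> \<le> K"
          using huber_lipschitz[of 0 ?y \<epsilon> "d $ j"] huber_lipschitz[of 0 ?x \<epsilon> "d $ i"] near(2)[of i] near(2)[of j]
            \<eta>(1) \<eta>K \<eta>0 by simp_all
        moreover have "\<bar>\<omega> * ((?y - d $ j) - (?x - d $ i))\<bar> \<le> 2 * K"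
        proof -
          have "\<bar>\<omega> * ((?y - d $ j) - (?x - d $ i))\<bar> \<le> 1 * \<bar>(?y - d $ j) - (?x - d $ i)\<bar>"
            unfolding abs_mult using \<omega> by (intro mult_right_mono) auto
          also have "\<dots> \<le> 2 * K" using near(2)[of i] near(2)[of j] \<eta>K \<eta>0 by simp
          finally show ?thesis .
        qed
        moreover have "g ?y - g ?x = (huber 0 ?y - huber \<epsilon> (d $ j)) - (huber 0 ?x - huber \<epsilon> (d $ i))
            - \<omega> * ((?y - d $ j) - (?x - d $ i))"
          using divdiff_mult[of \<epsilon> "d $ i" "d $ j"] by (simp add: g_def \<omega>_def algebra_simps)
        ultimately have gK: "\<bar>g ?y - g ?x\<bar> \<le> 4 * K" by linarith
        have "?t = \<bar>M $ i $ k\<bar> * (\<bar>M $ j $ k\<bar> * \<bar>g ?y - g ?x\<bar>)"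
          by (simp add: abs_mult 3)
        also have "\<dots> \<le> K / \<rho> * (1 * (4 * K))"
          using small[OF 3(1)] gK \<rho>(1) \<eta>K(3) by (intro mult_mono Mb) auto
        also have "\<dots> = 4 * K\<^sup>2 / \<rho>" by (simp add: power2_eq_square)
        finally show ?thesis .
      qed
    qed
    finally show "\<bar>(transpose P ** mat_of (Phi (0, W) - PhiD \<epsilon> P d (0, W)) ** P) $ i $ j\<bar> \<le> ?n * (4 * K\<^sup>2 / \<rho>)"
      by simp
  qed
  then show ?thesis by (simp add: K_def)
qed

lemma Phi_quadratic_error_at_zero:
  fixes W :: "'n::{finite,linorder} symmat"
  obtains C \<delta> where "\<delta> > 0"
    "\<And>\<epsilon> X P d. \<epsilon> \<noteq> 0 \<Longrightarrow> spectral_decomp X P d \<Longrightarrow> norm ((\<epsilon>, X) - (0, W)) < \<delta> \<Longrightarrow>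
       norm (Phi (\<epsilon>, X) - Phi (0, W) - PhiD \<epsilon> P d ((\<epsilon>, X) - (0, W))) \<le> C * (norm ((\<epsilon>, X) - (0, W)))\<^sup>2"
proof -
  let ?n = "real CARD('n)"
  obtain R e where W: "spectral_decomp W R e" by (metis ex_spectral_decomp)
  obtain \<rho> where \<rho>: "\<rho> > 0" "\<And>k l. e $ k \<noteq> e $ l \<Longrightarrow> \<rho> \<le> \<bar>e $ k - e $ l\<bar>"
      "\<And>k. e $ k \<noteq> 0 \<Longrightarrow> \<rho> \<le> \<bar>e $ k\<bar>"
    by (metis ex_min_gap)
  show ?thesis
    \<comment> \<open>within this radius an eigenvalue of \<open>X\<close> next to \<open>x \<noteq> 0\<close> has the sign of \<open>x\<close> and exceeds \<open>|\<epsilon>|\<close> in absolute value\<close>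
  proof (rule that[of "\<rho> / (?n + 1)" "?n * (?n * (4 * (?n + 1)\<^sup>2 / \<rho>))"])
    show "\<rho> / (?n + 1) > 0" using \<rho>(1) by simp
    fix \<epsilon> :: real and X :: "'n symmat" and P d
    assume nz: "\<epsilon> \<noteq> 0" and X: "spectral_decomp X P d"
    define \<eta> where "\<eta> = norm ((\<epsilon>, X) - (0, W))"
    assume "norm ((\<epsilon>, X) - (0, W)) < \<rho> / (?n + 1)"
    then have "(?n + 1) * \<eta> < \<rho>" by (simp add: \<eta>_def pos_less_divide_eq mult.commute)
    moreover have "\<bar>\<epsilon>\<bar> \<le> \<eta>" "norm (X - W) \<le> \<eta>"
      using norm_fst_le[of \<epsilon> "X - W"] norm_snd_le[of "X - W" \<epsilon>] by (simp_all add: \<eta>_def)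
    ultimately have "norm (Phi (0, W) - PhiD \<epsilon> P d (0, W)) \<le> ?n * (?n * (4 * ((?n + 1) * \<eta>)\<^sup>2 / \<rho>))"
      by (intro Phi_quadratic_error_at_zero_aux[OF W X nz \<rho>])
    moreover have "PhiD \<epsilon> P d ((\<epsilon>, X) - (0, W)) = Phi (\<epsilon>, X) - PhiD \<epsilon> P d (0, W)"
      unfolding linear_diff[OF linear_PhiD] PhiD_euler[OF X nz] ..
    ultimately have "norm (Phi (\<epsilon>, X) - Phi (0, W) - PhiD \<epsilon> P d ((\<epsilon>, X) - (0, W)))
        \<le> ?n * (?n * (4 * ((?n + 1) * \<eta>)\<^sup>2 / \<rho>))"
      by (simp add: norm_minus_commute)
    also have "\<dots> = ?n * (?n * (4 * (?n + 1)\<^sup>2 / \<rho>)) * \<eta>\<^sup>2" by (simp add: power_mult_distrib)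
    finally show "norm (Phi (\<epsilon>, X) - Phi (0, W) - PhiD \<epsilon> P d ((\<epsilon>, X) - (0, W)))
        \<le> ?n * (?n * (4 * (?n + 1)\<^sup>2 / \<rho>)) * (norm ((\<epsilon>, X) - (0, W)))\<^sup>2"
      by (simp only: \<eta>_def)
  qed
qed

section \<open>Continuous differentiability from quadratic error bounds\<close>

text \<open>
  Comparing the expansions from \<open>x\<close> and from \<open>y\<close> at a third point at distance \<open>\<parallel>y - x\<parallel>\<close> from \<open>y\<close>,
  in an arbitrary direction, bounds the difference of the derivatives.
\<close>

lemma continuous_on_derivative_if_quadratic_error:
  fixes F :: "'a::real_normed_vector \<Rightarrow> 'b::real_normed_vector" and L :: "'a \<Rightarrow> 'a \<Rightarrow>\<^sub>L 'b"
  assumes "0 \<le> K" and *: "\<And>x y. x \<in> ball z (3 * r) \<Longrightarrow> y \<in> ball z (3 * r) \<Longrightarrow>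
     norm (F y - F x - L x (y - x)) \<le> K * (norm (y - x))\<^sup>2"
  shows "continuous_on (ball z r) L"
proof -
  have "dist (L x) (L y) \<le> 6 * K * dist x y" if xy: "x \<in> ball z r" "y \<in> ball z r" for x y
  proof (cases "x = y")
    case False
    define s where "s = norm (y - x)"
    have s: "s > 0" using False by (simp add: s_def)
    have r: "s < 2 * r" "0 < r"
      using xy dist_triangle[of y x z] s
      by (auto simp: s_def dist_norm norm_minus_commute intro: le_less_trans[OF norm_ge_zero])
    have bound: "norm ((L x - L y) u) \<le> 6 * K * s\<^sup>2" if u: "norm u = s" for u
    proof -
      have in_ball: "x \<in> ball z (3 * r)" "y \<in> ball z (3 * r)" "y + u \<in> ball z (3 * r)"
        using xy u r norm_triangle_ineq4[of "z - y" u] by (auto simp: dist_norm algebra_simps)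
      let ?A = "F (y + u) - F x - L x (y + u - x)"
        and ?B = "F (y + u) - F y - L y (y + u - y)" and ?E = "F y - F x - L x (y - x)"
      have "norm (y + u - x) \<le> 2 * s"
        using norm_triangle_ineq[of "y - x" u] u by (simp add: s_def algebra_simps)
      then have "(norm (y + u - x))\<^sup>2 \<le> (2 * s)\<^sup>2" by (intro power_mono) auto
      then have "norm ?A \<le> K * (4 * s\<^sup>2)"
        using *[OF in_ball(1,3)] mult_left_mono[OF _ \<open>0 \<le> K\<close>] by (force simp: power_mult_distrib)
      moreover have "norm ?B \<le> K * s\<^sup>2" using *[OF in_ball(2,3)] u by simp
      moreover have "norm ?E \<le> K * s\<^sup>2" using *[OF in_ball(1,2)] by (simp add: s_def)
      moreover have "(L x - L y) u = ?B + ?E - ?A"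
        by (simp add: blinfun.bilinear_simps algebra_simps)
      then have "norm ((L x - L y) u) \<le> norm ?B + norm ?E + norm ?A"
        using norm_triangle_ineq4[of "?B + ?E" ?A] norm_triangle_ineq[of ?B ?E] by simp
      ultimately show ?thesis by simp
    qed
    have "norm (L x - L y) \<le> 6 * K * s"
    proof (rule norm_blinfun_bound)
      show "norm ((L x - L y) v) \<le> 6 * K * s * norm v" for v
      proof (cases "v = 0")
        case False
        have "norm ((L x - L y) ((s / norm v) *\<^sub>R v)) \<le> 6 * K * s\<^sup>2"
          using False s by (intro bound) simp
        then have "s / norm v * norm ((L x - L y) v) \<le> 6 * K * s\<^sup>2"
          using s by (simp add: blinfun.scaleR_right)
        then show ?thesis
          using False s by (simp add: power2_eq_square field_simps)
      qed (simp add: blinfun.bilinear_simps)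
    qed (use \<open>0 \<le> K\<close> s in simp)
    then show ?thesis by (simp add: dist_norm s_def norm_minus_commute)
  qed simp
  then have "(6 * K)-lipschitz_on (ball z r) L" using \<open>0 \<le> K\<close> by (intro lipschitz_onI) auto
  then show ?thesis by (rule lipschitz_on_continuous_on)
qed

lemma frechet_derivative_Phi:
  fixes W :: "'n::{finite,linorder} symmat"
  assumes "spectral_decomp W P d" "\<epsilon> \<noteq> 0"
  shows "frechet_derivative Phi (at (\<epsilon>, W)) = PhiD \<epsilon> P d"
  using frechet_derivative_at[OF has_derivative_Phi[OF assms]] by simp

lemma Phi_quadratic_error_ball:
  fixes x y :: "real \<times> 'n::{finite,linorder} symmat"
  assumes "x \<in> ball (\<epsilon>, W) (\<bar>\<epsilon>\<bar> / 4)" "y \<in> ball (\<epsilon>, W) (\<bar>\<epsilon>\<bar> / 4)" "\<epsilon> \<noteq> 0"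
  shows "(Phi has_derivative frechet_derivative Phi (at x)) (at x)"
    "norm (Phi y - Phi x - frechet_derivative Phi (at x) (y - x))
      \<le> 2 * (real CARD('n) * (real CARD('n) + 2)) / \<bar>\<epsilon>\<bar> * (norm (y - x))\<^sup>2"
proof -
  obtain a X b Y where xy: "x = (a, X)" "y = (b, Y)" by (metis surj_pair)
  obtain P d R e where X: "spectral_decomp X P d" and Y: "spectral_decomp Y R e"
    by (metis ex_spectral_decomp)
  have "\<bar>\<epsilon> - a\<bar> < \<bar>\<epsilon>\<bar> / 4" "\<bar>\<epsilon> - b\<bar> < \<bar>\<epsilon>\<bar> / 4"
    using assms(1,2) norm_fst_le[of "\<epsilon> - a" "W - X"] norm_fst_le[of "\<epsilon> - b" "W - Y"]
    by (auto simp: xy dist_norm)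
  then have a: "\<bar>\<epsilon>\<bar> / 2 \<le> \<bar>a\<bar>" "\<bar>b - a\<bar> < \<bar>a\<bar>" "a \<noteq> 0" by linarith+
  show "(Phi has_derivative frechet_derivative Phi (at x)) (at x)"
    unfolding xy frechet_derivative_Phi[OF X a(3)] by (rule has_derivative_Phi[OF X a(3)])
  let ?C = "real CARD('n) * (real CARD('n) + 2)"
  have "norm (Phi y - Phi x - frechet_derivative Phi (at x) (y - x)) \<le> ?C / \<bar>a\<bar> * (norm (y - x))\<^sup>2"
    using Phi_quadratic_error[OF X Y a(2)] by (simp add: xy frechet_derivative_Phi[OF X a(3)])
  also have "\<dots> \<le> ?C / (\<bar>\<epsilon>\<bar> / 2) * (norm (y - x))\<^sup>2"
    using a(1) \<open>\<epsilon> \<noteq> 0\<close> by (intro mult_right_mono divide_left_mono) auto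
  finally show "norm (Phi y - Phi x - frechet_derivative Phi (at x) (y - x))
      \<le> 2 * ?C / \<bar>\<epsilon>\<bar> * (norm (y - x))\<^sup>2" by (simp add: mult.commute)
qed

lemma continuously_differentiable_Phi:
  fixes W :: "'n::{finite,linorder} symmat"
  assumes "\<epsilon> \<noteq> 0"
  shows "continuously_differentiable_at Phi (\<epsilon>, W)"
  unfolding continuously_differentiable_at_def
proof (intro exI conjI ballI)
  let ?L = "\<lambda>x. Blinfun (frechet_derivative Phi (at x))"
  have sub: "ball (\<epsilon>, W) (\<bar>\<epsilon>\<bar> / 12) \<subseteq> ball (\<epsilon>, W) (\<bar>\<epsilon>\<bar> / 4)" by (intro subset_ball) simp
  have L: "blinfun_apply (?L x) = frechet_derivative Phi (at x)" if "x \<in> ball (\<epsilon>, W) (\<bar>\<epsilon>\<bar> / 4)" for x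
    using Phi_quadratic_error_ball(1)[OF that that assms]
    by (intro bounded_linear_Blinfun_apply has_derivative_bounded_linear)
  show "(Phi has_derivative blinfun_apply (?L x)) (at x)" if "x \<in> ball (\<epsilon>, W) (\<bar>\<epsilon>\<bar> / 12)" for x
    using that sub Phi_quadratic_error_ball(1)[OF _ _ assms, of x W x] by (subst L) auto
  show "continuous_on (ball (\<epsilon>, W) (\<bar>\<epsilon>\<bar> / 12)) ?L"
  proof (rule continuous_on_derivative_if_quadratic_error[where F = Phi])
    show "norm (Phi y - Phi x - ?L x (y - x))
        \<le> 2 * (real CARD('n) * (real CARD('n) + 2)) / \<bar>\<epsilon>\<bar> * (norm (y - x))\<^sup>2"
      if "x \<in> ball (\<epsilon>, W) (3 * (\<bar>\<epsilon>\<bar> / 12))" "y \<in> ball (\<epsilon>, W) (3 * (\<bar>\<epsilon>\<bar> / 12))" for x y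
    proof -
      have "x \<in> ball (\<epsilon>, W) (\<bar>\<epsilon>\<bar> / 4)" "y \<in> ball (\<epsilon>, W) (\<bar>\<epsilon>\<bar> / 4)" using that by auto
      then show ?thesis unfolding L[OF \<open>x \<in> ball (\<epsilon>, W) (\<bar>\<epsilon>\<bar> / 4)\<close>] by (rule Phi_quadratic_error_ball(2)[OF _ _ assms])
    qed
  qed simp
qed (use assms in auto)

lemma locally_lipschitz_Phi: "locally_lipschitz (Phi :: real \<times> 'n::{finite,linorder} symmat \<Rightarrow> 'n symmat)"
  unfolding locally_lipschitz_def
proof (intro allI exI conjI)
  show "(2 * real CARD('n))-lipschitz_on UNIV (Phi :: real \<times> 'n symmat \<Rightarrow> 'n symmat)"
    using Phi_lipschitz by (intro lipschitz_onI) (auto simp: dist_norm)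
qed auto

section \<open>Semismoothness from quadratic error bounds at points of differentiability\<close>

text \<open>The bound survives limits and convex combinations of derivatives.\<close>

lemma clarke_jacobian_error_bound:
  fixes F :: "'a::real_normed_vector \<Rightarrow> 'b::real_normed_vector"
  assumes cont: "continuous_on UNIV F"
    and *: "\<And>z D. norm (z - y) < \<delta> \<Longrightarrow> (F has_derivative D) (at z) \<Longrightarrow>
       norm (F z - F y - D (z - y)) \<le> C * (norm (z - y))\<^sup>2"
    and z: "norm (z - y) < \<delta>" and V: "V \<in> clarke_jacobian F z"
  shows "norm (F z - F y - V (z - y)) \<le> C * (norm (z - y))\<^sup>2"
proof -
  let ?S = "{V :: 'a \<Rightarrow>\<^sub>L 'b. norm (F z - F y - V (z - y)) \<le> C * (norm (z - y))\<^sup>2}"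
  have "B_subdiff F z \<subseteq> ?S"
  proof
    fix V assume "V \<in> B_subdiff F z"
    then obtain u :: "nat \<Rightarrow> 'a" and F' where u: "u \<longlonglongrightarrow> z"
      and F': "\<And>k. (F has_derivative blinfun_apply (F' k)) (at (u k))" "F' \<longlonglongrightarrow> V"
      by (auto simp: B_subdiff_def)
    have "(\<lambda>k. F (u k)) \<longlonglongrightarrow> F z"
      using cont u by (intro isCont_tendsto_compose[of z F u]) (auto simp: continuous_on_eq_continuous_at)
    then have lim: "(\<lambda>k. norm (F (u k) - F y - F' k (u k - y))) \<longlonglongrightarrow> norm (F z - F y - V (z - y))"
      by (intro tendsto_intros blinfun.tendsto F' u)
    have "(\<lambda>k. norm (u k - y)) \<longlonglongrightarrow> norm (z - y)" by (intro tendsto_intros u)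
    then have "\<forall>\<^sub>F k in sequentially. norm (u k - y) < \<delta>" using z by (rule order_tendstoD)
    then have "\<forall>\<^sub>F k in sequentially. norm (F (u k) - F y - F' k (u k - y)) \<le> C * (norm (u k - y))\<^sup>2"
      by eventually_elim (rule *[OF _ F'(1)])
    then have "norm (F z - F y - V (z - y)) \<le> C * (norm (z - y))\<^sup>2"
      by (intro tendsto_le[OF _ tendsto_mult[OF tendsto_const tendsto_power[OF tendsto_norm[OF
            tendsto_diff[OF u tendsto_const]]]] lim]) auto
    then show "V \<in> ?S" by simp
  qed
  moreover have "convex ?S"
  proof (rule convexI)
    fix V V' :: "'a \<Rightarrow>\<^sub>L 'b" and s t :: real
    assume VV': "V \<in> ?S" "V' \<in> ?S" and st: "0 \<le> s" "0 \<le> t" "s + t = 1"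
    have "a - (s *\<^sub>R V + t *\<^sub>R V') w = s *\<^sub>R (a - V w) + t *\<^sub>R (a - V' w)" for a w
    proof -
      have "s *\<^sub>R a + t *\<^sub>R a = a" by (simp add: st flip: scaleR_add_left)
      then show ?thesis by (simp add: blinfun.add_left blinfun.scaleR_left scaleR_diff_right flip: add_diff_add)
    qed
    then have "norm (F z - F y - (s *\<^sub>R V + t *\<^sub>R V') (z - y))
        = norm (s *\<^sub>R (F z - F y - V (z - y)) + t *\<^sub>R (F z - F y - V' (z - y)))"
      by (rule arg_cong)
    also have "\<dots> \<le> s * norm (F z - F y - V (z - y)) + t * norm (F z - F y - V' (z - y))"
      using st by (intro order_trans[OF norm_triangle_ineq]) simp
    also have "\<dots> \<le> s * (C * (norm (z - y))\<^sup>2) + t * (C * (norm (z - y))\<^sup>2)"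
      using VV' st by (intro add_mono mult_left_mono) auto
    also have "\<dots> = C * (norm (z - y))\<^sup>2" by (simp add: st flip: distrib_right)
    finally show "s *\<^sub>R V + t *\<^sub>R V' \<in> ?S" by simp
  qed
  ultimately have "clarke_jacobian F z \<subseteq> ?S" unfolding clarke_jacobian_def by (rule hull_minimal)
  then show ?thesis using V by auto
qed

lemma strongly_semismooth_at_if_quadratic_error:
  fixes F :: "'a::real_normed_vector \<Rightarrow> 'b::real_normed_vector"
  assumes "locally_lipschitz F" "directionally_differentiable_at F y"
    and cont: "continuous_on UNIV F" and "\<delta> > 0"
    and *: "\<And>z D. norm (z - y) < \<delta> \<Longrightarrow> (F has_derivative D) (at z) \<Longrightarrow>
       norm (F z - F y - D (z - y)) \<le> C * (norm (z - y))\<^sup>2"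
  shows "strongly_semismooth_at F y"
proof -
  have bound: "norm (F (y + h) - F y - V h) \<le> C * (norm h)\<^sup>2"
    if "norm h < \<delta>" "V \<in> clarke_jacobian F (y + h)" for h V
  proof -
    have "norm (F (y + h) - F y - V (y + h - y)) \<le> C * (norm (y + h - y))\<^sup>2"
    proof (rule clarke_jacobian_error_bound[OF cont, where \<delta> = \<delta>])
      show "norm (F z - F y - D (z - y)) \<le> C * (norm (z - y))\<^sup>2"
        if "norm (z - y) < \<delta>" "(F has_derivative D) (at z)" for z D
        using that by (rule *)
    qed (use that in simp_all)
    then show ?thesis by simp
  qed
  have "\<forall>\<^sub>F h in nhds 0. \<forall>V\<in>clarke_jacobian F (y + h). norm (F (y + h) - F y - V h) \<le> C * (norm h)\<^sup>2"
    unfolding eventually_nhds_metric using bound \<open>\<delta> > 0\<close> by (intro exI[of _ \<delta>]) (auto simp: dist_norm)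
  moreover have "\<forall>\<^sub>F h in nhds 0. \<forall>V\<in>clarke_jacobian F (y + h). norm (F (y + h) - F y - V h) \<le> c * norm h"
    if "c > 0" for c
    unfolding eventually_nhds_metric
  proof (intro exI conjI allI impI ballI)
    show "min \<delta> (c / (\<bar>C\<bar> + 1)) > 0" using \<open>\<delta> > 0\<close> \<open>c > 0\<close> by simp
    fix h :: 'a and V assume h: "dist h 0 < min \<delta> (c / (\<bar>C\<bar> + 1))" and V: "V \<in> clarke_jacobian F (y + h)"
    have "norm h * (\<bar>C\<bar> + 1) < c" using h by (simp add: dist_norm pos_less_divide_eq)
    moreover have "norm h * C \<le> norm h * (\<bar>C\<bar> + 1)" by (intro mult_left_mono) auto
    then have "C * norm h \<le> norm h * (\<bar>C\<bar> + 1)" by (simp only: mult.commute)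
    ultimately have "C * norm h * norm h \<le> c * norm h" by (intro mult_right_mono) auto
    then show "norm (F (y + h) - F y - V h) \<le> c * norm h"
      using bound[of h V] h V by (simp add: dist_norm power2_eq_square mult.assoc)
  qed
  ultimately show ?thesis
    unfolding strongly_semismooth_at_def semismooth_at_def using assms(1,2) by blast
qed

lemma has_vector_derivative_ray:
  assumes "(F has_derivative D) (at (y + s *\<^sub>R v))"
  shows "((\<lambda>s. F (y + s *\<^sub>R v)) has_vector_derivative D v) (at s)"
proof -
  have "((\<lambda>s. y + s *\<^sub>R v) has_vector_derivative v) (at s)"
    by (auto intro!: derivative_eq_intros)
  moreover have "(F has_derivative D) (at (y + s *\<^sub>R v) within range (\<lambda>s. y + s *\<^sub>R v))"
    using assms by (rule has_derivative_at_withinI)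
  ultimately show ?thesis
    using vector_derivative_diff_chain_within[of "\<lambda>s. y + s *\<^sub>R v" v s UNIV F D] by (simp add: o_def)
qed

lemma has_vector_derivative_right_quotient:
  assumes "(f has_vector_derivative f') (at x)"
  shows "((\<lambda>t. (f (x + t) - f x) /\<^sub>R t) \<longlongrightarrow> f') (at_right 0)"
proof -
  have "((\<lambda>t. norm (f (x + t) - f x - t *\<^sub>R f') / norm t) \<longlongrightarrow> 0) (at 0)"
    using assms by (simp add: has_vector_derivative_def has_derivative_at)
  moreover have "norm ((f (x + t) - f x) /\<^sub>R t - f') = norm (f (x + t) - f x - t *\<^sub>R f') / norm t" if "t \<noteq> 0" for t
  proof -
    have "(f (x + t) - f x) /\<^sub>R t - f' = (f (x + t) - f x - t *\<^sub>R f') /\<^sub>R t"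
      using that by (simp add: scaleR_diff_right)
    then show ?thesis by (simp add: divide_inverse mult.commute)
  qed
  ultimately have "((\<lambda>t. norm ((f (x + t) - f x) /\<^sub>R t - f')) \<longlongrightarrow> 0) (at 0)"
    by (subst tendsto_cong[of _ "\<lambda>t. norm (f (x + t) - f x - t *\<^sub>R f') / norm t"])
       (auto simp: eventually_at_filter)
  then have "((\<lambda>t. (f (x + t) - f x) /\<^sub>R t) \<longlongrightarrow> f') (at 0)"
    by (simp add: tendsto_norm_zero_iff LIM_zero_iff)
  then show ?thesis by (rule tendsto_mono[rotated]) (simp add: at_le)
qed

text \<open>The quotient \<open>(F (y + s v) - F y) / s\<close> has the derivative \<open>- (F x - F y - F'(x) (x - y)) / s\<^sup>2\<close> with
  \<open>x = y + s v\<close>, so the error bound controls its oscillation.\<close>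

lemma ray_quotient_bound:
  fixes F :: "'a::real_normed_vector \<Rightarrow> 'b::real_normed_vector"
  assumes "1 < b" and *: "\<And>s. 1 \<le> s \<Longrightarrow> s \<le> b \<Longrightarrow> \<exists>D. (F has_derivative D) (at (y + s *\<^sub>R v)) \<and>
     norm (F (y + s *\<^sub>R v) - F y - D (s *\<^sub>R v)) \<le> K * s\<^sup>2"
  shows "norm ((1 / b) *\<^sub>R (F (y + b *\<^sub>R v) - F y) - (F (y + v) - F y)) \<le> K * (b - 1)"
proof -
  obtain D where D: "\<And>s. 1 \<le> s \<Longrightarrow> s \<le> b \<Longrightarrow> (F has_derivative D s) (at (y + s *\<^sub>R v))"
    and err: "\<And>s. 1 \<le> s \<Longrightarrow> s \<le> b \<Longrightarrow> norm (F (y + s *\<^sub>R v) - F y - D s (s *\<^sub>R v)) \<le> K * s\<^sup>2"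
    using * by metis
  let ?\<psi> = "\<lambda>s. (1 / s) *\<^sub>R (F (y + s *\<^sub>R v) - F y)"
  let ?\<psi>' = "\<lambda>s. (- (1 / s\<^sup>2)) *\<^sub>R (F (y + s *\<^sub>R v) - F y - D s (s *\<^sub>R v))"
  have \<psi>: "(?\<psi> has_vector_derivative ?\<psi>' s) (at s)" if s: "1 \<le> s" "s \<le> b" for s
  proof -
    have "((\<lambda>s. 1 / s) has_real_derivative - (1 / s\<^sup>2)) (at s)"
      using s by (auto intro!: derivative_eq_intros simp: power2_eq_square)
    moreover have "((\<lambda>s. F (y + s *\<^sub>R v) - F y) has_vector_derivative D s v - 0) (at s)"
      by (intro has_vector_derivative_diff has_vector_derivative_ray D s has_vector_derivative_const)
    ultimately have "(?\<psi> has_vector_derivative (1 / s) *\<^sub>R (D s v - 0) + (- (1 / s\<^sup>2)) *\<^sub>R (F (y + s *\<^sub>R v) - F y)) (at s)"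
      by (rule has_vector_derivative_scaleR)
    moreover have "(1 / s) *\<^sub>R (D s v - 0) + (- (1 / s\<^sup>2)) *\<^sub>R (F (y + s *\<^sub>R v) - F y) = ?\<psi>' s"
      using s linear_scale[OF has_derivative_linear[OF D[OF s]], of s v]
      by (simp add: scaleR_diff_right power2_eq_square)
    ultimately show ?thesis by simp
  qed
  have "norm (?\<psi> b - ?\<psi> 1) \<le> K * b - K * 1"
  proof (rule differentiable_bound_general[where f' = ?\<psi>' and \<phi>' = "\<lambda>s. K", OF \<open>1 < b\<close>])
    show "continuous_on {1..b} ?\<psi>"
      by (intro continuous_at_imp_continuous_on ballI has_vector_derivative_continuous[OF \<psi>]) auto
    show "norm (?\<psi>' s) \<le> K" if "1 < s" "s < b" for s
      using err[of s] that by (simp add: divide_le_eq mult.commute)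
    show "((\<lambda>s. K * s) has_vector_derivative K) (at s)" for s
      by (auto intro!: derivative_eq_intros)
    show "(?\<psi> has_vector_derivative ?\<psi>' s) (at s)" if "1 < s" "s < b" for s
      using that by (intro \<psi>) auto
  qed (intro continuous_intros)
  then show ?thesis by (simp add: right_diff_distrib)
qed

text \<open>
  A function may happen to be differentiable at a point of the hyperplane \<open>\<epsilon> = 0\<close>, and the
  derivative there need not be a limit of derivatives off the hyperplane. The bound on the
  oscillation of the quotient along rays, however, passes to the limit.
\<close>

lemma quadratic_error_on_hyperplane:
  fixes F :: "real \<times> 'a::real_normed_vector \<Rightarrow> 'b::real_normed_vector"
  assumes cont: "continuous_on UNIV F" and "fst y = 0"
    and *: "\<And>x. fst x \<noteq> 0 \<Longrightarrow> norm (x - y) < \<delta> \<Longrightarrow> \<exists>D. (F has_derivative D) (at x) \<and>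
      norm (F x - F y - D (x - y)) \<le> C * (norm (x - y))\<^sup>2"
    and z: "norm (z - y) < \<delta>" and D: "(F has_derivative D) (at z)"
  shows "norm (F z - F y - D (z - y)) \<le> C * (norm (z - y))\<^sup>2"
proof (cases "fst z = 0")
  case False
  then show ?thesis using *[OF False z] has_derivative_unique[OF D] by auto
next
  case True
  define v where "v = z - y"
  have v: "norm v < \<delta>" "fst v = 0" "z = y + v" using z True \<open>fst y = 0\<close> by (auto simp: v_def)
  define \<psi> where "\<psi> s = (1 / s) *\<^sub>R (F (y + s *\<^sub>R v) - F y)" for s
  \<comment> \<open>the ray stays in the ball up to the parameter \<open>1 + t0\<close>\<close>
  define t0 where "t0 = (\<delta> - norm v) / (norm v + 1)"
  have t0: "t0 > 0" using v(1) by (simp add: t0_def add_nonneg_pos)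
  have quot: "norm (\<psi> (1 + t) - \<psi> 1) \<le> C * (norm v)\<^sup>2 * t" if t: "0 < t" "t < t0" for t
  proof -
    define b where "b = 1 + t"
    have b: "1 < b" using t by (simp add: b_def)
    have "t * (norm v + 1) < \<delta> - norm v" using t by (simp add: t0_def pos_less_divide_eq add_nonneg_pos)
    then have bv: "b * norm v < \<delta>" using t by (simp add: b_def algebra_simps)
    \<comment> \<open>tilt the ray off the hyperplane by \<open>\<sigma>\<close>, then let \<open>\<sigma>\<close> tend to zero\<close>
    let ?w = "\<lambda>\<sigma>. v + (\<sigma>, 0)"
    let ?f = "\<lambda>\<sigma>. C * (norm (?w \<sigma>))\<^sup>2 * (b - 1)
      - norm ((1 / b) *\<^sub>R (F (y + b *\<^sub>R ?w \<sigma>) - F y) - (F (y + ?w \<sigma>) - F y))"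
    have "continuous_on UNIV ?f" "continuous_on UNIV (\<lambda>\<sigma>. b * norm (?w \<sigma>))"
      by (intro continuous_intros continuous_on_compose2[OF cont]; auto)+
    then have lim: "(?f \<longlongrightarrow> ?f 0) (at 0)" and "((\<lambda>\<sigma>. b * norm (?w \<sigma>)) \<longlongrightarrow> b * norm (?w 0)) (at 0)"
      by (auto simp: continuous_on_def)
    then have "\<forall>\<^sub>F \<sigma> in at 0. b * norm (?w \<sigma>) < \<delta>" using bv by (intro order_tendstoD) (auto simp: zero_prod_def[symmetric])
    moreover have "\<forall>\<^sub>F \<sigma> :: real in at 0. \<sigma> \<noteq> 0" by (auto simp: eventually_at_filter)
    ultimately have "\<forall>\<^sub>F \<sigma> in at 0. 0 \<le> ?f \<sigma>"
    proof eventually_elim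
      case (elim \<sigma>)
      have "norm ((1 / b) *\<^sub>R (F (y + b *\<^sub>R ?w \<sigma>) - F y) - (F (y + ?w \<sigma>) - F y)) \<le> C * (norm (?w \<sigma>))\<^sup>2 * (b - 1)"
      proof (rule ray_quotient_bound[OF b])
        fix s :: real assume s: "1 \<le> s" "s \<le> b"
        let ?x = "y + s *\<^sub>R ?w \<sigma>"
        have "fst ?x \<noteq> 0" using s v \<open>fst y = 0\<close> elim(2) by simp
        moreover have "s * norm (?w \<sigma>) \<le> b * norm (?w \<sigma>)" using s by (intro mult_right_mono) auto
        then have "norm (?x - y) < \<delta>" using s elim(1) by simp
        ultimately show "\<exists>D. (F has_derivative D) (at ?x) \<and>
            norm (F ?x - F y - D (s *\<^sub>R ?w \<sigma>)) \<le> C * (norm (?w \<sigma>))\<^sup>2 * s\<^sup>2"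
          using *[of ?x] s by (simp add: power_mult_distrib mult_ac)
      qed
      then show ?case by simp
    qed
    then have "0 \<le> ?f 0" by (intro tendsto_lowerbound[OF lim]) auto
    then show ?thesis by (simp add: \<psi>_def b_def zero_prod_def[symmetric])
  qed
  have eq: "(1 / 1) *\<^sub>R (D v - 0) + (- 1) *\<^sub>R (F (y + 1 *\<^sub>R v) - F y) = D v - (F z - F y)"
    by (simp add: v(3))
  have "(\<psi> has_vector_derivative (1 / 1) *\<^sub>R (D v - 0) + (- 1) *\<^sub>R (F (y + 1 *\<^sub>R v) - F y)) (at 1)"
    unfolding \<psi>_def
  proof (rule has_vector_derivative_scaleR)
    show "((\<lambda>s. 1 / s) has_real_derivative - 1) (at 1)"
      by (auto intro!: derivative_eq_intros)
    show "((\<lambda>s. F (y + s *\<^sub>R v) - F y) has_vector_derivative D v - 0) (at 1)"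
      using D v(3) by (intro has_vector_derivative_diff has_vector_derivative_ray has_vector_derivative_const) auto
  qed
  then have "(\<psi> has_vector_derivative D v - (F z - F y)) (at 1)" unfolding eq .
  from tendsto_norm[OF has_vector_derivative_right_quotient[OF this]]
  have lim: "((\<lambda>t. norm ((\<psi> (1 + t) - \<psi> 1) /\<^sub>R t)) \<longlongrightarrow> norm (D v - (F z - F y))) (at_right 0)" .
  have "\<forall>\<^sub>F t in at_right 0. norm ((\<psi> (1 + t) - \<psi> 1) /\<^sub>R t) \<le> C * (norm v)\<^sup>2"
    unfolding eventually_at_right_field
  proof (intro exI[of _ t0] conjI allI impI)
    fix t :: real assume t: "0 < t" "t < t0"
    have "norm ((\<psi> (1 + t) - \<psi> 1) /\<^sub>R t) = norm (\<psi> (1 + t) - \<psi> 1) / t"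
      using t by (simp add: divide_inverse mult.commute)
    also have "\<dots> \<le> C * (norm v)\<^sup>2" using quot[OF t] t by (simp add: divide_le_eq)
    finally show "norm ((\<psi> (1 + t) - \<psi> 1) /\<^sub>R t) \<le> C * (norm v)\<^sup>2" .
  qed (use t0 in simp)
  then have "norm (D v - (F z - F y)) \<le> C * (norm v)\<^sup>2"
    by (intro tendsto_upperbound[OF lim]) auto
  then show ?thesis by (simp add: v_def norm_minus_commute)
qed

section \<open>Expansions along rays\<close>

lemma perturbed_frame:
  fixes W H :: "'n::{finite,linorder} symmat"
  assumes W: "spectral_decomp W R d" "antimono (($) d)"
    and X: "spectral_decomp (W + t *\<^sub>R H) P e" "antimono (($) e)" and "0 \<le> t"
  defines "N \<equiv> transpose R ** P" and "G \<equiv> transpose R ** mat_of H ** R"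
  shows perturbed_eigenvalue: "\<bar>e $ k - d $ k\<bar> \<le> real CARD('n) * norm H * t"
    and perturbed_frame_row: "N $ i $ k * (e $ k - (d $ i + t * G $ i $ i)) = t * (\<Sum>l\<in>UNIV - {i}. G $ i $ l * N $ l $ k)"
    and perturbed_frame_off_block: "\<rho> > 0 \<Longrightarrow> \<rho> \<le> \<bar>d $ l - d $ k\<bar> \<Longrightarrow>
      \<bar>N $ l $ k\<bar> \<le> (real CARD('n) + 1) * norm H / \<rho> * t"
proof -
  have R: "orthogonal_matrix R" using W by (auto dest: spectral_decompD)
  have diff: "mat_of (W + t *\<^sub>R H) - mat_of W = t *\<^sub>R mat_of H" by (simp add: mat_of_linear)
  have normH: "norm (W + t *\<^sub>R H - W) = t * norm H" using \<open>0 \<le> t\<close> by simp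
  show ev: "\<bar>e $ k - d $ k\<bar> \<le> real CARD('n) * norm H * t" for k
    using eigenvalue_perturbation[OF W X, of k] unfolding normH by (simp add: mult_ac)
  have "G ** N = transpose R ** mat_of H ** P"
    by (simp add: G_def N_def matrix_mul_assoc orthogonal_cancel[OF R])
  then have "t * (\<Sum>l\<in>UNIV. G $ i $ l * N $ l $ k) = N $ i $ k * (e $ k - d $ i)"
    using mixed_frame_diff[OF W(1) X(1), of i k] unfolding diff matrix_linear_distribs
    by (simp add: N_def matrix_mult_entry[of G, symmetric])
  moreover have "(\<Sum>l\<in>UNIV. G $ i $ l * N $ l $ k) = G $ i $ i * N $ i $ k + (\<Sum>l\<in>UNIV - {i}. G $ i $ l * N $ l $ k)"
    by (rule sum.remove) auto
  ultimately show "N $ i $ k * (e $ k - (d $ i + t * G $ i $ i)) = t * (\<Sum>l\<in>UNIV - {i}. G $ i $ l * N $ l $ k)"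
    by (simp add: algebra_simps)
  show "\<bar>N $ l $ k\<bar> \<le> (real CARD('n) + 1) * norm H / \<rho> * t" if "\<rho> > 0" "\<rho> \<le> \<bar>d $ l - d $ k\<bar>" 
  proof -
    have "\<bar>N $ l $ k\<bar> * \<rho> \<le> \<bar>N $ l $ k\<bar> * (\<bar>e $ k - d $ l\<bar> + \<bar>e $ k - d $ k\<bar>)"
      using that(2) by (intro mult_left_mono) auto
    also have "\<dots> \<le> norm (W + t *\<^sub>R H - W) + 1 * (real CARD('n) * norm H * t)"
      unfolding distrib_left N_def
      by (intro add_mono mult_mono mixed_frame_bound[OF W(1) X(1)] ev
          orthogonal_entry_le_1[OF orthogonal_frames[OF W(1) X(1)]]) auto
    also have "\<dots> = (real CARD('n) + 1) * norm H * t" unfolding normH by (simp add: algebra_simps)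
    finally show ?thesis using that(1) by (simp add: pos_le_divide_eq)
  qed
qed

lemma conjugated_entry_le_norm:
  "orthogonal_matrix R \<Longrightarrow> \<bar>(transpose R ** mat_of H ** R) $ i $ j\<bar> \<le> norm H"
  using abs_entry_le_norm[of "transpose R ** mat_of H ** R" i j] by (simp add: norm_change_frames)

text \<open>
  A row \<open>a\<close> and a column \<open>b\<close> with a large entry of \<open>R\<^sup>T P\<close> belong to the same block, and then \<open>e\<^sub>b\<close> agrees with
  \<open>d\<^sub>a + t G\<^sub>a\<^sub>a\<close> to second order. Choosing such entries on both sides of the diagonal encloses the sorted
  eigenvalue \<open>e\<^sub>i\<close>.
\<close>

lemma eigenvalue_ray_expansion:
  fixes W H :: "'n::{finite,linorder} symmat"
  assumes W: "spectral_decomp W R d" "antimono (($) d)"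
  defines "G \<equiv> transpose R ** mat_of H ** R"
  assumes offdiag: "\<And>i j. i \<noteq> j \<Longrightarrow> d $ i = d $ j \<Longrightarrow> G $ i $ j = 0"
    and sorted: "\<And>i j. i \<le> j \<Longrightarrow> d $ i = d $ j \<Longrightarrow> G $ j $ j \<le> G $ i $ i"
  obtains C t1 where "t1 > 0" "\<And>t P e. 0 < t \<Longrightarrow> t < t1 \<Longrightarrow> spectral_decomp (W + t *\<^sub>R H) P e \<Longrightarrow>
    antimono (($) e) \<Longrightarrow> \<bar>e $ i - d $ i - t * G $ i $ i\<bar> \<le> C * t\<^sup>2"
proof -
  let ?n = "real CARD('n)"
  obtain \<rho> where \<rho>: "\<rho> > 0" "\<And>k l. d $ k \<noteq> d $ l \<Longrightarrow> \<rho> \<le> \<bar>d $ k - d $ l\<bar>"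
    by (metis ex_min_gap)
  define B where "B = (?n + 1) * norm H / \<rho>"
  have B: "0 \<le> B" using \<rho>(1) by (simp add: B_def)
  show ?thesis
    \<comment> \<open>for such \<open>t\<close>, entries outside the blocks are too small to be pivots\<close>
  proof (rule that[of "1 / (?n * (B + 1))" "?n * (?n * (norm H * B))"])
    show "0 < 1 / (?n * (B + 1))" using B by simp
    fix t P e assume t: "0 < t" "t < 1 / (?n * (B + 1))"
      and X: "spectral_decomp (W + t *\<^sub>R H) P e" "antimono (($) e)"
    define N where "N = transpose R ** P"
    have N: "orthogonal_matrix N" unfolding N_def by (rule orthogonal_frames[OF W(1) X(1)])
    have "?n * (B + 1) * t < 1" using t B by (simp add: pos_less_divide_eq mult.commute)
    then have "(B + 1) * t < 1 / ?n" by (simp add: pos_less_divide_eq mult_ac)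
    then have Bt: "B * t < 1 / ?n" using t by (simp add: algebra_simps)
    have off: "\<bar>N $ l $ k\<bar> \<le> B * t" if "d $ l \<noteq> d $ k" for l k
      using perturbed_frame_off_block[OF W X less_imp_le[OF t(1)] \<rho>(1) \<rho>(2)[OF that]]
      by (simp add: N_def B_def)
    have key: "d $ a = d $ b \<and> \<bar>e $ b - (d $ a + t * G $ a $ a)\<bar> \<le> ?n * (?n * (norm H * B)) * t\<^sup>2"
      if ab: "1 / ?n \<le> \<bar>N $ a $ b\<bar>" for a b
    proof
      show dab: "d $ a = d $ b" using off[of a b] ab Bt by fastforce
      have "\<bar>G $ a $ l * N $ l $ b\<bar> \<le> norm H * (B * t)" if "l \<in> UNIV - {a}" for l
      proof (cases "d $ l = d $ a")
        case True
        then have "G $ a $ l = 0" using that by (intro offdiag) auto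
        then show ?thesis using B t by simp
      next
        case False
        have "\<bar>G $ a $ l\<bar> \<le> norm H"
          unfolding G_def using W by (intro conjugated_entry_le_norm) (auto dest: spectral_decompD)
        then show ?thesis
          using off[of l b] False dab unfolding abs_mult by (intro mult_mono) auto
      qed
      then have "\<bar>\<Sum>l\<in>UNIV - {a}. G $ a $ l * N $ l $ b\<bar> \<le> (\<Sum>l\<in>UNIV - {a}. norm H * (B * t))"
        by (intro order_trans[OF sum_abs] sum_mono)
      also have "\<dots> \<le> (\<Sum>l\<in>(UNIV :: 'n set). norm H * (B * t))"
        using B t by (intro sum_mono2) auto
      also have "\<dots> = ?n * (norm H * B) * t" by simp
      finally have "t * \<bar>\<Sum>l\<in>UNIV - {a}. G $ a $ l * N $ l $ b\<bar> \<le> t * (?n * (norm H * B) * t)"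
        using t by (intro mult_left_mono) auto
      then have "\<bar>N $ a $ b\<bar> * \<bar>e $ b - (d $ a + t * G $ a $ a)\<bar> \<le> ?n * (norm H * B) * t\<^sup>2"
        using arg_cong[OF perturbed_frame_row[OF W X less_imp_le[OF t(1)], of a b], of abs] t
        unfolding abs_mult by (simp add: N_def G_def power2_eq_square mult_ac)
      from abs_le_of_product[OF this ab]
      show "\<bar>e $ b - (d $ a + t * G $ a $ a)\<bar> \<le> ?n * (?n * (norm H * B)) * t\<^sup>2"
        by (simp add: mult.assoc)
    qed
    obtain j k where jk: "j \<le> i" "i \<le> k" "1 / ?n \<le> \<bar>N $ j $ k\<bar>" by (rule orthogonal_matrix_pivot[OF N])
    have "d $ k \<le> d $ i" "d $ i \<le> d $ j" using jk W(2) by (auto dest: antimonoD)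
    then have "d $ j = d $ i" using key[OF jk(3)] by simp
    then have "t * G $ i $ i \<le> t * G $ j $ j" using t by (intro mult_left_mono sorted jk) auto
    moreover have "e $ k \<le> e $ i" using jk X(2) by (auto dest: antimonoD)
    ultimately have lower: "- (?n * (?n * (norm H * B)) * t\<^sup>2) \<le> e $ i - d $ i - t * G $ i $ i"
      using key[OF jk(3)] \<open>d $ j = d $ i\<close> unfolding abs_le_iff by linarith
    obtain j' k' where jk': "j' \<le> i" "i \<le> k'" "1 / ?n \<le> \<bar>transpose N $ j' $ k'\<bar>"
      using orthogonal_matrix_pivot[of "transpose N" i] N by auto
    then have piv: "1 / ?n \<le> \<bar>N $ k' $ j'\<bar>" by (simp add: transpose_def)
    have "d $ k' \<le> d $ i" "d $ i \<le> d $ j'" using jk' W(2) by (auto dest: antimonoD)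
    then have "d $ i = d $ k'" using key[OF piv] by simp
    then have "t * G $ k' $ k' \<le> t * G $ i $ i" using t by (intro mult_left_mono sorted jk') auto
    moreover have "e $ i \<le> e $ j'" using jk' X(2) by (auto dest: antimonoD)
    ultimately have upper: "e $ i - d $ i - t * G $ i $ i \<le> ?n * (?n * (norm H * B)) * t\<^sup>2"
      using key[OF piv] \<open>d $ i = d $ k'\<close> unfolding abs_le_iff by linarith
    from lower upper show "\<bar>e $ i - d $ i - t * G $ i $ i\<bar> \<le> ?n * (?n * (norm H * B)) * t\<^sup>2" by linarith
  qed
qed

lemma tendsto_at_right_if_linear_error:
  fixes f :: "real \<Rightarrow> 'b::real_normed_vector"
  assumes "\<forall>\<^sub>F t in at_right 0. norm (f t - l) \<le> C * t"
  shows "(f \<longlongrightarrow> l) (at_right 0)"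
proof -
  have "((\<lambda>t. C * t) \<longlongrightarrow> C * 0) (at_right 0)" by (intro tendsto_intros)
  then have "((\<lambda>t. f t - l) \<longlongrightarrow> 0) (at_right 0)"
    using assms by (intro Lim_null_comparison[of "\<lambda>t. f t - l" "\<lambda>t. C * t"]) auto
  then show ?thesis by (simp add: LIM_zero_iff)
qed

lemma has_eigval_deriv_block_diagonal:
  fixes W H :: "'n::{finite,linorder} symmat"
  assumes W: "spectral_decomp W R d" "antimono (($) d)"
    and "\<And>i j. i \<noteq> j \<Longrightarrow> d $ i = d $ j \<Longrightarrow> (transpose R ** mat_of H ** R) $ i $ j = 0"
    and "\<And>i j. i \<le> j \<Longrightarrow> d $ i = d $ j \<Longrightarrow>
       (transpose R ** mat_of H ** R) $ j $ j \<le> (transpose R ** mat_of H ** R) $ i $ i"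
  shows "has_eigval_deriv W H i ((transpose R ** mat_of H ** R) $ i $ i)"
proof -
  let ?\<mu> = "(transpose R ** mat_of H ** R) $ i $ i"
  obtain C t1 where t1: "t1 > 0" and C: "\<And>t P e. 0 < t \<Longrightarrow> t < t1 \<Longrightarrow> spectral_decomp (W + t *\<^sub>R H) P e \<Longrightarrow>
      antimono (($) e) \<Longrightarrow> \<bar>e $ i - d $ i - t * ?\<mu>\<bar> \<le> C * t\<^sup>2"
  proof (rule eigenvalue_ray_expansion[OF assms, where i = i])
    fix C t1 assume "t1 > 0" "\<And>t P e. 0 < t \<Longrightarrow> t < t1 \<Longrightarrow> spectral_decomp (W + t *\<^sub>R H) P e \<Longrightarrow>
      antimono (($) e) \<Longrightarrow> \<bar>e $ i - d $ i - t * ?\<mu>\<bar> \<le> C * t\<^sup>2"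
    then show thesis by (rule that)
  qed
  have "norm ((eigvals (W + t *\<^sub>R H) $ i - eigvals W $ i) / t - ?\<mu>) \<le> C * t" if t: "0 < t" "t < t1" for t
  proof -
    obtain P e where e: "spectral_decomp (W + t *\<^sub>R H) P e" "antimono (($) e)" by (rule ex_spectral_decomp)
    have "(e $ i - d $ i) / t - ?\<mu> = (e $ i - d $ i - t * ?\<mu>) / t" using t by (simp add: field_simps)
    also have "\<bar>\<dots>\<bar> \<le> C * t"
      using C[OF t e] t by (simp add: abs_divide divide_le_eq power2_eq_square mult.assoc)
    finally show ?thesis by (simp add: eigvals_spectral_decomp[OF e] eigvals_spectral_decomp[OF W])
  qed
  then show ?thesis
    unfolding has_eigval_deriv_def using t1
    by (intro tendsto_at_right_if_linear_error[where C = C]) (auto simp: eventually_at_right_field)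
qed

lemma eigval_deriv_eqI: "has_eigval_deriv W H i l \<Longrightarrow> eigval_deriv W H i = l"
  unfolding eigval_deriv_def has_eigval_deriv_def
  by (rule the_equality) (auto intro: tendsto_unique[OF trivial_limit_at_right_real])

text \<open>The coefficient of the off-diagonal blocks; the diagonal blocks are accounted for separately.\<close>

definition block_slope :: "real \<Rightarrow> real \<Rightarrow> real" where
  "block_slope x y = (if x = y then 0 else (huber 0 x - huber 0 y) / (x - y))"

lemma block_slope_bounds: "0 \<le> block_slope x y" "block_slope x y \<le> 1"
  using divdiff_bounds[of 0 x y] by (auto simp: block_slope_def divdiff_def)

lemma block_slope_commute: "block_slope x y = block_slope y x"
  unfolding block_slope_def by (metis minus_diff_eq minus_divide_divide)

text \<open>
  The same exchange of divided differences as for the derivative off \<open>\<epsilon> = 0\<close>: with \<open>N = R\<^sup>T P\<close> and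
  \<open>x\<^sub>i = d\<^sub>i + t G\<^sub>i\<^sub>i\<close>, the error has the entries \<open>t \<Sum>\<^sub>l\<^sub>\<noteq>\<^sub>i G\<^sub>i\<^sub>l N\<^sub>l\<^sub>k (h[x\<^sub>i, e\<^sub>k] - \<kappa>(d\<^sub>i, d\<^sub>l))\<close>, where either \<open>N\<^sub>l\<^sub>k\<close> is of
  order \<open>t\<close> (different blocks) or the two slopes differ by order \<open>t\<close>. The only exception is \<open>d\<^sub>i = d\<^sub>l = d\<^sub>k\<close>, where
  \<open>G\<^sub>i\<^sub>l = 0\<close> if the common value is nonnegative and both slopes vanish if it is negative; hence \<open>G\<close> may be
  arbitrary on the blocks of the negative eigenvalues.
\<close>

lemma Phi_ray_expansion:
  fixes W H :: "'n::{finite,linorder} symmat"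
  assumes W: "spectral_decomp W R d" "antimono (($) d)"
  defines "G \<equiv> transpose R ** mat_of H ** R"
  assumes offdiag: "\<And>i j. i \<noteq> j \<Longrightarrow> d $ i = d $ j \<Longrightarrow> 0 \<le> d $ i \<Longrightarrow> G $ i $ j = 0"
  obtains C t1 where "t1 > 0" "\<And>t. 0 < t \<Longrightarrow> t < t1 \<Longrightarrow>
    norm (mat_of (Phi (t * \<tau>, W + t *\<^sub>R H)) - R ** (diag_mat (\<chi> i. huber (t * \<tau>) (d $ i + t * G $ i $ i))
      + t *\<^sub>R (\<chi> i j. block_slope (d $ i) (d $ j) * G $ i $ j)) ** transpose R) \<le> C * t\<^sup>2"
proof -
  let ?n = "real CARD('n)"
  obtain \<rho> where \<rho>: "\<rho> > 0" "\<And>k l. d $ k \<noteq> d $ l \<Longrightarrow> \<rho> \<le> \<bar>d $ k - d $ l\<bar>"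
      "\<And>k. d $ k \<noteq> 0 \<Longrightarrow> \<rho> \<le> \<bar>d $ k\<bar>"
    by (metis ex_min_gap)
  define B where "B = (?n + 1) * norm H / \<rho>"
  define B' where "B' = (2 * (?n + 1) * norm H + \<bar>\<tau>\<bar>) / \<rho>"
  have B: "0 \<le> B" "0 \<le> B'" using \<rho>(1) by (simp_all add: B_def B'_def)
  have n: "?n \<ge> 1" by (simp add: Suc_leI)
  have R: "orthogonal_matrix R" using W by (auto dest: spectral_decompD)
  have G: "\<bar>G $ i $ l\<bar> \<le> norm H" for i l
    unfolding G_def by (rule conjugated_entry_le_norm[OF R])
  define K where "K = (\<chi> i j. block_slope (d $ i) (d $ j) * G $ i $ j)"
  show ?thesis
    \<comment> \<open>for such \<open>t\<close>, the negative eigenvalues stay negative\<close>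
  proof (rule that[of "\<rho> / (?n * norm H + 1)" "?n * (?n * (norm H * (B + B')))"])
    show "\<rho> / (?n * norm H + 1) > 0" using \<rho>(1) by (simp add: add_nonneg_pos)
    fix t :: real assume t: "0 < t" "t < \<rho> / (?n * norm H + 1)"
    define x where "x i = d $ i + t * G $ i $ i" for i
    let ?Z = "diag_mat (\<chi> i. huber (t * \<tau>) (x i)) + t *\<^sub>R K"
    obtain P e where X: "spectral_decomp (W + t *\<^sub>R H) P e" "antimono (($) e)" by (rule ex_spectral_decomp)
    have P: "orthogonal_matrix P" using X by (auto dest: spectral_decompD)
    define N where "N = transpose R ** P"
    have N: "orthogonal_matrix N" unfolding N_def by (rule orthogonal_frames[OF W(1) X(1)])
    have small: "?n * norm H * t < \<rho>"
    proof -
      have "(?n * norm H + 1) * t < \<rho>" using t by (simp add: pos_less_divide_eq add_nonneg_pos mult.commute)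
      then show ?thesis using t by (simp add: algebra_simps)
    qed
    have off: "\<bar>N $ l $ k\<bar> \<le> B * t" if "d $ l \<noteq> d $ k" for l k
      using perturbed_frame_off_block[OF W X less_imp_le[OF t(1)] \<rho>(1) \<rho>(2)[OF that]]
      by (simp add: N_def B_def)
    have ev: "\<bar>e $ k - d $ k\<bar> \<le> ?n * norm H * t" for k
      using perturbed_eigenvalue[OF W X less_imp_le[OF t(1)]] .
    have xd: "\<bar>x i - d $ i\<bar> \<le> norm H * t" for i
      using G[of i i] t by (simp add: x_def abs_mult mult.commute)
    have Hn: "norm H * t \<le> ?n * norm H * t" using n t mult_right_mono[OF n, of "norm H * t"] by (simp add: mult.assoc)
    have "norm (mat_of (Phi (t * \<tau>, W + t *\<^sub>R H)) - R ** ?Z ** transpose R)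
       = norm (transpose R ** (mat_of (Phi (t * \<tau>, W + t *\<^sub>R H)) - R ** ?Z ** transpose R) ** P)"
      by (simp add: norm_change_frames[OF R P])
    also have "\<dots> \<le> ?n * (?n * (norm H * (B + B')) * t\<^sup>2)"
    proof (rule norm_le_entry_bound)
      fix i k
      let ?\<omega> = "divdiff (t * \<tau>) (x i) (e $ k)"
      have 1: "transpose R ** mat_of (Phi (t * \<tau>, W + t *\<^sub>R H)) ** P = N ** diag_mat (\<chi> i. huber (t * \<tau>) (e $ i))"
        using spectral_decompD(4)[OF huber_mat_frame[OF X(1), of "t * \<tau>"]] 
        by (simp add: N_def flip: matrix_mul_assoc)
      have 2: "transpose R ** (R ** ?Z ** transpose R) ** P = ?Z ** N"
        by (simp add: N_def matrix_mul_assoc orthogonal_matrixD[OF R])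
      have "(\<Sum>l\<in>UNIV. K $ i $ l * N $ l $ k) = K $ i $ i * N $ i $ k + (\<Sum>l\<in>UNIV - {i}. K $ i $ l * N $ l $ k)"
        by (rule sum.remove) auto
      then have 3: "(K ** N) $ i $ k = (\<Sum>l\<in>UNIV - {i}. K $ i $ l * N $ l $ k)"
        by (simp add: matrix_mult_entry K_def block_slope_def)
      have "?\<omega> * (e $ k - x i) = huber (t * \<tau>) (e $ k) - huber (t * \<tau>) (x i)"
        using divdiff_mult[of "t * \<tau>" "x i" "e $ k"] by (simp add: algebra_simps)
      then have "N $ i $ k * (huber (t * \<tau>) (e $ k) - huber (t * \<tau>) (x i)) = ?\<omega> * (N $ i $ k * (e $ k - x i))"
        by (metis mult.left_commute)
      also have "\<dots> = t * (\<Sum>l\<in>UNIV - {i}. G $ i $ l * N $ l $ k * ?\<omega>)"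
        using perturbed_frame_row[OF W X less_imp_le[OF t(1)], of i k]
        by (simp add: N_def G_def x_def sum_distrib_left mult_ac)
      finally have 4: "N $ i $ k * (huber (t * \<tau>) (e $ k) - huber (t * \<tau>) (x i)) = \<dots>" .
      have "(transpose R ** (mat_of (Phi (t * \<tau>, W + t *\<^sub>R H)) - R ** ?Z ** transpose R) ** P) $ i $ k
         = N $ i $ k * (huber (t * \<tau>) (e $ k) - huber (t * \<tau>) (x i)) - t * (K ** N) $ i $ k"
        unfolding matrix_diff_distribs 1 2
        by (simp add: matrix_linear_distribs mult_diag_mat_entry diag_mat_mult_entry algebra_simps)
      also have "\<dots> = t * (\<Sum>l\<in>UNIV - {i}. G $ i $ l * N $ l $ k * (?\<omega> - block_slope (d $ i) (d $ l)))"
        unfolding 3 4 by (simp add: right_diff_distrib sum_subtractf K_def mult_ac)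
      finally have eq: "(transpose R ** (mat_of (Phi (t * \<tau>, W + t *\<^sub>R H)) - R ** ?Z ** transpose R) ** P) $ i $ k = \<dots>" .
      have \<omega>: "0 \<le> ?\<omega>" "?\<omega> \<le> 1" by (rule divdiff_bounds)+
      have "\<bar>G $ i $ l * N $ l $ k * (?\<omega> - block_slope (d $ i) (d $ l))\<bar> \<le> norm H * ((B + B') * t)"
        if "l \<in> UNIV - {i}" for l
      proof -
        consider "d $ l \<noteq> d $ k" | "d $ l = d $ k" "d $ i \<noteq> d $ k" | "d $ l = d $ k" "d $ i = d $ k" "0 \<le> d $ i"
          | "d $ l = d $ k" "d $ i = d $ k" "d $ i < 0" by linarith
        then show ?thesis
        proof cases
          case 1
          have "\<bar>?\<omega> - block_slope (d $ i) (d $ l)\<bar> \<le> 1"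
            using \<omega> block_slope_bounds[of "d $ i" "d $ l"] by linarith
          then have "\<bar>G $ i $ l\<bar> * (\<bar>N $ l $ k\<bar> * \<bar>?\<omega> - block_slope (d $ i) (d $ l)\<bar>) \<le> norm H * ((B * t) * 1)"
            using B t by (intro mult_mono G off 1) auto
          also have "\<dots> \<le> norm H * ((B + B') * t)"
            using B t by (intro mult_left_mono) (auto simp: distrib_right)
          finally show ?thesis by (simp add: abs_mult mult.assoc)
        next
          case 2
          let ?\<kappa> = "block_slope (d $ i) (d $ k)"
          have \<kappa>: "?\<kappa> * (d $ k - d $ i) = huber 0 (d $ k) - huber 0 (d $ i)"
            using 2 unfolding block_slope_commute[of "d $ i"] by (simp add: block_slope_def)
          have abs3: "\<bar>a - b + c\<bar> \<le> a' + b' + c'" if "\<bar>a\<bar> \<le> a'" "\<bar>b\<bar> \<le> b'" "\<bar>c\<bar> \<le> c'" for a b c a' b' c' :: real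
            using that by linarith
          have a: "\<bar>huber (t * \<tau>) (e $ k) - huber 0 (d $ k)\<bar> \<le> ?n * norm H * t + t * \<bar>\<tau>\<bar> / 2"
            using huber_lipschitz[of "t * \<tau>" "e $ k" 0 "d $ k"] ev[of k] t by (simp add: abs_mult)
          have b: "\<bar>huber (t * \<tau>) (x i) - huber 0 (d $ i)\<bar> \<le> norm H * t + t * \<bar>\<tau>\<bar> / 2"
            using huber_lipschitz[of "t * \<tau>" "x i" 0 "d $ i"] xd[of i] t by (simp add: abs_mult)
          have c: "\<bar>?\<omega> * ((d $ k - d $ i) - (e $ k - x i))\<bar> \<le> 1 * (?n * norm H * t + norm H * t)"
            unfolding abs_mult using \<omega> ev[of k] xd[of i] t
            by (intro mult_mono) (auto simp: abs_le_iff)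
          have "(?\<omega> - ?\<kappa>) * (d $ k - d $ i) = (huber (t * \<tau>) (e $ k) - huber 0 (d $ k))
              - (huber (t * \<tau>) (x i) - huber 0 (d $ i)) + ?\<omega> * ((d $ k - d $ i) - (e $ k - x i))"
            using \<kappa> divdiff_mult[of "t * \<tau>" "x i" "e $ k"] by (simp add: algebra_simps)
          then have "\<bar>(?\<omega> - ?\<kappa>) * (d $ k - d $ i)\<bar> \<le> (?n * norm H * t + t * \<bar>\<tau>\<bar> / 2) + (norm H * t + t * \<bar>\<tau>\<bar> / 2)
              + 1 * (?n * norm H * t + norm H * t)"
            using abs3[OF a b c] by simp
          also have "\<dots> = (2 * (?n + 1) * norm H + \<bar>\<tau>\<bar>) * t" by (simp add: algebra_simps)
          finally have "\<bar>?\<omega> - ?\<kappa>\<bar> * \<bar>d $ k - d $ i\<bar> \<le> (2 * (?n + 1) * norm H + \<bar>\<tau>\<bar>) * t" by (simp add: abs_mult)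
          moreover have "\<bar>?\<omega> - ?\<kappa>\<bar> * \<rho> \<le> \<bar>?\<omega> - ?\<kappa>\<bar> * \<bar>d $ k - d $ i\<bar>"
            using 2 \<rho>(2)[of k i] by (intro mult_left_mono) auto
          ultimately have \<omega>\<kappa>: "\<bar>?\<omega> - ?\<kappa>\<bar> \<le> B' * t" using \<rho>(1) by (simp add: B'_def pos_le_divide_eq)
          have "\<bar>G $ i $ l\<bar> * (\<bar>N $ l $ k\<bar> * \<bar>?\<omega> - ?\<kappa>\<bar>) \<le> norm H * (1 * (B' * t))"
            using B t \<omega>\<kappa> by (intro mult_mono G orthogonal_entry_le_1[OF N]) auto
          also have "\<dots> \<le> norm H * ((B + B') * t)"
            using B t by (intro mult_left_mono) (auto simp: distrib_right)
          finally show ?thesis by (simp add: abs_mult mult.assoc 2)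
        next
          case 3
          then have "G $ i $ l = 0" using that by (intro offdiag) auto
          then show ?thesis using B t by simp
        next
          case 4
          have "d $ k \<le> - \<rho>" using \<rho>(3)[of k] 4 by simp
          then have neg: "e $ k < 0" "x i < 0" using ev[of k] xd[of i] small Hn 4 by linarith+
          moreover have "huber a b = 0" "huber_slope a b = 0" if "b < 0" for a b
          proof -
            have "\<not> \<bar>a\<bar> < b" using that by linarith
            then show "huber a b = 0" using that by (simp add: huber_def)
            have "b / \<bar>a\<bar> \<le> 0" using that by (intro divide_nonpos_nonneg) auto
            then show "huber_slope a b = 0" by (simp add: huber_slope_def)
          qed
          ultimately have "?\<omega> = 0" by (simp add: divdiff_def)
          then show ?thesis using 4 B t by (simp add: block_slope_def)
        qed
      qed
      then have "\<bar>\<Sum>l\<in>UNIV - {i}. G $ i $ l * N $ l $ k * (?\<omega> - block_slope (d $ i) (d $ l))\<bar>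
          \<le> (\<Sum>l\<in>UNIV - {i}. norm H * ((B + B') * t))"
        by (intro order_trans[OF sum_abs] sum_mono)
      also have "\<dots> \<le> (\<Sum>l\<in>(UNIV :: 'n set). norm H * ((B + B') * t))"
        using B t by (intro sum_mono2) auto
      also have "\<dots> = ?n * (norm H * (B + B')) * t" by simp
      finally show "\<bar>(transpose R ** (mat_of (Phi (t * \<tau>, W + t *\<^sub>R H)) - R ** ?Z ** transpose R) ** P) $ i $ k\<bar>
          \<le> ?n * (norm H * (B + B')) * t\<^sup>2"
        unfolding eq abs_mult using t by (simp add: power2_eq_square mult_ac)
    qed
    finally show "norm (mat_of (Phi (t * \<tau>, W + t *\<^sub>R H)) - R ** (diag_mat (\<chi> i. huber (t * \<tau>) (d $ i + t * G $ i $ i))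
      + t *\<^sub>R (\<chi> i j. block_slope (d $ i) (d $ j) * G $ i $ j)) ** transpose R) \<le> ?n * (?n * (norm H * (B + B'))) * t\<^sup>2"
      by (simp add: K_def x_def mult.assoc)
  qed
qed

section \<open>The directional derivative at \<open>\<epsilon> = 0\<close>\<close>

lemma huber_homogeneous: "0 < t \<Longrightarrow> huber (t * \<tau>) (t * \<mu>) = t * huber \<tau> \<mu>"
  by (auto simp: huber_def abs_mult power2_eq_square zero_le_mult_iff max_def right_diff_distrib)

text \<open>The directional derivative of \<open>h\<close> at \<open>(0, x)\<close> in the direction \<open>(\<tau>, \<mu>)\<close>.\<close>

definition huber_dir :: "real \<Rightarrow> real \<Rightarrow> real \<Rightarrow> real" where
  "huber_dir \<tau> x \<mu> = (if x > 0 then \<mu> - \<bar>\<tau>\<bar> / 2 else if x = 0 then huber \<tau> \<mu> else 0)"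

lemma huber_ray: "\<forall>\<^sub>F t in at_right 0. huber (t * \<tau>) (x + t * \<mu>) = huber 0 x + t * huber_dir \<tau> x \<mu>"
proof (cases "x = 0")
  case True
  then show ?thesis
    by (auto simp: eventually_at_filter huber_homogeneous huber_dir_def huber_def[of 0 0])
next
  case False
  have "huber (t * \<tau>) (x + t * \<mu>) = huber 0 x + t * huber_dir \<tau> x \<mu>"
    if t: "0 < t" "t < \<bar>x\<bar> / (\<bar>\<mu>\<bar> + \<bar>\<tau>\<bar> + 1)" for t
  proof -
    have "t * (\<bar>\<mu>\<bar> + \<bar>\<tau>\<bar> + 1) < \<bar>x\<bar>" using t by (simp add: pos_less_divide_eq)
    then have "\<bar>t * \<mu>\<bar> + \<bar>t * \<tau>\<bar> < \<bar>x\<bar>" using t by (simp add: abs_mult distrib_left)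
    moreover have "\<bar>t * \<tau>\<bar> = t * \<bar>\<tau>\<bar>" using t by (simp add: abs_mult)
    ultimately show ?thesis
      using False by (auto simp: huber_def huber_dir_def right_diff_distrib)
  qed
  then show ?thesis
    using False by (auto simp: eventually_at_right_field intro!: exI[of _ "\<bar>x\<bar> / (\<bar>\<mu>\<bar> + \<bar>\<tau>\<bar> + 1)"])
qed

lemma ex_Phi_dir_deriv_at_zero:
  fixes W H :: "'n::{finite,linorder} symmat"
  assumes W: "spectral_decomp W R d" "antimono (($) d)"
    and offdiag: "\<And>i j. i \<noteq> j \<Longrightarrow> d $ i = d $ j \<Longrightarrow> 0 \<le> d $ i \<Longrightarrow> (transpose R ** mat_of H ** R) $ i $ j = 0"
  obtains D where "has_dir_deriv Phi (0, W) (\<tau>, H) D"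
    "mat_of D = R ** (diag_mat (\<chi> i. huber_dir \<tau> (d $ i) ((transpose R ** mat_of H ** R) $ i $ i))
       + (\<chi> i j. block_slope (d $ i) (d $ j) * (transpose R ** mat_of H ** R) $ i $ j)) ** transpose R"
proof -
  define G where "G = transpose R ** mat_of H ** R"
  define v where "v = (\<chi> i. huber_dir \<tau> (d $ i) (G $ i $ i))"
  define K where "K = (\<chi> i j. block_slope (d $ i) (d $ j) * G $ i $ j)"
  have "G $ j $ i = G $ i $ j" for i j unfolding G_def by (rule conjugated_symmetric)
  then have "transpose (diag_mat v + K) = diag_mat v + K"
    by (auto simp: vec_eq_iff transpose_def diag_mat_nth K_def block_slope_commute)
  then have "transpose (R ** (diag_mat v + K) ** transpose R) = R ** (diag_mat v + K) ** transpose R"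
    by (simp add: matrix_transpose_mul matrix_mul_assoc)
  then obtain D where D: "mat_of D = R ** (diag_mat v + K) ** transpose R"
    by (metis (mono_tags, lifting) mem_Collect_eq symmat_of_inverse)
  obtain C t1 where "t1 > 0" and C: "\<And>t. 0 < t \<Longrightarrow> t < t1 \<Longrightarrow>
      norm (mat_of (Phi (t * \<tau>, W + t *\<^sub>R H)) - R ** (diag_mat (\<chi> i. huber (t * \<tau>) (d $ i + t * G $ i $ i))
        + t *\<^sub>R K) ** transpose R) \<le> C * t\<^sup>2"
    unfolding G_def K_def
  proof (rule Phi_ray_expansion[OF W offdiag, of \<tau>])
    fix C t1 assume "t1 > 0" "\<And>t. 0 < t \<Longrightarrow> t < t1 \<Longrightarrow>
      norm (mat_of (Phi (t * \<tau>, W + t *\<^sub>R H)) - R ** (diag_mat (\<chi> i. huber (t * \<tau>) (d $ i + t * (transpose R ** mat_of H ** R) $ i $ i))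
        + t *\<^sub>R (\<chi> i j. block_slope (d $ i) (d $ j) * (transpose R ** mat_of H ** R) $ i $ j)) ** transpose R) \<le> C * t\<^sup>2"
    then show thesis by (rule that[unfolded G_def K_def])
  qed
  have "\<forall>\<^sub>F t in at_right 0. \<forall>i. huber (t * \<tau>) (d $ i + t * G $ i $ i) = huber 0 (d $ i) + t * v $ i"
    by (intro eventually_all_finite) (simp add: v_def huber_ray)
  moreover have "\<forall>\<^sub>F t in at_right 0. 0 < t \<and> t < t1"
    using \<open>t1 > 0\<close> by (auto simp: eventually_at_right_field)
  ultimately have "\<forall>\<^sub>F t in at_right 0. norm ((Phi ((0, W) + t *\<^sub>R (\<tau>, H)) - Phi (0, W)) /\<^sub>R t - D) \<le> C * t"
  proof eventually_elim
    case (elim t)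
    then have t: "0 < t" "t < t1" by auto
    let ?A = "Phi (t * \<tau>, W + t *\<^sub>R H) - Phi (0, W) - t *\<^sub>R D"
    have "diag_mat (\<chi> i. huber (t * \<tau>) (d $ i + t * G $ i $ i)) = diag_mat (\<chi> i. huber 0 (d $ i)) + t *\<^sub>R diag_mat v"
      using elim by (simp add: vec_eq_iff diag_mat_nth)
    then have "mat_of (Phi (0, W)) + t *\<^sub>R mat_of D
        = R ** (diag_mat (\<chi> i. huber (t * \<tau>) (d $ i + t * G $ i $ i)) + t *\<^sub>R K) ** transpose R"
      by (simp add: mat_of_Phi_frame[OF W(1)] D matrix_linear_distribs scaleR_add_right add.assoc)
    then have "norm (mat_of ?A) \<le> C * t\<^sup>2"
      using C[OF t] by (simp add: mat_of_minus mat_of_linear diff_diff_eq)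
    moreover have "(Phi ((0, W) + t *\<^sub>R (\<tau>, H)) - Phi (0, W)) /\<^sub>R t - D = ?A /\<^sub>R t"
      using t by (simp add: scaleR_diff_right)
    moreover have "norm (?A /\<^sub>R t) = norm ?A / t" using t by (simp add: divide_inverse mult.commute)
    moreover have "norm ?A \<le> C * t * t \<Longrightarrow> norm ?A / t \<le> C * t" using t by (simp add: pos_divide_le_eq)
    ultimately show ?case by (simp only: norm_mat_of power2_eq_square mult.assoc)
  qed
  then have "has_dir_deriv Phi (0, W) (\<tau>, H) D"
    unfolding has_dir_deriv_def by (rule tendsto_at_right_if_linear_error)
  then show ?thesis using that D unfolding v_def K_def G_def by blast
qed

lemma dir_deriv_eqI: "has_dir_deriv F y h D \<Longrightarrow> dir_deriv F y h = D"
  unfolding dir_deriv_def has_dir_deriv_def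
  by (rule the_equality) (auto intro: tendsto_unique[OF trivial_limit_at_right_real])

lemma sum_outer_columns:
  fixes R :: "real^'n^'n"
  shows "(\<Sum>i\<in>S. c i *\<^sub>R outer (column i R) (column i R))
    = R ** diag_mat (\<chi> i. if i \<in> S then c i else 0) ** transpose R"
proof -
  have "(\<Sum>i\<in>S. c i * (R $ a $ i * R $ b $ i)) = (\<Sum>k\<in>UNIV. R $ a $ k * (if k \<in> S then c k else 0) * R $ b $ k)" for a b
  proof -
    have "(\<Sum>k\<in>UNIV. R $ a $ k * (if k \<in> S then c k else 0) * R $ b $ k)
        = (\<Sum>k\<in>UNIV. if k \<in> S then c k * (R $ a $ k * R $ b $ k) else 0)"
      by (rule sum.cong) auto
    also have "\<dots> = (\<Sum>k\<in>UNIV \<inter> S. c k * (R $ a $ k * R $ b $ k))"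
      by (rule sum.inter_restrict[symmetric]) simp
    finally show ?thesis by simp
  qed
  then show ?thesis by (simp add: vec_eq_iff conjugated_diag_entry outer_def column_def)
qed

lemma eigproj_eq: "eigproj R d x = R ** diag_mat (\<chi> i. if d $ i = x then 1 else 0) ** transpose R"
  using sum_outer_columns[of "\<lambda>i. 1" R "block d x"] by (simp add: eigproj_def block_def)

lemma Phi_dir_formula_eq:
  fixes W H :: "'n::{finite,linorder} symmat"
  shows "Phi_dir_formula W R d \<tau> H = R ** (diag_mat (\<chi> i. huber_dir \<tau> (d $ i) (eigval_deriv W H i))
       + (\<chi> i j. block_slope (d $ i) (d $ j) * (transpose R ** mat_of H ** R) $ i $ j)) ** transpose R"
proof -
  define G where "G = transpose R ** mat_of H ** R"
  define E :: "real \<Rightarrow> real^'n::{finite,linorder}^'n::{finite,linorder}"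
    where "E x = diag_mat (\<chi> i. if d $ i = x then 1 else 0)" for x
  define S where "S = {(x, y). x \<in> range (($) d) \<and> y \<in> range (($) d) \<and> x \<noteq> y}"
  define c where "c p = (huber 0 (fst p) - huber 0 (snd p)) / (fst p - snd p)" for p :: "real \<times> real"
  define T where "T p = c p *\<^sub>R (E (snd p) ** G ** E (fst p) + E (fst p) ** G ** E (snd p))" for p
  let ?C = "\<lambda>A. R ** A ** transpose R"
  have lin: "linear ?C" by (rule linearI) (simp_all add: matrix_linear_distribs)
  have "S \<subseteq> range (($) d) \<times> range (($) d)" by (auto simp: S_def)
  then have fin: "finite S" by (rule finite_subset) simp
  have QHQ: "eigproj R d x ** mat_of H ** eigproj R d y = ?C (E x ** G ** E y)" for x y
    by (simp add: eigproj_eq E_def G_def matrix_mul_assoc)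
  have "(\<Sum>(x, y)\<in>S. ((huber 0 x - huber 0 y) / (x - y)) *\<^sub>R
        (eigproj R d y ** mat_of H ** eigproj R d x + eigproj R d x ** mat_of H ** eigproj R d y))
      = (\<Sum>p\<in>S. ?C (T p))"
    by (rule sum.cong) (auto simp: QHQ T_def c_def matrix_linear_distribs)
  also have "\<dots> = ?C (\<Sum>p\<in>S. T p)" by (rule linear_sum[OF lin, symmetric])
  finally have sum1: "(\<Sum>(x, y)\<in>S. ((huber 0 x - huber 0 y) / (x - y)) *\<^sub>R
        (eigproj R d y ** mat_of H ** eigproj R d x + eigproj R d x ** mat_of H ** eigproj R d y)) = \<dots>" .
  have "((1/2) *\<^sub>R (\<Sum>p\<in>S. T p)) $ i $ j = block_slope (d $ i) (d $ j) * G $ i $ j" for i j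
  proof -
    have EGE: "(E x ** G ** E y) $ i $ j = (if d $ i = x \<and> d $ j = y then G $ i $ j else 0)" for x y
      by (simp add: E_def mult_diag_mat_entry diag_mat_mult_entry)
    have "T p $ i $ j = (if p = (d $ j, d $ i) then c p * G $ i $ j else 0)
        + (if p = (d $ i, d $ j) then c p * G $ i $ j else 0)" for p
    proof -
      obtain x y where p: "p = (x, y)" by (cases p)
      show ?thesis
        unfolding p T_def fst_conv snd_conv vector_scaleR_component vector_add_component EGE prod.inject
        by (simp only: eq_commute[of x] eq_commute[of y] conj_commute[of "d $ j = x"] real_scaleR_def
            distrib_left mult_zero_right if_distrib[of "(*) (c (x, y))"])
    qed
    then have "(\<Sum>p\<in>S. T p) $ i $ j = (if (d $ j, d $ i) \<in> S then c (d $ j, d $ i) * G $ i $ j else 0)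
        + (if (d $ i, d $ j) \<in> S then c (d $ i, d $ j) * G $ i $ j else 0)"
      using fin by (simp add: sum.distrib)
    moreover have "(if (d $ a, d $ b) \<in> S then c (d $ a, d $ b) * g else 0) = block_slope (d $ a) (d $ b) * g" for a b g
      by (simp add: S_def c_def block_slope_def)
    ultimately show ?thesis
      using block_slope_commute[of "d $ i" "d $ j"] by (simp only: vector_scaleR_component) simp
  qed
  then have blocks: "(1/2) *\<^sub>R (\<Sum>p\<in>S. T p) = (\<chi> i j. block_slope (d $ i) (d $ j) * G $ i $ j)"
    by (simp add: vec_eq_iff)
  have diag: "diag_mat (\<chi> i. if i \<in> {i. d $ i > 0} then eigval_deriv W H i - \<bar>\<tau>\<bar> / 2 else 0)
      + diag_mat (\<chi> i. if i \<in> {i. d $ i = 0} then huber \<tau> (eigval_deriv W H i) else 0)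
      = diag_mat (\<chi> i. huber_dir \<tau> (d $ i) (eigval_deriv W H i))"
    by (auto simp: vec_eq_iff diag_mat_nth huber_dir_def)
  have "Phi_dir_formula W R d \<tau> H = ?C ((1/2) *\<^sub>R (\<Sum>p\<in>S. T p))
      + (?C (diag_mat (\<chi> i. if i \<in> {i. d $ i > 0} then eigval_deriv W H i - \<bar>\<tau>\<bar> / 2 else 0))
      + ?C (diag_mat (\<chi> i. if i \<in> {i. d $ i = 0} then huber \<tau> (eigval_deriv W H i) else 0)))"
    unfolding Phi_dir_formula_def sum_outer_columns S_def[symmetric] sum1 linear_scale[OF lin] by (rule add.assoc)
  also have "\<dots> = ?C (diag_mat (\<chi> i. huber_dir \<tau> (d $ i) (eigval_deriv W H i))
       + (\<chi> i j. block_slope (d $ i) (d $ j) * G $ i $ j))"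
    unfolding blocks linear_add[OF lin, symmetric] diag by (simp add: add.commute)
  finally show ?thesis unfolding G_def .
qed

text \<open>
  Two eigenframes of \<open>W\<close> differ by an orthogonal matrix \<open>M\<close> that is block diagonal, so \<open>M\<close> maps the
  eigenspaces of a diagonal block of \<open>R\<^sup>T H R\<close>, which are coordinate subspaces, onto those of the corresponding
  block of \<open>P\<^sup>T H P\<close>.
\<close>

lemma are_eigenvalues_on_block:
  fixes W H :: "'n::finite symmat"
  assumes P: "spectral_decomp W P d" and R: "spectral_decomp W R d"
    and diag: "\<And>i j. i \<noteq> j \<Longrightarrow> d $ i = d $ j \<Longrightarrow> (transpose R ** mat_of H ** R) $ i $ j = 0"
  shows "are_eigenvalues_on (block d x) (transpose P ** mat_of H ** P) (\<lambda>i. (transpose R ** mat_of H ** R) $ i $ i)"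
  unfolding are_eigenvalues_on_def
proof
  fix z
  define G where "G = transpose R ** mat_of H ** R"
  define A where "A = transpose P ** mat_of H ** P"
  define M where "M = transpose P ** R"
  let ?B = "block d x"
  let ?I = "{i \<in> ?B. G $ i $ i = z}"
  let ?Y = "{y :: real^'n. \<forall>i. i \<notin> ?I \<longrightarrow> y $ i = 0}"
  have oP: "orthogonal_matrix P" and oR: "orthogonal_matrix R"
    using P R by (auto dest: spectral_decompD)
  have M: "orthogonal_matrix M" unfolding M_def by (rule orthogonal_frames[OF P R])
  have M0: "M $ i $ k = 0" if "d $ i \<noteq> d $ k" for i k
    using mixed_frame_bound[OF P R, of i k] that by (simp add: M_def mult_le_0_iff)
  have AM: "A ** M = M ** G"
    by (simp add: A_def M_def G_def matrix_mul_assoc orthogonal_cancel[OF oP] orthogonal_cancel[OF oR])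
  then have MA: "transpose M ** A = G ** transpose M"
    by (metis M matrix_mul_assoc orthogonal_cancel(1,3))
  have inv: "transpose M *v (M *v y) = y" "M *v (transpose M *v y) = y" for y
    by (simp_all only: matrix_vector_mul_assoc orthogonal_matrixD[OF M] matrix_vector_mul_lid)
  have entry: "(B *v y) $ i = (\<Sum>k\<in>UNIV. B $ i $ k * y $ k)" for B :: "real^'n^'n" and y i
    by (simp add: matrix_vector_mult_def)
  have tentry: "(transpose M *v y) $ i = (\<Sum>k\<in>UNIV. M $ k $ i * y $ k)" for y i
    unfolding entry by (simp add: transpose_def)
  have Gy: "(G *v y) $ k = G $ k $ k * y $ k" if y: "\<And>i. i \<notin> ?B \<Longrightarrow> y $ i = 0" and k: "k \<in> ?B" for y k
  proof -
    have "G $ k $ l * y $ l = (if l = k then G $ k $ k * y $ k else 0)" for l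
    proof (cases "l \<in> ?B")
      case True
      then have "d $ k = d $ l" using k by (simp add: block_def)
      then show ?thesis using diag[of k l] by (auto simp: G_def)
    next
      case False
      then show ?thesis using y k by auto
    qed
    then have "(G *v y) $ k = (\<Sum>l\<in>UNIV. if l = k then G $ k $ k * y $ k else 0)"
      unfolding entry by (intro sum.cong) auto
    then show ?thesis by simp
  qed
  have "eigenspace_on ?B A z = (*v) M ` ?Y"
  proof
    show "(*v) M ` ?Y \<subseteq> eigenspace_on ?B A z"
    proof clarify
      fix y :: "real^'n" assume y: "\<forall>i. i \<notin> ?I \<longrightarrow> y $ i = 0"
      have "(M *v y) $ i = 0" if "i \<notin> ?B" for i
        unfolding entry using that y M0[of i] by (intro sum.neutral) (force simp: block_def)
      moreover have "(A *v (M *v y)) $ i = z * (M *v y) $ i" if i: "i \<in> ?B" for i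
      proof -
        have "(A *v (M *v y)) $ i = (M *v (G *v y)) $ i"
          by (simp add: matrix_vector_mul_assoc AM)
        also have "\<dots> = (\<Sum>k\<in>UNIV. z * (M $ i $ k * y $ k))"
          unfolding entry[of M]
        proof (rule sum.cong)
          fix k
          show "M $ i $ k * (G *v y) $ k = z * (M $ i $ k * y $ k)"
          proof (cases "d $ i = d $ k")
            case True
            then have "k \<in> ?B" using i by (simp add: block_def)
            moreover have "(G *v y) $ k = G $ k $ k * y $ k" using y \<open>k \<in> ?B\<close> by (intro Gy) auto
            moreover have "G $ k $ k * y $ k = z * y $ k" using y by (cases "k \<in> ?I") auto
            ultimately show ?thesis by simp
          qed (simp add: M0)
        qed simp
        finally show ?thesis by (simp add: entry sum_distrib_left)
      qed
      ultimately show "M *v y \<in> eigenspace_on ?B A z" by (simp add: eigenspace_on_def)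
    qed
    show "eigenspace_on ?B A z \<subseteq> (*v) M ` ?Y"
    proof
      fix v assume "v \<in> eigenspace_on ?B A z"
      then have v: "\<And>i. i \<notin> ?B \<Longrightarrow> v $ i = 0" "\<And>i. i \<in> ?B \<Longrightarrow> (A *v v) $ i = z * v $ i"
        by (auto simp: eigenspace_on_def)
      define y where "y = transpose M *v v"
      have y0: "y $ k = 0" if "k \<notin> ?B" for k
      proof -
        have "M $ i $ k * v $ i = 0" for i
          using that v(1)[of i] M0[of i k] by (cases "i \<in> ?B") (auto simp: block_def)
        then show ?thesis unfolding y_def tentry by (intro sum.neutral) blast
      qed
      have "y $ k = 0" if k: "k \<in> ?B" "G $ k $ k \<noteq> z" for k
      proof -
        have "G $ k $ k * y $ k = (G *v y) $ k" by (rule Gy[OF y0 k(1), symmetric])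
        also have "\<dots> = (transpose M *v (A *v v)) $ k"
          by (simp only: y_def matrix_vector_mul_assoc MA)
        also have "\<dots> = (\<Sum>i\<in>UNIV. z * (M $ i $ k * v $ i))"
          unfolding tentry
        proof (rule sum.cong)
          fix i
          show "M $ i $ k * (A *v v) $ i = z * (M $ i $ k * v $ i)"
            using k(1) M0[of i k] v(2)[of i] by (cases "d $ i = d $ k") (auto simp: block_def)
        qed simp
        also have "\<dots> = z * y $ k" by (simp only: y_def tentry sum_distrib_left)
        finally show ?thesis using k(2) by simp
      qed
      then have "y \<in> ?Y" using y0 by auto
      moreover have "v = M *v y" by (simp only: y_def inv)
      ultimately show "v \<in> (*v) M ` ?Y" by (rule rev_image_eqI)
    qed
  qed
  moreover have "inj ((*v) M)"
    by (rule inj_on_inverseI[where g = "(*v) (transpose M)"]) (rule inv)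
  ultimately have "dim (eigenspace_on ?B A z) = dim ?Y"
    by (simp only: dim_image_eq[OF matrix_vector_mul_linear] inj_on_subset[OF _ subset_UNIV])
  also have "\<dots> = card ?I"
    using dim_substandard_cart[of ?I, where 'a = real] by (simp only: dim_vec_eq)
  finally show "card {i \<in> ?B. (transpose R ** mat_of H ** R) $ i $ i = z}
      = dim (eigenspace_on ?B (transpose P ** mat_of H ** P) z)"
    by (simp add: A_def G_def)
qed

section \<open>Strong semismoothness\<close>

lemma continuous_on_Phi: "continuous_on UNIV (Phi :: real \<times> 'n::{finite,linorder} symmat \<Rightarrow> 'n symmat)"
proof -
  have "(2 * real CARD('n))-lipschitz_on UNIV (Phi :: real \<times> 'n symmat \<Rightarrow> 'n symmat)"
    using Phi_lipschitz by (intro lipschitz_onI) (auto simp: dist_norm)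
  then show ?thesis by (rule lipschitz_on_continuous_on)
qed

lemma directionally_differentiable_Phi:
  "directionally_differentiable_at (Phi :: real \<times> 'n::{finite,linorder} symmat \<Rightarrow> 'n symmat) y"
  unfolding directionally_differentiable_at_def
proof
  fix h :: "real \<times> 'n symmat"
  obtain \<epsilon> W \<tau> H where yh: "y = (\<epsilon>, W)" "h = (\<tau>, H)" by (metis surj_pair)
  obtain P d where W: "spectral_decomp W P d" "antimono (($) d)" by (rule ex_spectral_decomp)
  show "\<exists>D. has_dir_deriv Phi y h D"
  proof (cases "\<epsilon> = 0")
    case True
    obtain R where "spectral_decomp W R d"
      "\<And>i j. i \<noteq> j \<Longrightarrow> d $ i = d $ j \<Longrightarrow> (transpose R ** mat_of H ** R) $ i $ j = 0"
      using ex_block_diagonalizing_frame[OF W(1), of H] by metis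
    then obtain D where "has_dir_deriv Phi (0, W) (\<tau>, H) D"
      using ex_Phi_dir_deriv_at_zero[OF _ W(2), of W R H \<tau>] by metis
    then show ?thesis using True yh by auto
  next
    case False
    have "(Phi has_derivative PhiD \<epsilon> P d) (at (y + 0 *\<^sub>R h))"
      using has_derivative_Phi[OF W(1) False] by (simp add: yh)
    from has_vector_derivative_right_quotient[OF has_vector_derivative_ray[OF this]]
    show ?thesis unfolding has_dir_deriv_def by auto
  qed
qed

lemma Phi_quadratic_error_at_differentiable:
  fixes y :: "real \<times> 'n::{finite,linorder} symmat"
  obtains C \<delta> where "\<delta> > 0"
    "\<And>z D. norm (z - y) < \<delta> \<Longrightarrow> (Phi has_derivative D) (at z) \<Longrightarrow>
       norm (Phi z - Phi y - D (z - y)) \<le> C * (norm (z - y))\<^sup>2"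
proof -
  obtain \<epsilon> W where y: "y = (\<epsilon>, W)" by (metis surj_pair)
  show ?thesis
  proof (cases "\<epsilon> = 0")
    case True
    obtain C \<delta> where \<delta>: "\<delta> > 0" and C: "\<And>\<epsilon> X P d. \<epsilon> \<noteq> 0 \<Longrightarrow> spectral_decomp X P d \<Longrightarrow> norm ((\<epsilon>, X) - (0, W)) < \<delta> \<Longrightarrow>
       norm (Phi (\<epsilon>, X) - Phi (0, W) - PhiD \<epsilon> P d ((\<epsilon>, X) - (0, W))) \<le> C * (norm ((\<epsilon>, X) - (0, W)))\<^sup>2"
    proof (rule Phi_quadratic_error_at_zero[of W])
      fix C \<delta> assume "\<delta> > 0" "\<And>\<epsilon> X P d. \<epsilon> \<noteq> 0 \<Longrightarrow> spectral_decomp X P d \<Longrightarrow> norm ((\<epsilon>, X) - (0, W)) < \<delta> \<Longrightarrow>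
        norm (Phi (\<epsilon>, X) - Phi (0, W) - PhiD \<epsilon> P d ((\<epsilon>, X) - (0, W))) \<le> C * (norm ((\<epsilon>, X) - (0, W)))\<^sup>2"
      then show thesis by (rule that)
    qed
    show ?thesis
    proof (rule that[OF \<delta>])
      fix z D assume z: "norm (z - y) < \<delta>" and D: "(Phi has_derivative D) (at z)"
      show "norm (Phi z - Phi y - D (z - y)) \<le> C * (norm (z - y))\<^sup>2"
      proof (rule quadratic_error_on_hyperplane[OF continuous_on_Phi _ _ z D])
        fix x :: "real \<times> 'n symmat" assume x: "fst x \<noteq> 0" "norm (x - y) < \<delta>"
        obtain a X where aX: "x = (a, X)" by (metis surj_pair)
        obtain P d where X: "spectral_decomp X P d" by (metis ex_spectral_decomp)
        show "\<exists>D. (Phi has_derivative D) (at x) \<and> norm (Phi x - Phi y - D (x - y)) \<le> C * (norm (x - y))\<^sup>2"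
          using has_derivative_Phi[OF X, of a] C[OF _ X, of a] x by (auto simp: aX y True)
      qed (simp add: y True)
    qed
  next
    case False
    show ?thesis
    proof (rule that)
      show "\<bar>\<epsilon>\<bar> / 4 > 0" using False by simp
      fix z D assume z: "norm (z - y) < \<bar>\<epsilon>\<bar> / 4" and D: "(Phi has_derivative D) (at z)"
      have "z \<in> ball (\<epsilon>, W) (\<bar>\<epsilon>\<bar> / 4)" "y \<in> ball (\<epsilon>, W) (\<bar>\<epsilon>\<bar> / 4)"
        using z False by (auto simp: y dist_norm norm_minus_commute)
      from Phi_quadratic_error_ball(2)[OF this False]
      have "norm (Phi y - Phi z - D (y - z)) \<le> 2 * (real CARD('n) * (real CARD('n) + 2)) / \<bar>\<epsilon>\<bar> * (norm (y - z))\<^sup>2"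
        by (simp only: frechet_derivative_at[OF D, symmetric])
      moreover have "Phi z - Phi y - D (z - y) = - (Phi y - Phi z - D (y - z))"
        using linear_neg[OF has_derivative_linear[OF D], of "y - z"] by simp
      ultimately show "norm (Phi z - Phi y - D (z - y)) \<le> 2 * (real CARD('n) * (real CARD('n) + 2)) / \<bar>\<epsilon>\<bar> * (norm (z - y))\<^sup>2"
        by (simp only: norm_minus_cancel norm_minus_commute[of z y])
    qed
  qed
qed

lemma strongly_semismooth_Phi:
  "strongly_semismooth (Phi :: real \<times> 'n::{finite,linorder} symmat \<Rightarrow> 'n symmat)"
  unfolding strongly_semismooth_def
proof
  fix y :: "real \<times> 'n symmat"
  obtain C \<delta> where "\<delta> > 0" and C: "\<And>z D. norm (z - y) < \<delta> \<Longrightarrow> (Phi has_derivative D) (at z) \<Longrightarrow>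
       norm (Phi z - Phi y - D (z - y)) \<le> C * (norm (z - y))\<^sup>2"
  proof (rule Phi_quadratic_error_at_differentiable[of y])
    fix C \<delta> assume "\<delta> > 0" "\<And>z D. norm (z - y) < \<delta> \<Longrightarrow> (Phi has_derivative D) (at z) \<Longrightarrow>
       norm (Phi z - Phi y - D (z - y)) \<le> C * (norm (z - y))\<^sup>2"
    then show thesis by (rule that)
  qed
  show "strongly_semismooth_at Phi y"
  proof (rule strongly_semismooth_at_if_quadratic_error[OF locally_lipschitz_Phi
        directionally_differentiable_Phi continuous_on_Phi \<open>\<delta> > 0\<close>])
    show "norm (Phi z - Phi y - D (z - y)) \<le> C * (norm (z - y))\<^sup>2"
      if "norm (z - y) < \<delta>" "(Phi has_derivative D) (at z)" for z D
      using that by (rule C)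
  qed
qed

theorem proposition1:
  fixes W :: "'n::{finite,linorder} symmat"
    and P :: "real^'n::{finite,linorder}^'n::{finite,linorder}" and d :: "real^'n::{finite,linorder}"
  assumes "spectral_decomp W P d" and "antimono (($) d)"
  shows
    "(\<forall>\<epsilon>. \<epsilon> \<noteq> 0 \<longrightarrow>
        continuously_differentiable_at Phi (\<epsilon>, W) \<and>
        (\<forall>\<tau> H. mat_of (frechet_derivative Phi (at (\<epsilon>, W)) (\<tau>, H)) =
           P ** (Omega \<epsilon> d * (transpose P ** mat_of H ** P) + \<tau> *\<^sub>R Dcal \<epsilon> d) ** transpose P)) \<and>
     locally_lipschitz (Phi :: real \<times> 'n symmat \<Rightarrow> 'n symmat) \<and>
     (directionally_differentiable_at Phi (0, W) \<and>
      (\<forall>\<tau> H.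
        (\<forall>i. \<exists>l. has_eigval_deriv W H i l) \<and>
        (\<forall>x\<in>range (($) d).
           are_eigenvalues_on (block d x) (transpose P ** mat_of H ** P) (eigval_deriv W H) \<and>
           antimono_on (block d x) (eigval_deriv W H)) \<and>
        (\<exists>R. spectral_decomp W R d \<and> diagonalizes_on UNIV W H R d) \<and>
        (\<forall>R. spectral_decomp W R d \<and> diagonalizes_on {i. d $ i \<ge> 0} W H R d \<longrightarrow>
           mat_of (dir_deriv Phi (0, W) (\<tau>, H)) = Phi_dir_formula W R d \<tau> H))) \<and>
     strongly_semismooth (Phi :: real \<times> 'n symmat \<Rightarrow> 'n symmat)"
proof (intro conjI allI impI)
  show "continuously_differentiable_at Phi (\<epsilon>, W)" if "\<epsilon> \<noteq> 0" for \<epsilon>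
    using that by (rule continuously_differentiable_Phi)
  show "mat_of (frechet_derivative Phi (at (\<epsilon>, W)) (\<tau>, H)) =
      P ** (Omega \<epsilon> d * (transpose P ** mat_of H ** P) + \<tau> *\<^sub>R Dcal \<epsilon> d) ** transpose P"
    if "\<epsilon> \<noteq> 0" for \<epsilon> \<tau> H
    by (simp add: frechet_derivative_Phi[OF assms(1) that] mat_of_PhiD)
  show "locally_lipschitz (Phi :: real \<times> 'n symmat \<Rightarrow> 'n symmat)" by (rule locally_lipschitz_Phi)
  show "strongly_semismooth (Phi :: real \<times> 'n symmat \<Rightarrow> 'n symmat)" by (rule strongly_semismooth_Phi)
  show "directionally_differentiable_at Phi (0, W)" by (rule directionally_differentiable_Phi)
next
  fix \<tau> :: real and H :: "'n symmat"
  obtain R where R: "spectral_decomp W R d"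
    and offdiag: "\<And>i j. i \<noteq> j \<Longrightarrow> d $ i = d $ j \<Longrightarrow> (transpose R ** mat_of H ** R) $ i $ j = 0"
    and sorted: "\<And>i j. i \<le> j \<Longrightarrow> d $ i = d $ j \<Longrightarrow>
       (transpose R ** mat_of H ** R) $ j $ j \<le> (transpose R ** mat_of H ** R) $ i $ i"
    using ex_block_diagonalizing_frame[OF assms(1), of H] by metis
  have deriv: "has_eigval_deriv W H i ((transpose R ** mat_of H ** R) $ i $ i)" for i
    by (rule has_eigval_deriv_block_diagonal[OF R assms(2) offdiag sorted])
  then have eq: "eigval_deriv W H i = (transpose R ** mat_of H ** R) $ i $ i" for i
    by (rule eigval_deriv_eqI)
  show "\<exists>l. has_eigval_deriv W H i l" for i using deriv by blast
  show "\<forall>x\<in>range (($) d).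
      are_eigenvalues_on (block d x) (transpose P ** mat_of H ** P) (eigval_deriv W H) \<and>
      antimono_on (block d x) (eigval_deriv W H)"
  proof (intro ballI conjI)
    fix x
    show "are_eigenvalues_on (block d x) (transpose P ** mat_of H ** P) (eigval_deriv W H)"
      using are_eigenvalues_on_block[OF assms(1) R offdiag] by (simp add: eq[abs_def])
    show "antimono_on (block d x) (eigval_deriv W H)"
      unfolding eq by (rule monotone_onI) (simp add: sorted block_def)
  qed
  show "\<exists>R. spectral_decomp W R d \<and> diagonalizes_on UNIV W H R d"
    using R offdiag by (auto simp: diagonalizes_on_def eq)
  fix R' assume R': "spectral_decomp W R' d \<and> diagonalizes_on {i. d $ i \<ge> 0} W H R' d"
  then have W: "spectral_decomp W R' d"
    and diag: "\<And>i k. d $ i = d $ k \<Longrightarrow> 0 \<le> d $ i \<Longrightarrow>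
      (transpose R' ** mat_of H ** R') $ i $ k = (if i = k then eigval_deriv W H i else 0)"
    by (auto simp: diagonalizes_on_def)
  obtain D where D: "has_dir_deriv Phi (0, W) (\<tau>, H) D"
    "mat_of D = R' ** (diag_mat (\<chi> i. huber_dir \<tau> (d $ i) ((transpose R' ** mat_of H ** R') $ i $ i))
       + (\<chi> i j. block_slope (d $ i) (d $ j) * (transpose R' ** mat_of H ** R') $ i $ j)) ** transpose R'"
  proof (rule ex_Phi_dir_deriv_at_zero[OF W assms(2), of H \<tau>])
    show "(transpose R' ** mat_of H ** R') $ i $ j = 0" if "i \<noteq> j" "d $ i = d $ j" "0 \<le> d $ i" for i j
      using diag[OF that(2,3)] that(1) by simp
  qed (rule that)
  have "huber_dir \<tau> (d $ i) ((transpose R' ** mat_of H ** R') $ i $ i) = huber_dir \<tau> (d $ i) (eigval_deriv W H i)" for i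
    using diag[of i i] by (auto simp: huber_dir_def)
  then show "mat_of (dir_deriv Phi (0, W) (\<tau>, H)) = Phi_dir_formula W R' d \<tau> H"
    by (simp add: dir_deriv_eqI[OF D(1)] D(2) Phi_dir_formula_eq)
qed

end
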